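(* Let $\lambda>0$ and let $F:\mathbb{C}\to\mathbb{C}$ be an entire function of exponential type at most $\pi$. Then $$\lambda^{-1/2}\int_{-1/2}^{1/2}\theta_1\bigl(u,i\lambda^{-1}\bigr)\,du\ \le\ \int_{-\infty}^{\infty}\bigl|G_\lambda(x)-F(x)\bigr|\,dx,$$ and there is equality if and only if $F(z)=K_\lambda(z)$.
   Context: An entire function $F$ is of exponential type at most $2\pi\delta$ if for every $\epsilon>0$ there is a constant $C>0$ with $|F(z)|\le C e^{(2\pi\delta+\epsilon)|z|}$ for all $z\in\mathbb{C}$. For $\lambda>0$, $G_\lambda(z)=e^{-\pi\lambda z^2}$, and $K_\lambda$ is the entire function (of exponential type $\pi$) $$K_\lambda(z)=\frac{\cos\pi z}{\pi}\sum_{n=-\infty}^{\infty}(-1)^{n+1}\frac{G_\lambda(n+\frac12)}{z-n-\frac12}$$ (with removable singularities at $\mathbb{Z}+\frac12$ filled in). With $e(z)=e^{2\pi i z}$, $\Im\tau>0$ and $q=e^{\pi i\tau}$ (and $q^{s}=e^{\pi i\tau s}$), $\theta_1(v,\tau)=\sum_{n=-\infty}^{\infty}q^{(n+\frac12)^2}e\bigl((n+\tfrac12)v\bigr)$. The integral on the right may be $+\infty$. *)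

theory Defs
  imports "HOL-Complex_Analysis.Complex_Analysis"
begin

definition entire_exp_type_le :: "real \<Rightarrow> (complex \<Rightarrow> complex) \<Rightarrow> bool" where
  "entire_exp_type_le t F \<longleftrightarrow>
     F holomorphic_on UNIV \<and>
     (\<forall>\<epsilon>>0. \<exists>C>0. \<forall>z. norm (F z) \<le> C * exp ((t + \<epsilon>) * norm z))"

definition gaussian :: "real \<Rightarrow> complex \<Rightarrow> complex" where
  "gaussian lam z = exp (- of_real (pi * lam) * z\<^sup>2)"

definition K_raw :: "real \<Rightarrow> complex \<Rightarrow> complex" where
  "K_raw lam z = cos (of_real pi * z) / of_real pi *
     (\<Sum>\<^sub>\<infinity>n::int. (-1) powi (n + 1) * gaussian lam (of_int n + 1/2) / (z - of_int n - 1/2))"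

text \<open>
  At a half-integer the term of the series with vanishing denominator is \<open>0\<close> by
  the convention on division, so \<open>K_raw\<close> takes a wrong value there;
  \<^const>\<open>remove_sings\<close> replaces it by the limit.
\<close>

definition K :: "real \<Rightarrow> complex \<Rightarrow> complex" where
  "K lam = remove_sings (K_raw lam)"

text \<open>
  With \<open>q = exp (\<pi> \<i> \<tau>)\<close>, the power \<open>q\<^sup>s\<close> means \<open>exp (\<pi> \<i> \<tau> s)\<close>.
\<close>

definition theta1 :: "complex \<Rightarrow> complex \<Rightarrow> complex" where
  "theta1 v \<tau> = (\<Sum>\<^sub>\<infinity>n::int.
     exp (of_real pi * \<i> * \<tau> * (of_int n + 1/2)\<^sup>2) *
     exp (2 * of_real pi * \<i> * ((of_int n + 1/2) * v)))"

text \<open>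
  On the real line, and for purely imaginary \<open>\<tau>\<close>, the theta function is real-valued, so
  nothing is lost by passing to the real part.
\<close>

lemma theta1_real: "theta1 (of_real u) (\<i> * of_real t) \<in> \<real>"
proof -
  let ?f = "\<lambda>n::int. exp (of_real pi * \<i> * (\<i> * of_real t) * (of_int n + 1/2)\<^sup>2) *
     exp (2 * of_real pi * \<i> * ((of_int n + 1/2) * complex_of_real u))"
  have bij: "bij (\<lambda>n::int. - 1 - n)"
    by (rule bij_betwI[where g = "\<lambda>n. - 1 - n"]) auto
  have eq: "cnj (?f n) = ?f (- 1 - n)" for n
    by (simp add: exp_cnj power2_eq_square algebra_simps flip: exp_add)
  have "cnj (infsum ?f UNIV) = (\<Sum>\<^sub>\<infinity>n. cnj (?f n))"
    by (rule infsum_cnj [symmetric])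
  also have "\<dots> = (\<Sum>\<^sub>\<infinity>n. ?f (- 1 - n))"
    by (simp only: eq)
  also have "\<dots> = infsum ?f UNIV"
    by (rule infsum_reindex_bij_betw [OF bij])
  finally show ?thesis
    by (simp add: theta1_def Reals_cnj_iff)
qed

end

theory Submission
  imports Defs "HOL-Probability.Probability"
begin

text \<open>
  Let \<open>\<sigma> x = sgn (cos (pi * x))\<close>. Its Fourier frequencies are the odd multiples of \<open>pi\<close>, whereas the
  Fourier transform of an integrable function of exponential type \<open>pi\<close> lives on \<open>[-pi, pi]\<close> and, being
  continuous, vanishes at the two end points. So \<open>\<sigma>\<close> annihilates every integrable \<open>F\<close> of the given
  type (\<open>square_wave_annihilates_exp_type\<close>), and with \<open>G\<close> the Gaussian
  \<open>\<integral>\<bar>G - F\<bar> \<ge> \<integral>(G - F) \<sigma> = \<integral>G \<sigma>\<close>.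
  Expanding \<open>\<sigma>\<close> in its Fourier series and integrating the theta series termwise shows that the last
  integral is the left-hand side of the theorem (\<open>gaussian_square_wave_eq_theta\<close>).

  Equality forces \<open>(G - F) \<sigma> = \<bar>G - F\<bar>\<close> almost everywhere. As \<open>\<sigma>\<close> changes sign at each half-integer, \<open>F\<close>
  must agree with \<open>G\<close> there (\<open>zero_at_half_int_of_sign\<close>). Now \<open>F\<close> is bounded by a multiple of
  \<open>exp (pi * \<bar>Im z\<bar>)\<close> (\<open>integrable_exp_type_bound\<close>), so the residues of \<open>F w / (cos (pi * w) * w * (w - z))\<close>
  recover \<open>F\<close> from its values at the half-integers up to a multiple of \<open>cos (pi * z)\<close>
  (\<open>interpolation_series\<close>). That multiple is zero because \<open>F\<close> and the restriction of \<open>K\<close> to the real line are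
  integrable and the cosine is not; hence \<open>F = K\<close> (\<open>interpolant_unique\<close>).

  If \<open>F = K\<close>, equality holds as soon as \<open>G - K\<close> has the sign of \<open>cos (pi * x)\<close>
  (\<open>gaussian_minus_interpolant_sign\<close>). To see this, regard \<open>G\<close> as the function \<open>exp (- l * s)\<close> of \<open>s = x\<^sup>2\<close>,
  where \<open>l = pi * lam\<close>. The cosine product and Wallis' product show that \<open>K\<close> is the limit of the Lagrange
  polynomials in \<open>s\<close> that interpolate \<open>exp (- l * s)\<close> at the squares of the first \<open>N\<close> positive half-integers
  \<open>n + 1/2\<close>. By the error formula of Lagrange interpolation, the error of such a polynomial is a derivative of
  order \<open>N\<close> of \<open>exp (- l * s)\<close>, divided by \<open>N!\<close>, times the product of the \<open>s - (k + 1/2)\<^sup>2\<close>, \<open>k < N\<close>. The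
  derivatives of \<open>exp (- l * s)\<close> alternate in sign, so the error has the sign of the partial products of
  the cosine.
\<close>

section \<open>Laplace transforms on half-lines\<close>

text \<open>
  Cauchy's inequality on a smaller disc bounds the difference quotients of \<open>k\<close> in \<open>z\<close> uniformly in \<open>x\<close>, so
  that dominated convergence applies to them.
\<close>

lemma holomorphic_integral_parameter:
  fixes f :: "'a \<Rightarrow> complex" and k :: "complex \<Rightarrow> 'a \<Rightarrow> complex"
  assumes U: "open U" and f: "integrable M f"
    and meas: "\<And>z. z \<in> U \<Longrightarrow> k z \<in> borel_measurable M"
    and holo: "\<And>x. x \<in> space M \<Longrightarrow> (\<lambda>z. k z x) holomorphic_on U"
    and bound: "\<And>z x. z \<in> U \<Longrightarrow> x \<in> space M \<Longrightarrow> norm (k z x) \<le> B"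
  shows "(\<lambda>z. \<integral>x. f x * k z x \<partial>M) holomorphic_on U"
proof (subst holomorphic_on_open[OF U], intro ballI)
  fix z assume z: "z \<in> U"
  obtain r where r: "r > 0" "cball z r \<subseteq> U"
    using U z open_contains_cball by blast
  define k' where "k' x = deriv (\<lambda>z. k z x) z" for x
  define I where "I w = (\<integral>x. f x * k w x \<partial>M)" for w
  have fm: "f \<in> borel_measurable M" using f by simp
  have B: "norm (k w x) \<le> B" if "w \<in> cball z r" "x \<in> space M" for w x
    using bound r that by blast
  have int: "integrable M (\<lambda>x. f x * k w x)" if "w \<in> U" for w
  proof (rule Bochner_Integration.integrable_bound[of M "\<lambda>x. norm (f x) * B"])
    show "integrable M (\<lambda>x. norm (f x) * B)" using f by simp
    show "(\<lambda>x. f x * k w x) \<in> borel_measurable M" using fm meas[OF that] by simp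
    show "AE x in M. norm (f x * k w x) \<le> norm (norm (f x) * B)"
    proof (rule AE_I2)
      fix x assume "x \<in> space M"
      then have "norm (k w x) \<le> \<bar>B\<bar>" using bound[OF that] by fastforce
      then show "norm (f x * k w x) \<le> norm (norm (f x) * B)"
        by (simp add: norm_mult abs_mult mult_left_mono)
    qed
  qed
  have lip: "norm (k w x - k z x) \<le> 2 * B / r * norm (w - z)"
    if w: "w \<in> ball z (r/2)" and x: "x \<in> space M" for w x
  proof -
    have h: "(\<lambda>z. k z x) holomorphic_on U" by (rule holo[OF x])
    have "norm ((\<lambda>w. k w x) w - (\<lambda>w. k w x) z) \<le> 2 * B / r * norm (w - z)"
    proof (rule field_differentiable_bound[of "ball z (r/2)"])
      fix v assume v: "v \<in> ball z (r/2)"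
      then have sub: "cball v (r/2) \<subseteq> cball z r"
        using dist_triangle_half_l[of z v r] by (auto simp: dist_norm) (smt (verit, best) dist_norm dist_triangle field_sum_of_halves norm_minus_commute)
      have vU: "v \<in> U" using sub r by (auto dest!: subsetD[of _ _ v])
      show "((\<lambda>w. k w x) has_field_derivative deriv (\<lambda>w. k w x) v) (at v within ball z (r/2))"
        using h U vU holomorphic_derivI by blast
      have "norm ((deriv ^^ 1) (\<lambda>w. k w x) v) \<le> fact 1 * B / (r/2) ^ 1"
      proof (rule Cauchy_inequality)
        show "(\<lambda>w. k w x) holomorphic_on ball v (r/2)"
          using h sub r(2) by (meson ball_subset_cball holomorphic_on_subset subset_trans)
        show "continuous_on (cball v (r/2)) (\<lambda>w. k w x)"
          using h sub r(2) by (meson holomorphic_on_imp_continuous_on holomorphic_on_subset subset_trans)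
        show "0 < r / 2" using r by simp
        fix y assume "norm (v - y) = r/2"
        then have "y \<in> cball v (r/2)" by (simp add: dist_norm)
        then show "norm (k y x) \<le> B" using B x sub by blast
      qed
      then show "norm (deriv (\<lambda>w. k w x) v) \<le> 2 * B / r" by (simp add: mult.commute)
    qed (use w r in auto)
    then show ?thesis by simp
  qed
  have "((\<lambda>w. (I w - I z) / (w - z)) \<longlongrightarrow> (\<integral>x. f x * k' x \<partial>M)) (at z within ball z (r/2))"
    unfolding tendsto_at_iff_sequentially
  proof (intro allI impI)
    fix X assume X: "\<forall>i. X i \<in> ball z (r/2) - {z}" and lim: "X \<longlonglongrightarrow> z"
    have XU: "X i \<in> U" and Xn: "X i \<noteq> z" and Xb: "X i \<in> ball z (r/2)" for i
    proof -
      show b: "X i \<in> ball z (r/2)" "X i \<noteq> z" using X by auto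
      then have "X i \<in> cball z r" using r(1) by auto
      then show "X i \<in> U" using r(2) by blast
    qed
    define s where "s i x = f x * ((k (X i) x - k z x) / (X i - z))" for i x
    have eq: "(I (X i) - I z) / (X i - z) = integral\<^sup>L M (s i)" for i
    proof -
      have "I (X i) - I z = (\<integral>x. f x * k (X i) x - f x * k z x \<partial>M)"
        unfolding I_def by (simp add: Bochner_Integration.integral_diff[OF int[OF XU] int[OF z]])
      also have "\<dots> / (X i - z) = (\<integral>x. (f x * k (X i) x - f x * k z x) / (X i - z) \<partial>M)"
        by simp
      also have "\<dots> = integral\<^sup>L M (s i)"
        unfolding s_def by (simp add: algebra_simps)
      finally show ?thesis .
    qed
    have smeas: "s i \<in> borel_measurable M" for i
      unfolding s_def using fm meas[OF XU] meas[OF z] by measurable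
    have slim: "(\<lambda>i. s i x) \<longlonglongrightarrow> f x * k' x" if x: "x \<in> space M" for x
    proof -
      have "((\<lambda>z. k z x) has_field_derivative k' x) (at z)"
        unfolding k'_def using holo[OF x] U z holomorphic_derivI by blast
      then have "((\<lambda>w. (k w x - k z x) / (w - z)) \<longlongrightarrow> k' x) (at z)"
        by (simp add: has_field_derivative_iff)
      then have "(\<lambda>i. (k (X i) x - k z x) / (X i - z)) \<longlonglongrightarrow> k' x"
        using lim Xn unfolding tendsto_at_iff_sequentially o_def by auto
      then show ?thesis unfolding s_def by (intro tendsto_intros)
    qed
    have k'm: "(\<lambda>x. f x * k' x) \<in> borel_measurable M"
      by (rule borel_measurable_LIMSEQ_metric[of s]) (use smeas slim in auto)
    have "(\<lambda>i. integral\<^sup>L M (s i)) \<longlonglongrightarrow> (\<integral>x. f x * k' x \<partial>M)"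
    proof (rule integral_dominated_convergence[where w = "\<lambda>x. norm (f x) * (2 * B / r)"])
      show "AE x in M. norm (s i x) \<le> norm (f x) * (2 * B / r)" for i
      proof (rule AE_I2)
        fix x assume "x \<in> space M"
        then have "norm (k (X i) x - k z x) \<le> 2 * B / r * norm (X i - z)"
          by (rule lip[OF Xb])
        moreover have "norm (X i - z) > 0" using Xn by simp
        ultimately have "norm ((k (X i) x - k z x) / (X i - z)) \<le> 2 * B / r"
          unfolding norm_divide by (metis pos_divide_le_eq)
        then show "norm (s i x) \<le> norm (f x) * (2 * B / r)"
          unfolding s_def norm_mult by (rule mult_left_mono) simp
      qed
    qed (use f smeas slim k'm in auto)
    then show "((\<lambda>w. (I w - I z) / (w - z)) \<circ> X) \<longlonglongrightarrow> (\<integral>x. f x * k' x \<partial>M)"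
      by (simp add: o_def eq)
  qed
  then have "((\<lambda>w. (I w - I z) / (w - z)) \<longlongrightarrow> (\<integral>x. f x * k' x \<partial>M)) (at z)"
    using r by (simp add: at_within_open[of z "ball z (r/2)"])
  then show "\<exists>d. ((\<lambda>z. \<integral>x. f x * k z x \<partial>M) has_field_derivative d) (at z)"
    unfolding has_field_derivative_iff I_def by blast
qed

lemma holomorphic_laplace:
  fixes g :: "real \<Rightarrow> complex"
  assumes "set_integrable lborel {0..} (\<lambda>x. g x * exp (- of_real (a * x)))"
  shows "(\<lambda>s. LBINT x:{0..}. g x * exp (- s * of_real x)) holomorphic_on {s. Re s > a}"
proof -
  let ?f = "\<lambda>x. indicator {0..} x *\<^sub>R (g x * exp (- of_real (a * x)))"
  let ?k = "\<lambda>(s::complex) (x::real). indicator {0..} x *\<^sub>R exp (- (s - of_real a) * of_real x)"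
  have eq: "(LBINT x:{0..}. g x * exp (- s * of_real x)) = (\<integral>x. ?f x * ?k s x \<partial>lborel)" for s
    unfolding set_lebesgue_integral_def
    by (rule Bochner_Integration.integral_cong)
       (auto simp: indicator_def algebra_simps simp flip: exp_add)
  have "(\<lambda>s. \<integral>x. ?f x * ?k s x \<partial>lborel) holomorphic_on {s. Re s > a}"
  proof (rule holomorphic_integral_parameter[where B = 1])
    show "open {s. Re s > a}" by (rule open_halfspace_Re_gt)
    show "integrable lborel ?f" using assms by (simp add: set_integrable_def)
    show "?k z \<in> borel_measurable lborel" for z
    proof -
      have [measurable]: "(\<lambda>x. exp (- (z - of_real a) * complex_of_real x)) \<in> borel_measurable borel"
        by (intro borel_measurable_continuous_onI continuous_intros)
      show ?thesis by measurable
    qed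
    show "(\<lambda>z. ?k z x) holomorphic_on {s. Re s > a}" for x
      by (cases "x \<ge> 0") (auto intro!: holomorphic_intros)
    show "norm (?k z x) \<le> 1" if "z \<in> {s. Re s > a}" for z x
      using that by (cases "x \<ge> 0") (auto simp: mult_nonpos_nonneg)
  qed
  then show ?thesis by (simp only: eq)
qed

lemma set_integrable_exp_minus:
  assumes "a > 0"
  shows "set_integrable lborel {0..} (\<lambda>x::real. exp (- (a * x)))"
proof -
  have "set_integrable lebesgue {0..} (\<lambda>x::real. exp (- a * x))"
    using assms by (intro nonnegative_absolutely_integrable_1 integrable_on_exp_minus_to_infinity) auto
  then show ?thesis
    unfolding set_integrable_def
    by (subst (asm) integrable_completion) auto
qed

lemma entire_along_line_measurable:
  assumes "F holomorphic_on UNIV"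
  shows "(\<lambda>x::real. F (c * of_real x)) \<in> borel_measurable borel"
  by (rule borel_measurable_continuous_onI)
     (intro continuous_on_compose2[OF holomorphic_on_imp_continuous_on[OF assms]] continuous_intros, auto)

lemma set_integrable_exp_growth:
  assumes F: "F holomorphic_on UNIV" and F_bound: "\<And>z. norm (F z) \<le> C * exp (m * norm z)"
    and "norm c = 1" and s: "Re s > m"
  shows "set_integrable lborel {0..} (\<lambda>x. F (c * of_real x) * exp (- s * of_real x))"
proof (rule set_integrable_bound[of _ _ "\<lambda>x. C * exp (- ((Re s - m) * x))"])
  show "set_integrable lborel {0..} (\<lambda>x. C * exp (- ((Re s - m) * x)))"
    using s by (intro set_integrable_mult_right set_integrable_exp_minus) auto
  show "set_borel_measurable lborel {0..} (\<lambda>x. F (c * of_real x) * exp (- s * of_real x))"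
    unfolding set_borel_measurable_def using entire_along_line_measurable[OF F] by measurable
  have "norm (F (c * of_real x) * exp (- s * of_real x)) \<le> C * exp (- ((Re s - m) * x))"
    if "x \<ge> 0" for x
  proof -
    have "norm (F (c * of_real x) * exp (- s * of_real x))
        \<le> (C * exp (m * norm (c * of_real x))) * exp (- (Re s * x))"
      unfolding norm_mult[of "F _"] using F_bound order_trans[OF norm_ge_zero F_bound] by (intro mult_mono) auto
    also have "\<dots> = C * exp (- ((Re s - m) * x))"
      using \<open>norm c = 1\<close> that by (simp add: norm_mult algebra_simps flip: exp_add)
    finally show ?thesis .
  qed
  moreover have "C \<ge> 0" using order_trans[OF norm_ge_zero F_bound[of 0]] by simp
  ultimately show "AE x in lborel. x \<in> {0..} \<longrightarrow> norm (F (c * of_real x) * exp (- s * of_real x))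
      \<le> norm (C * exp (- ((Re s - m) * x)))"
    by (intro AE_I2) (simp add: abs_mult)
qed

text \<open>
  The two integrals are limits of differences \<open>P R - P 0\<close> and \<open>P (\<i> * R) - P 0\<close> of a primitive \<open>P\<close> of
  \<open>F z * exp (- s * z)\<close>. On the segment from \<open>R\<close> to \<open>\<i> * R\<close> both coordinates of \<open>z\<close> are nonnegative with sum
  \<open>R \<ge> norm z\<close>, so \<open>Re (s * z)\<close> exceeds \<open>m * norm z\<close> by a multiple of \<open>R\<close> and the increment of \<open>P\<close> along the
  segment tends to \<open>0\<close>.
\<close>

lemma laplace_rotate_quarter:
  assumes F: "F holomorphic_on UNIV" and F_bound: "\<And>z. norm (F z) \<le> C * exp (m * norm z)"
    and "m \<ge> 0" and s: "Re s > m" "Im s < - m"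
  shows "(LBINT x:{0..}. F (of_real x) * exp (- s * of_real x)) =
         \<i> * (LBINT y:{0..}. F (\<i> * of_real y) * exp (- (\<i> * s) * of_real y))"
proof -
  define f where "f z = F z * exp (- s * z)" for z
  have "f holomorphic_on UNIV" unfolding f_def by (intro holomorphic_intros F)
  then obtain P where P: "\<And>z. (P has_field_derivative f z) (at z)"
    using holomorphic_convex_primitive'[of UNIV f] by auto
  define \<delta> where "\<delta> = min (Re s) (- Im s) - m"
  have \<delta>: "\<delta> > 0" using s by (simp add: \<delta>_def)
  have "C \<ge> 0" using order_trans[OF norm_ge_zero F_bound[of 0]] by simp
  have cf: "continuous_on A f" for A
    by (rule holomorphic_on_imp_continuous_on)
       (use \<open>f holomorphic_on UNIV\<close> holomorphic_on_subset in blast)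
  have ftc: "(LBINT x:{0..R}. c * f (c * of_real x)) = P (c * of_real R) - P 0"
    if "R \<ge> 0" for R :: real and c
  proof -
    have "(LBINT x:{0..R}. c * f (c * of_real x)) = P (c * of_real R) - P (c * of_real 0)"
      unfolding set_lebesgue_integral_def
    proof (rule integral_FTC_atLeastAtMost[OF that])
      fix x assume "0 \<le> x" "x \<le> R"
      have "((\<lambda>x. c * of_real x) has_vector_derivative c) (at x within {0..R})"
        by (auto intro!: derivative_eq_intros has_vector_derivative_real_field)
      from field_vector_diff_chain_within[OF this, of P]
      show "((\<lambda>x. P (c * of_real x)) has_vector_derivative c * f (c * of_real x)) (at x within {0..R})"
        using has_field_derivative_at_within[OF P] by (simp add: o_def)
    next
      show "continuous_on {0..R} (\<lambda>x. c * f (c * of_real x))"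
        by (intro continuous_intros continuous_on_compose2[OF cf[of UNIV]]) auto
    qed
    then show ?thesis by simp
  qed
  have lim: "((\<lambda>R. P (c * of_real R) - P 0) \<longlongrightarrow> c * (LBINT x:{0..}. F (c * of_real x) * exp (- (c * s) * of_real x))) at_top"
    if c: "norm c = 1" "Re (c * s) > m" for c
  proof -
    have "((\<lambda>R. LBINT x:{0..R}. c * f (c * of_real x)) \<longlongrightarrow> (LBINT x:{0..}. c * f (c * of_real x))) at_top"
    proof (rule tendsto_set_lebesgue_integral_at_top)
      show "set_integrable lborel {0..} (\<lambda>x. c * f (c * of_real x))"
        using set_integrable_mult_right[OF set_integrable_exp_growth[OF F F_bound c], of c]
        by (simp add: f_def algebra_simps)
    qed auto
    then have "((\<lambda>R. P (c * of_real R) - P 0) \<longlongrightarrow> (LBINT x:{0..}. c * f (c * of_real x))) at_top"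
      by (rule Lim_transform_eventually) (rule eventually_mono[OF eventually_ge_at_top[of 0] ftc])
    then show ?thesis by (simp add: f_def algebra_simps)
  qed
  have "((\<lambda>R. P (of_real R) - P (\<i> * of_real R)) \<longlongrightarrow> 0) at_top"
  proof (rule Lim_null_comparison[of _ "\<lambda>R. C * exp (- \<delta> * R) * (2 * R)"])
    show "((\<lambda>R. C * exp (- \<delta> * R) * (2 * R)) \<longlongrightarrow> 0) at_top"
      using \<delta> by real_asymp
    show "\<forall>\<^sub>F R in at_top. norm (P (of_real R) - P (\<i> * of_real R)) \<le> C * exp (- \<delta> * R) * (2 * R)"
    proof (rule eventually_mono[OF eventually_ge_at_top[of 0]])
      fix R :: real assume R: "R \<ge> 0"
      have "norm (P (of_real R) - P (\<i> * of_real R)) \<le> C * exp (- \<delta> * R) * norm (of_real R - \<i> * of_real R)"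
      proof (rule field_differentiable_bound[of "closed_segment (of_real R) (\<i> * of_real R)" P f])
        fix z assume z: "z \<in> closed_segment (of_real R) (\<i> * of_real R)"
        then obtain u where u: "0 \<le> u" "u \<le> 1" "z = (1 - u) *\<^sub>R of_real R + u *\<^sub>R (\<i> * of_real R)"
          by (auto simp: in_segment)
        have re: "Re z = (1 - u) * R" and im: "Im z = u * R" using u by auto
        have pos: "Re z \<ge> 0" "Im z \<ge> 0" using re im u R by auto
        have sum: "Re z + Im z = R" by (simp add: re im algebra_simps)
        have nz: "norm z \<le> R" using cmod_le[of z] pos sum by simp
        have "Re (s * z) = Re s * Re z + (- Im s) * Im z" by simp
        also have "\<dots> \<ge> (m + \<delta>) * Re z + (m + \<delta>) * Im z"
          using pos by (intro add_mono mult_right_mono) (auto simp: \<delta>_def)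
        finally have re_sz: "Re (s * z) \<ge> (m + \<delta>) * R" using sum by (metis distrib_left)
        have "norm (f z) \<le> (C * exp (m * norm z)) * exp (- Re (s * z))"
          unfolding f_def norm_mult[of "F z"] using F_bound order_trans[OF norm_ge_zero F_bound]
          by (intro mult_mono) auto
        also have "\<dots> \<le> (C * exp (m * R)) * exp (- ((m + \<delta>) * R))"
          using re_sz nz \<open>C \<ge> 0\<close> \<open>m \<ge> 0\<close> by (intro mult_mono) (auto intro!: mult_left_mono)
        also have "\<dots> = C * exp (- \<delta> * R)" by (simp add: algebra_simps flip: exp_add)
        finally show "norm (f z) \<le> C * exp (- \<delta> * R)" .
        show "(P has_field_derivative f z) (at z within closed_segment (of_real R) (\<i> * of_real R))"
          by (rule has_field_derivative_at_within[OF P])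
      qed auto
      also have "\<dots> \<le> C * exp (- \<delta> * R) * (2 * R)"
      proof (rule mult_left_mono)
        show "norm (complex_of_real R - \<i> * of_real R) \<le> 2 * R"
          using norm_triangle_ineq4[of "complex_of_real R" "\<i> * of_real R"] R by (simp add: norm_mult)
      qed (use \<open>C \<ge> 0\<close> in auto)
      finally show "norm (P (of_real R) - P (\<i> * of_real R)) \<le> C * exp (- \<delta> * R) * (2 * R)" .
    qed
  qed
  moreover have "((\<lambda>R. P (of_real R) - P (\<i> * of_real R)) \<longlongrightarrow>
      (LBINT x:{0..}. F (of_real x) * exp (- s * of_real x)) -
      \<i> * (LBINT y:{0..}. F (\<i> * of_real y) * exp (- (\<i> * s) * of_real y))) at_top"
    using tendsto_diff[OF lim[of 1] lim[of \<i>]] s by simp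
  ultimately show ?thesis
    using tendsto_unique[OF trivial_limit_at_top_linorder] by fastforce
qed

section \<open>Fourier transforms of integrable functions of exponential type\<close>

lemma entire_exp_type_leE:
  assumes "entire_exp_type_le t F" "m > t"
  obtains C where "\<And>z. norm (F z) \<le> C * exp (m * norm z)"
  using assms(2) assms(1)[unfolded entire_exp_type_le_def, THEN conjunct2, rule_format, of "m - t"]
  by (metis add.commute diff_add_cancel diff_gt_0_iff_gt)

text \<open>
  The contour cannot be turned directly at this frequency, since nothing is known about the pointwise decay of
  \<open>F\<close> near the real axis. Instead both sides are values at \<open>s = - \<i> * \<xi>\<close> of Laplace transforms. The one along
  the real axis is holomorphic for \<open>Re s > 0\<close> and continuous up to the boundary because \<open>F\<close> is integrable
  there; the one along the imaginary axis is holomorphic for \<open>Im s < - m\<close> because of the exponential type.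
  They agree on the quadrant where \<open>laplace_rotate_quarter\<close> applies, hence on the intersection of their half-planes.
\<close>

lemma half_line_fourier_rotate:
  assumes F: "entire_exp_type_le t F" and "t \<ge> 0" and \<xi>: "\<xi> > t"
    and int: "set_integrable lborel {0..} (\<lambda>x. F (of_real x))"
  shows "(LBINT x:{0..}. F (of_real x) * exp (\<i> * of_real \<xi> * of_real x)) =
         \<i> * (LBINT y:{0..}. F (\<i> * of_real y) * exp (- of_real \<xi> * of_real y))"
proof -
  \<comment> \<open>Any growth rate strictly between the type and \<open>\<xi>\<close> leaves room on both sides.\<close>
  define m where "m = (t + \<xi>) / 2"
  have m: "m > t" "m < \<xi>" "m \<ge> 0" using \<xi> \<open>t \<ge> 0\<close> by (auto simp: m_def)
  obtain C where C: "\<And>z. norm (F z) \<le> C * exp (m * norm z)"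
    using entire_exp_type_leE[OF F m(1)] by blast
  have hol: "F holomorphic_on UNIV" using F by (simp add: entire_exp_type_le_def)
  define \<Phi> where "\<Phi> s = (LBINT x:{0..}. F (of_real x) * exp (- s * of_real x))" for s
  define \<Psi> where "\<Psi> s = \<i> * (LBINT y:{0..}. F (\<i> * of_real y) * exp (- (\<i> * s) * of_real y))" for s
  let ?D = "{s. Re s > 0} \<inter> {s. Im s < - m}"
  let ?E = "{s. Re s > m} \<inter> {s. Im s < - m}"
  have \<Phi>_hol: "\<Phi> holomorphic_on {s. Re s > 0}"
    unfolding \<Phi>_def by (rule holomorphic_laplace) (use int in simp)
  have \<Psi>_hol: "\<Psi> holomorphic_on {s. Im s < - m}"
  proof -
    have "(\<lambda>s. LBINT y:{0..}. F (\<i> * of_real y) * exp (- s * of_real y)) holomorphic_on {s. Re s > m'}"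
      if "m' > m" for m'
      using set_integrable_exp_growth[OF hol C, of \<i> "of_real m'"] that
      by (intro holomorphic_laplace) (simp add: algebra_simps)
    then have "(\<lambda>s. LBINT y:{0..}. F (\<i> * of_real y) * exp (- s * of_real y)) holomorphic_on (\<Union>m'\<in>{m<..}. {s. Re s > m'})"
      by (intro holomorphic_on_UN_open) (auto simp: open_halfspace_Re_gt)
    also have "(\<Union>m'\<in>{m<..}. {s. Re s > m'}) = {s. Re s > m}"
      by (auto dest: dense)
    finally have "((\<lambda>s. LBINT y:{0..}. F (\<i> * of_real y) * exp (- s * of_real y)) \<circ> (\<lambda>s. \<i> * s)) holomorphic_on {s. Im s < - m}"
      by (intro holomorphic_on_compose_gen[of _ _ _ "{s. Re s > m}"] holomorphic_intros) auto
    then show ?thesis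
      unfolding \<Psi>_def by (intro holomorphic_intros) (simp add: o_def)
  qed
  have agree: "\<Phi> s = \<Psi> s" if "s \<in> ?D" for s
  proof (rule analytic_continuation_open[of ?E ?D \<Phi> \<Psi>])
    show "open ?E" "open ?D"
      by (intro open_Int open_halfspace_Re_gt open_halfspace_Im_lt)+
    have "Complex (m + 1) (- m - 1) \<in> ?E" by simp
    then show "?E \<noteq> {}" by blast
    show "connected ?D"
      by (intro convex_connected convex_Int convex_halfspace_Re_gt convex_halfspace_Im_lt)
    show "?E \<subseteq> ?D" using m by auto
    show "\<Phi> holomorphic_on ?D" "\<Psi> holomorphic_on ?D"
      by (rule holomorphic_on_subset[OF \<Phi>_hol], blast) (rule holomorphic_on_subset[OF \<Psi>_hol], blast)
    show "\<Phi> z = \<Psi> z" if "z \<in> ?E" for z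
      unfolding \<Phi>_def \<Psi>_def by (rule laplace_rotate_quarter[OF hol C]) (use that m in auto)
  qed (rule that)
  \<comment> \<open>The boundary point \<open>- \<i> * \<xi>\<close> is approached from inside the common domain.\<close>
  define s where "s n = of_real (1 / real (Suc n)) - \<i> * of_real \<xi>" for n
  have s_lim: "s \<longlonglongrightarrow> - \<i> * of_real \<xi>"
  proof -
    have "(\<lambda>n. of_real (1 / real (Suc n)) - \<i> * of_real \<xi>) \<longlonglongrightarrow> of_real 0 - \<i> * of_real \<xi>"
      using LIMSEQ_inverse_real_of_nat by (intro tendsto_intros) (simp add: divide_inverse)
    moreover have "s = (\<lambda>n. of_real (1 / real (Suc n)) - \<i> * of_real \<xi>)"
      by (auto simp: s_def)
    ultimately show ?thesis by simp
  qed
  have "(\<lambda>n. \<Psi> (s n)) \<longlonglongrightarrow> \<Psi> (- \<i> * of_real \<xi>)"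
  proof (rule continuous_on_tendsto_compose[of "{s. Im s < - m}" \<Psi>])
    show "continuous_on {s. Im s < - m} \<Psi>" by (rule holomorphic_on_imp_continuous_on[OF \<Psi>_hol])
    show "s \<longlonglongrightarrow> - \<i> * of_real \<xi>" by (rule s_lim)
  qed (use m in \<open>auto simp: s_def\<close>)
  moreover have "(\<lambda>n. \<Phi> (s n)) \<longlonglongrightarrow> \<Phi> (- \<i> * of_real \<xi>)"
    unfolding \<Phi>_def set_lebesgue_integral_def
  proof (rule integral_dominated_convergence[where w = "\<lambda>x. norm (indicator {0..} x *\<^sub>R F (of_real x))"])
    have Fm: "(\<lambda>x::real. F (of_real x)) \<in> borel_measurable borel"
      using entire_along_line_measurable[OF hol, of 1] by simp
    have "(\<lambda>x. exp (- s * complex_of_real x)) \<in> borel_measurable borel" for s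
      by (intro borel_measurable_continuous_onI continuous_intros)
    then show "(\<lambda>x. indicator {0..} x *\<^sub>R (F (of_real x) * exp (- s * of_real x))) \<in> borel_measurable lborel"
      "(\<lambda>x. indicator {0..} x *\<^sub>R (F (of_real x) * exp (- (- \<i> * of_real \<xi>) * of_real x))) \<in> borel_measurable lborel" for s
      using Fm by measurable
    show "integrable lborel (\<lambda>x. norm (indicator {0..} x *\<^sub>R F (of_real x)))"
      using int unfolding set_integrable_def by (rule integrable_norm)
    show "AE x in lborel. (\<lambda>n. indicator {0..} x *\<^sub>R (F (of_real x) * exp (- s n * of_real x)))
       \<longlonglongrightarrow> indicator {0..} x *\<^sub>R (F (of_real x) * exp (- (- \<i> * of_real \<xi>) * of_real x))"
      by (intro AE_I2 tendsto_intros s_lim)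
    have "norm (exp (- s n * of_real x)) \<le> 1" if "x \<ge> 0" for n x
      using that by (simp add: s_def)
    then show "AE x in lborel. norm (indicator {0..} x *\<^sub>R (F (of_real x) * exp (- s n * of_real x)))
       \<le> norm (indicator {0..} x *\<^sub>R F (of_real x))" for n
      by (intro AE_I2) (auto simp: indicator_def norm_mult simp del: norm_exp_eq_Re intro!: mult_left_le)
  qed
  moreover have "\<Phi> (s n) = \<Psi> (s n)" for n
    by (rule agree) (use m in \<open>auto simp: s_def\<close>)
  ultimately have "\<Phi> (- \<i> * of_real \<xi>) = \<Psi> (- \<i> * of_real \<xi>)"
    using LIMSEQ_unique by auto
  then show ?thesis by (simp add: \<Phi>_def \<Psi>_def mult.assoc)
qed

text \<open>
  Reflection in the imaginary axis, with conjugated values: it exchanges the two real half-lines and fixes the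
  imaginary axis pointwise.
\<close>

lemma entire_reflect_cnj:
  assumes "entire_exp_type_le t F"
  shows "entire_exp_type_le t (\<lambda>z. cnj (F (- cnj z)))"
  unfolding entire_exp_type_le_def
proof
  have F: "F holomorphic_on UNIV" using assms by (simp add: entire_exp_type_le_def)
  have "(\<lambda>z. F (- z)) holomorphic_on cnj ` UNIV"
    by (rule holomorphic_on_compose_gen[of "\<lambda>z. - z" _ F UNIV, unfolded o_def])
       (auto intro!: holomorphic_intros F)
  from holomorphic_on_compose_cnj_cnj[OF this]
  show "(\<lambda>z. cnj (F (- cnj z))) holomorphic_on UNIV" by (simp add: o_def)
  show "\<forall>\<epsilon>>0. \<exists>C>0. \<forall>z. norm (cnj (F (- cnj z))) \<le> C * exp ((t + \<epsilon>) * norm z)"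
    using assms unfolding entire_exp_type_le_def
    by (metis complex_mod_cnj norm_minus_cancel)
qed

lemma entire_reflect:
  assumes "entire_exp_type_le t F"
  shows "entire_exp_type_le t (\<lambda>z. F (- z))"
  unfolding entire_exp_type_le_def
proof
  have F: "F holomorphic_on UNIV" using assms by (simp add: entire_exp_type_le_def)
  show "(\<lambda>z. F (- z)) holomorphic_on UNIV"
    by (rule holomorphic_on_compose_gen[of "\<lambda>z. - z" _ F UNIV, unfolded o_def])
       (auto intro!: holomorphic_intros F)
  show "\<forall>\<epsilon>>0. \<exists>C>0. \<forall>z. norm (F (- z)) \<le> C * exp ((t + \<epsilon>) * norm z)"
    using assms unfolding entire_exp_type_le_def by (metis norm_minus_cancel)
qed

lemma integrable_mult_cis:
  fixes f :: "real \<Rightarrow> complex"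
  assumes f: "integrable lborel f"
  shows "integrable lborel (\<lambda>x. f x * exp (\<i> * of_real \<xi> * of_real x))"
proof (rule Bochner_Integration.integrable_bound[OF f])
  have [measurable]: "(\<lambda>x. exp (\<i> * of_real \<xi> * complex_of_real x)) \<in> borel_measurable borel"
    by (intro borel_measurable_continuous_onI continuous_intros)
  have [measurable]: "f \<in> borel_measurable borel" using f by simp
  show "(\<lambda>x. f x * exp (\<i> * of_real \<xi> * of_real x)) \<in> borel_measurable lborel" by measurable
qed (simp add: norm_mult)

text \<open>
  Both half-lines are turned onto the positive imaginary axis, where their contributions cancel.
\<close>

lemma fourier_vanishes_above_type:
  assumes F: "entire_exp_type_le t F" and "t \<ge> 0" and \<xi>: "\<xi> > t"
    and int: "integrable lborel (\<lambda>x. F (of_real x))"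
  shows "(LBINT x. F (of_real x) * exp (\<i> * of_real \<xi> * of_real x)) = 0"
proof -
  define f where "f x = F (of_real x) * exp (\<i> * of_real \<xi> * of_real x)" for x
  have hol: "F holomorphic_on UNIV" using F by (simp add: entire_exp_type_le_def)
  have f_int: "integrable lborel f"
    unfolding f_def by (rule integrable_mult_cis[OF int])
  have si: "set_integrable lborel A g" if "integrable lborel g" "A \<in> sets lborel" for A and g :: "real \<Rightarrow> complex"
    unfolding set_integrable_def by (rule integrable_mult_indicator[OF that(2,1)])
  have int': "integrable lborel (\<lambda>x. F (- of_real x))"
    using lborel_integrable_real_affine[OF int, of "-1" 0] by simp
  have right: "(LBINT x:{0..}. f x) = \<i> * (LBINT y:{0..}. F (\<i> * of_real y) * exp (- of_real \<xi> * of_real y))"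
    unfolding f_def by (rule half_line_fourier_rotate[OF F \<open>t \<ge> 0\<close> \<xi> si[OF int]]) simp
  have cnj_int: "(LBINT x:A. cnj (g x)) = cnj (LBINT x:A. g x)" for A and g :: "real \<Rightarrow> complex"
    using Bochner_Integration.integral_cnj[of lborel "\<lambda>x. indicator A x *\<^sub>R g x"]
    unfolding set_lebesgue_integral_def by simp
  have "(LBINT x:{..0}. f x) = (LBINT x:{0..}. f (- x))"
    using set_integral_reflect[of "{..0}" f] by (simp add: atMost_def atLeast_def)
  also have "\<dots> = cnj (LBINT x:{0..}. cnj (F (- cnj (of_real x))) * exp (\<i> * of_real \<xi> * of_real x))"
    unfolding cnj_int[symmetric] by (simp add: f_def exp_cnj)
  also have "(LBINT x:{0..}. cnj (F (- cnj (of_real x))) * exp (\<i> * of_real \<xi> * of_real x)) =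
      \<i> * (LBINT y:{0..}. cnj (F (- cnj (\<i> * of_real y))) * exp (- of_real \<xi> * of_real y))"
  proof (rule half_line_fourier_rotate[OF entire_reflect_cnj[OF F] \<open>t \<ge> 0\<close> \<xi>])
    show "set_integrable lborel {0..} (\<lambda>x. cnj (F (- cnj (of_real x))))"
      using si[of "\<lambda>x. cnj (F (- of_real x))"] int' by simp
  qed
  also have "cnj \<dots> = - \<i> * (LBINT y:{0..}. cnj (cnj (F (- cnj (\<i> * of_real y))) * exp (- of_real \<xi> * of_real y)))"
    unfolding cnj_int by simp
  also have "\<dots> = - (\<i> * (LBINT y:{0..}. F (\<i> * of_real y) * exp (- of_real \<xi> * of_real y)))"
    by (simp add: exp_cnj)
  finally have left: "(LBINT x:{..0}. f x) = - (\<i> * (LBINT y:{0..}. F (\<i> * of_real y) * exp (- of_real \<xi> * of_real y)))" .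
  have "(LBINT x. f x) = (LBINT x:{..0} \<union> {0..}. f x)"
    unfolding set_lebesgue_integral_def
    by (rule Bochner_Integration.integral_cong) (auto simp: indicator_def)
  also have "\<dots> = (LBINT x:{..0}. f x) + (LBINT x:{0..}. f x)"
  proof (rule set_integral_Un_AE)
    have "AE x::real in lborel. x \<noteq> 0" by (rule AE_lborel_singleton)
    then show "AE x::real in lborel. \<not> (x \<in> {..0} \<and> x \<in> {0..})" by eventually_elim auto
  qed (use si[OF f_int] in auto)
  finally show ?thesis using left right by (simp add: f_def)
qed

text \<open>
  The end points \<open>\<xi> = t\<close> and \<open>\<xi> = - t\<close> are included because the Fourier transform of an integrable function
  is continuous.
\<close>

lemma fourier_vanishes_outside_type:
  assumes F: "entire_exp_type_le t F" and "t > 0" and \<xi>: "\<bar>\<xi>\<bar> \<ge> t"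
    and int: "integrable lborel (\<lambda>x. F (of_real x))"
  shows "(LBINT x. F (of_real x) * exp (\<i> * of_real \<xi> * of_real x)) = 0"
proof -
  have pos: "(LBINT x. F (of_real x) * exp (\<i> * of_real \<xi> * of_real x)) = 0"
    if F: "entire_exp_type_le t F" and \<xi>: "\<xi> \<ge> t" and int: "integrable lborel (\<lambda>x. F (of_real x))"
    for F \<xi>
  proof -
    define \<eta> where "\<eta> n = \<xi> + 1 / real (Suc n)" for n
    have \<eta>: "\<eta> n > t" for n     proof -
      have "1 / real (Suc n) > 0" by simp
      then show ?thesis using \<xi> unfolding \<eta>_def by linarith
    qed
    have "\<eta> \<longlonglongrightarrow> \<xi> + 0"
      unfolding \<eta>_def using LIMSEQ_inverse_real_of_nat by (intro tendsto_intros) (simp add: divide_inverse)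
    then have lim: "\<eta> \<longlonglongrightarrow> \<xi>" by simp
    have "(\<lambda>n. LBINT x. F (of_real x) * exp (\<i> * of_real (\<eta> n) * of_real x))
        \<longlonglongrightarrow> (LBINT x. F (of_real x) * exp (\<i> * of_real \<xi> * of_real x))"
    proof (rule integral_dominated_convergence[where w = "\<lambda>x. norm (F (of_real x))"])
      show "(\<lambda>x. F (of_real x) * exp (\<i> * of_real s * of_real x)) \<in> borel_measurable lborel"
        "(\<lambda>x. F (of_real x) * exp (\<i> * of_real \<xi> * of_real x)) \<in> borel_measurable lborel" for s
        using borel_measurable_integrable[OF integrable_mult_cis[OF int]] by auto
      show "AE x in lborel. (\<lambda>n. F (of_real x) * exp (\<i> * of_real (\<eta> n) * of_real x))
         \<longlonglongrightarrow> F (of_real x) * exp (\<i> * of_real \<xi> * of_real x)"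
        by (intro AE_I2 tendsto_intros lim)
    qed (use int in \<open>auto simp: norm_mult\<close>)
    then show ?thesis
      using fourier_vanishes_above_type[OF F _ \<eta> int] \<open>t > 0\<close> by (simp add: LIMSEQ_const_iff)
  qed
  show ?thesis
  proof (cases "\<xi> \<ge> 0")
    case True
    then show ?thesis using pos[OF F _ int] \<xi> by simp
  next
    case False
    have int': "integrable lborel (\<lambda>x. F (- of_real x))"
      using lborel_integrable_real_affine[OF int, of "-1" 0] by simp
    have "(LBINT x. F (of_real x) * exp (\<i> * of_real \<xi> * of_real x)) =
      (LBINT x. F (- of_real x) * exp (\<i> * of_real (- \<xi>) * of_real x))"
      using lborel_integral_real_affine[of "-1" "\<lambda>x. F (of_real x) * exp (\<i> * of_real \<xi> * of_real x)" 0] by simp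
    also have "\<dots> = 0"
      using pos[OF entire_reflect[OF F] _ int', of "- \<xi>"] \<xi> False by simp
    finally show ?thesis .
  qed
qed

section \<open>Growth of integrable functions of exponential type\<close>

definition difference_quotient :: "(complex \<Rightarrow> complex) \<Rightarrow> complex \<Rightarrow> complex \<Rightarrow> complex" where
  "difference_quotient f a z = (if z = a then deriv f a else (f z - f a) / (z - a))"

lemma difference_quotient_holomorphic:
  assumes "f holomorphic_on UNIV"
  shows "difference_quotient f a holomorphic_on UNIV"
  using pole_lemma_open[OF assms open_UNIV, of a] by (simp add: difference_quotient_def[abs_def])

lemma entire_exp_type_difference_quotient:
  assumes F: "entire_exp_type_le t F" and "t \<ge> 0"
  shows "entire_exp_type_le t (difference_quotient F a)"
  unfolding entire_exp_type_le_def
proof (intro conjI allI impI)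
  have hol: "F holomorphic_on UNIV" using F by (simp add: entire_exp_type_le_def)
  show h: "difference_quotient F a holomorphic_on UNIV"
    by (rule difference_quotient_holomorphic[OF hol])
  fix \<epsilon> :: real assume \<epsilon>: "\<epsilon> > 0"
  obtain C where C: "C > 0" "\<And>z. norm (F z) \<le> C * exp ((t + \<epsilon>) * norm z)"
    using F \<epsilon> by (auto simp: entire_exp_type_le_def)
  have "compact (difference_quotient F a ` cball a 1)"
    by (rule compact_continuous_image[OF continuous_on_subset[OF holomorphic_on_imp_continuous_on[OF h]] compact_cball]) simp
  then have "bounded (difference_quotient F a ` cball a 1)" by (rule compact_imp_bounded)
  then obtain M where M: "M > 0" "\<And>z. z \<in> cball a 1 \<Longrightarrow> norm (difference_quotient F a z) \<le> M"
    unfolding bounded_pos by blast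
  have "norm (difference_quotient F a z) \<le> (C + norm (F a) + M) * exp ((t + \<epsilon>) * norm z)" for z
  proof -
    have e: "exp ((t + \<epsilon>) * norm z) \<ge> 1" using \<epsilon> \<open>t \<ge> 0\<close> by simp
    show ?thesis
    proof (cases "z \<in> cball a 1")
      case True
      have "norm (difference_quotient F a z) \<le> M * 1" using M(2)[OF True] by simp
      also have "\<dots> \<le> (C + norm (F a) + M) * exp ((t + \<epsilon>) * norm z)"
        using M(1) C(1) e by (intro mult_mono) auto
      finally show ?thesis .
    next
      case False
      then have z: "z \<noteq> a" "norm (z - a) \<ge> 1" by (auto simp: dist_norm norm_minus_commute)
      then have "norm (difference_quotient F a z) = norm (F z - F a) / norm (z - a)" by (simp add: difference_quotient_def norm_divide)
      also have "\<dots> \<le> norm (F z - F a)" using z by (simp add: divide_le_eq mult_right_le_one_le mult_le_cancel_left1)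
      also have "\<dots> \<le> norm (F z) + norm (F a) * 1" using norm_triangle_ineq4 by simp
      also have "\<dots> \<le> C * exp ((t + \<epsilon>) * norm z) + norm (F a) * exp ((t + \<epsilon>) * norm z)"
        using C(2)[of z] e by (intro add_mono mult_left_mono) auto
      also have "\<dots> \<le> (C + norm (F a) + M) * exp ((t + \<epsilon>) * norm z)"
        using M(1) by (simp add: algebra_simps)
      finally show ?thesis .
    qed
  qed
  then show "\<exists>C>0. \<forall>z. norm (difference_quotient F a z) \<le> C * exp ((t + \<epsilon>) * norm z)"
    using C(1) M(1) by (intro exI[of _ "C + norm (F a) + M"]) (auto simp: add_pos_nonneg)
qed

lemma norm_cos_le_exp_Im: "norm (cos z) \<le> exp \<bar>Im z\<bar>" for z :: complex
proof -
  have "norm (cos z) = norm (exp (\<i> * z) + exp (- (\<i> * z))) / 2"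
    by (simp add: cos_exp_eq norm_divide)
  also have "\<dots> \<le> (norm (exp (\<i> * z)) + norm (exp (- (\<i> * z)))) / 2"
    by (intro divide_right_mono norm_triangle_ineq) simp
  also have "\<dots> \<le> exp \<bar>Im z\<bar>" by (cases "Im z \<ge> 0") auto
  finally show ?thesis .
qed

lemma norm_sin_le_exp_Im: "norm (sin z) \<le> exp \<bar>Im z\<bar>" for z :: complex
proof -
  have "norm (sin z) = norm (exp (\<i> * z) - exp (- (\<i> * z))) / 2"
    by (simp add: sin_exp_eq norm_divide norm_mult)
  also have "\<dots> \<le> (norm (exp (\<i> * z)) + norm (exp (- (\<i> * z)))) / 2"
    by (intro divide_right_mono norm_triangle_ineq4) simp
  also have "\<dots> \<le> exp \<bar>Im z\<bar>" by (cases "Im z \<ge> 0") auto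
  finally show ?thesis .
qed

lemma norm_sin_le_norm_exp_Im: "norm (sin z) \<le> norm z * exp \<bar>Im z\<bar>" for z :: complex
proof -
  have "norm (sin z - sin 0) \<le> exp \<bar>Im z\<bar> * norm (z - 0)"
  proof (rule field_differentiable_bound[of "closed_segment 0 z" sin cos])
    fix v assume "v \<in> closed_segment 0 z"
    then obtain u where u: "0 \<le> u" "u \<le> 1" "v = u *\<^sub>R z" by (auto simp: in_segment)
    then have "\<bar>Im v\<bar> \<le> \<bar>Im z\<bar>" by (simp add: abs_mult mult_left_le_one_le)
    then show "norm (cos v) \<le> exp \<bar>Im z\<bar>"
      using norm_cos_le_exp_Im[of v] by (meson exp_le_cancel_iff order_trans)
  qed (auto intro!: derivative_eq_intros)
  then show ?thesis by (simp add: mult.commute)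
qed

text \<open>
  The function \<open>sin (pi * w) / w\<close>, thus \<open>pi\<close> times the normalised cardinal sine.
\<close>

definition csinc :: "complex \<Rightarrow> complex" where
  "csinc = difference_quotient (\<lambda>w. sin (of_real pi * w)) 0"

lemma csinc_0: "csinc 0 = of_real pi"
proof -
  have "((\<lambda>w. sin (of_real pi * w)) has_field_derivative of_real pi) (at (0::complex))"
    by (auto intro!: derivative_eq_intros)
  then show ?thesis by (simp add: csinc_def difference_quotient_def DERIV_imp_deriv)
qed

lemma csinc_mult: "csinc w * w = sin (of_real pi * w)"
  by (cases "w = 0") (auto simp: csinc_def difference_quotient_def)

lemma norm_csinc_le: "norm (csinc w) \<le> pi * exp (pi * \<bar>Im w\<bar>)"
proof (cases "w = 0")
  case True
  then show ?thesis by (simp add: csinc_0)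
next
  case False
  have "norm (csinc w) * norm w = norm (sin (of_real pi * w))"
    by (simp flip: csinc_mult norm_mult)
  also have "\<dots> \<le> norm (of_real pi * w) * exp \<bar>Im (of_real pi * w)\<bar>" by (rule norm_sin_le_norm_exp_Im)
  also have "\<dots> = (pi * exp (pi * \<bar>Im w\<bar>)) * norm w" by (simp add: norm_mult abs_mult)
  finally show ?thesis using False by simp
qed

lemma norm_csinc_mult_le: "norm (csinc (of_real x)) * \<bar>x\<bar> \<le> 1"
proof -
  have "norm (csinc (of_real x)) * \<bar>x\<bar> = norm (sin (of_real pi * complex_of_real x))"
    by (simp flip: csinc_mult add: norm_mult)
  also have "\<dots> \<le> exp 0" using norm_sin_le_exp_Im[of "of_real pi * complex_of_real x"] by simp
  finally show ?thesis by simp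
qed

lemma csinc_holomorphic: "csinc holomorphic_on A"
proof -
  have "csinc holomorphic_on UNIV"
    unfolding csinc_def by (intro difference_quotient_holomorphic holomorphic_intros)
  then show ?thesis by (rule holomorphic_on_subset) simp
qed

lemma entire_exp_type_le_of_Im_bound:
  assumes F: "F holomorphic_on UNIV" and "C > 0" "t \<ge> 0"
    and bound: "\<And>z. norm (F z) \<le> C * exp (t * \<bar>Im z\<bar>)"
  shows "entire_exp_type_le t F"
  unfolding entire_exp_type_le_def
proof (intro conjI allI impI F)
  fix \<epsilon> :: real assume "\<epsilon> > 0"
  have "norm (F z) \<le> C * exp ((t + \<epsilon>) * norm z)" for z
  proof -
    have "t * \<bar>Im z\<bar> \<le> (t + \<epsilon>) * norm z"
      using \<open>\<epsilon> > 0\<close> \<open>t \<ge> 0\<close> abs_Im_le_cmod[of z] by (intro mult_mono) auto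
    then show ?thesis
      using bound[of z] \<open>C > 0\<close> by (meson exp_le_cancel_iff mult_left_mono less_imp_le order_trans)
  qed
  then show "\<exists>C>0. \<forall>z. norm (F z) \<le> C * exp ((t + \<epsilon>) * norm z)"
    using \<open>C > 0\<close> by blast
qed

lemma csinc_exp_type: "entire_exp_type_le pi (\<lambda>w. csinc (w - a))"
proof (rule entire_exp_type_le_of_Im_bound[where C = "pi * exp (pi * \<bar>Im a\<bar>)"])
  show "(\<lambda>w. csinc (w - a)) holomorphic_on UNIV"
    by (rule holomorphic_on_compose_gen[of "\<lambda>w. w - a" _ csinc UNIV, unfolded o_def])
       (auto intro!: holomorphic_intros csinc_holomorphic)
  fix w
  have "norm (csinc (w - a)) \<le> pi * exp (pi * \<bar>Im w - Im a\<bar>)"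
    using norm_csinc_le[of "w - a"] by simp
  also have "\<dots> \<le> pi * exp (pi * (\<bar>Im a\<bar> + \<bar>Im w\<bar>))" by simp
  finally show "norm (csinc (w - a)) \<le> pi * exp (pi * \<bar>Im a\<bar>) * exp (pi * \<bar>Im w\<bar>)"
    by (simp add: distrib_left exp_add mult.assoc)
qed auto

lemma integrable_inverse_1_plus_square_shift:
  "integrable lborel (\<lambda>x::real. inverse (1 + (x - a)\<^sup>2))"
proof -
  have "integrable lborel (\<lambda>x::real. inverse (1 + x\<^sup>2))"
    using integrable_inverse_1_plus_square by (simp add: set_integrable_def einterval_def)
  from lborel_integrable_real_affine[OF this, of 1 "- a"] show ?thesis by simp
qed

lemma csinc_real_sq_integrable: "integrable lborel (\<lambda>x. (norm (csinc (of_real x)))\<^sup>2)"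
proof (rule Bochner_Integration.integrable_bound)
  show "integrable lborel (\<lambda>x::real. (pi\<^sup>2 + 1) * inverse (1 + (x - 0)\<^sup>2))"
    by (intro integrable_mult_right integrable_inverse_1_plus_square_shift)
  have "(\<lambda>x::real. csinc (of_real x)) \<in> borel_measurable borel"
    using entire_along_line_measurable[OF csinc_holomorphic, of 1] by simp
  then show "(\<lambda>x. (norm (csinc (of_real x)))\<^sup>2) \<in> borel_measurable lborel" by simp
  show "AE x in lborel. norm ((norm (csinc (of_real x)))\<^sup>2) \<le> norm ((pi\<^sup>2 + 1) * inverse (1 + (x - 0)\<^sup>2))"
  proof (rule AE_I2)
    fix x :: real
    have "(norm (csinc (of_real x)))\<^sup>2 \<le> pi\<^sup>2"
      using norm_csinc_le[of "of_real x"] by (intro power_mono) auto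
    moreover have "(norm (csinc (of_real x)) * \<bar>x\<bar>)\<^sup>2 \<le> 1\<^sup>2"
      using norm_csinc_mult_le[of x] by (intro power_mono) auto
    moreover have "(norm (csinc (of_real x)))\<^sup>2 * (1 + x\<^sup>2) = (norm (csinc (of_real x)))\<^sup>2 + (norm (csinc (of_real x)) * \<bar>x\<bar>)\<^sup>2"
      by (simp add: algebra_simps power_mult_distrib)
    ultimately have "(norm (csinc (of_real x)))\<^sup>2 * (1 + x\<^sup>2) \<le> pi\<^sup>2 + 1"
      unfolding one_power2 by linarith
    moreover have "1 + x\<^sup>2 > 0" by (simp add: add_pos_nonneg)
    ultimately have "(norm (csinc (of_real x)))\<^sup>2 \<le> (pi\<^sup>2 + 1) / (1 + x\<^sup>2)"
      by (simp add: pos_le_divide_eq)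
    then show "norm ((norm (csinc (of_real x)))\<^sup>2) \<le> norm ((pi\<^sup>2 + 1) * inverse (1 + (x - 0)\<^sup>2))"
      by (simp add: divide_inverse abs_mult)
  qed
qed

lemma csinc_of_real_in_Reals: "csinc (of_real x) \<in> \<real>"
proof (cases "x = 0")
  case True
  then show ?thesis by (simp add: csinc_0)
next
  case False
  have "csinc (of_real x) = of_real (sin (pi * x) / x)"
    using csinc_mult[of "of_real x"] False by (simp add: sin_of_real[symmetric] field_simps)
  then show ?thesis by simp
qed

lemma csinc_real_sq_integral_pos: "(LBINT x. (norm (csinc (of_real x)))\<^sup>2) > 0"
proof -
  have "(LBINT x. (norm (csinc (of_real x)))\<^sup>2) \<noteq> 0"
  proof
    assume "(LBINT x. (norm (csinc (of_real x)))\<^sup>2) = 0"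
    then have zero: "AE x in lborel. (norm (csinc (of_real x)))\<^sup>2 = 0"
      by (subst (asm) integral_nonneg_eq_0_iff_AE[OF csinc_real_sq_integrable]) auto
    have null: "{x. csinc (of_real x) = 0} \<in> null_sets lborel"
    proof (rule countable_imp_null_set_lborel, rule countable_subset)
      show "{x. csinc (of_real x) = 0} \<subseteq> range real_of_int"
      proof
        fix x assume "x \<in> {x. csinc (of_real x) = 0}"
        then have "sin (of_real pi * complex_of_real x) = 0" using csinc_mult[of "of_real x"] by simp
        then have "sin (pi * x) = 0"
          by (simp only: of_real_mult[symmetric] sin_of_real of_real_eq_0_iff)
        then show "x \<in> range real_of_int" by (auto simp: sin_zero_iff_int2)
      qed
    qed simp
    then have "AE x in lborel. csinc (of_real x) \<noteq> 0"
      using AE_not_in[OF null] by simp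
    with zero have "AE x in lborel. (norm (csinc (of_real x)))\<^sup>2 = 0 \<and> csinc (of_real x) \<noteq> 0"
      by (rule AE_conjI)
    then show False by (simp add: ae_filter_eq_bot_iff)
  qed
  moreover have "(LBINT x. (norm (csinc (of_real x)))\<^sup>2) \<ge> 0" by simp
  ultimately show ?thesis by linarith
qed

text \<open>
  The difference quotient \<open>E\<close> of \<open>pi * F w - F z * csinc (w - z)\<close> at \<open>z\<close> is again of type \<open>pi\<close>, and it is
  integrable on the real line because its second term is of the order of \<open>1 / (x - z)\<^sup>2\<close> there. So its Fourier transform
  vanishes at \<open>pi\<close> and \<open>- pi\<close>, and integrating \<open>E x\<close> against \<open>sin (pi * (x - z))\<close> gives \<open>0\<close>, which is the
  claim. The constant on the right is translation invariant and positive, which is what makes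
  the formula useful for bounding \<open>F\<close>.
\<close>

lemma csinc_reproduces_real:
  assumes F: "entire_exp_type_le pi F" and int: "integrable lborel (\<lambda>x. F (of_real x))"
  shows "of_real pi * (LBINT x. F (of_real x) * csinc (of_real x - of_real z)) =
     of_real (LBINT x. (norm (csinc (of_real x)))\<^sup>2) * F (of_real z)"
proof -
  define g where "g w = of_real pi * F w - F (of_real z) * csinc (w - of_real z)" for w
  define E where "E = difference_quotient g (of_real z)"
  have Fh: "F holomorphic_on UNIV" using F by (simp add: entire_exp_type_le_def)
  have g_type: "entire_exp_type_le pi g"
    unfolding entire_exp_type_le_def
  proof (intro conjI allI impI)
    show "g holomorphic_on UNIV"
      unfolding g_def using csinc_exp_type[of "of_real z"]
      by (intro holomorphic_intros Fh) (simp add: entire_exp_type_le_def)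
    fix \<epsilon> :: real assume "\<epsilon> > 0"
    then obtain C where C: "C > 0" "\<And>z. norm (F z) \<le> C * exp ((pi + \<epsilon>) * norm z)"
      using F by (auto simp: entire_exp_type_le_def)
    obtain D where D: "D > 0" "\<And>w. norm (csinc (w - of_real z)) \<le> D * exp ((pi + \<epsilon>) * norm w)"
      using csinc_exp_type[of "of_real z"] \<open>\<epsilon> > 0\<close> by (auto simp: entire_exp_type_le_def)
    have "norm (g w) \<le> (pi * C + norm (F (of_real z)) * D) * exp ((pi + \<epsilon>) * norm w)" for w
    proof -
      have "norm (g w) \<le> norm (of_real pi * F w) + norm (F (of_real z) * csinc (w - of_real z))"
        unfolding g_def by (rule norm_triangle_ineq4)
      also have "\<dots> = pi * norm (F w) + norm (F (of_real z)) * norm (csinc (w - of_real z))"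
        by (simp add: norm_mult)
      also have "\<dots> \<le> pi * (C * exp ((pi + \<epsilon>) * norm w)) + norm (F (of_real z)) * (D * exp ((pi + \<epsilon>) * norm w))"
        by (intro add_mono mult_left_mono C D) auto
      finally show ?thesis by (simp add: algebra_simps)
    qed
    then show "\<exists>C>0. \<forall>w. norm (g w) \<le> C * exp ((pi + \<epsilon>) * norm w)"
      using C(1) D(1) by (intro exI[of _ "pi * C + norm (F (of_real z)) * D"]) (auto simp: add_pos_nonneg)
  qed
  have E_type: "entire_exp_type_le pi E"
    unfolding E_def by (rule entire_exp_type_difference_quotient[OF g_type]) simp
  have gz: "g (of_real z) = 0" by (simp add: g_def csinc_0)
  have E_mult: "E w * (w - of_real z) = g w" for w
    by (cases "w = of_real z") (auto simp: E_def difference_quotient_def gz)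
  have Eh: "E holomorphic_on UNIV" using E_type by (simp add: entire_exp_type_le_def)
  have E_meas: "(\<lambda>x::real. E (of_real x)) \<in> borel_measurable borel"
    using entire_along_line_measurable[OF Eh, of 1] by simp
  have "compact (E ` cball (of_real z) 1)"
    by (rule compact_continuous_image[OF continuous_on_subset[OF holomorphic_on_imp_continuous_on[OF Eh]] compact_cball]) simp
  then have "bounded (E ` cball (of_real z) 1)" by (rule compact_imp_bounded)
  then obtain M where M: "M > 0" "\<And>w. w \<in> cball (of_real z) 1 \<Longrightarrow> norm (E w) \<le> M"
    unfolding bounded_pos by blast
  have E_int: "integrable lborel (\<lambda>x. E (of_real x))"
  proof (rule Bochner_Integration.integrable_bound)
    show "integrable lborel (\<lambda>x. pi * norm (F (of_real x)) + (2 * (norm (F (of_real z)) + M)) * inverse (1 + (x - z)\<^sup>2))"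
      using int by (intro Bochner_Integration.integrable_add integrable_mult_right integrable_inverse_1_plus_square_shift) auto
    show "(\<lambda>x. E (of_real x)) \<in> borel_measurable lborel" using E_meas by simp
    show "AE x in lborel. norm (E (of_real x)) \<le>
       norm (pi * norm (F (of_real x)) + (2 * (norm (F (of_real z)) + M)) * inverse (1 + (x - z)\<^sup>2))"
    proof (rule AE_I2)
      fix x :: real
      define d where "d = \<bar>x - z\<bar>"
      have pos: "1 + d\<^sup>2 > 0" by (simp add: add_pos_nonneg)
      have "norm (E (of_real x)) \<le> pi * norm (F (of_real x)) + (2 * (norm (F (of_real z)) + M)) / (1 + d\<^sup>2)"
      proof (cases "d \<le> 1")
        case True
        then have "complex_of_real x \<in> cball (of_real z) 1"
          unfolding mem_cball dist_norm of_real_diff[symmetric] norm_of_real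
          by (simp add: d_def abs_minus_commute)
        then have "norm (E (of_real x)) \<le> M" by (rule M(2))
        also have "M \<le> (2 * (norm (F (of_real z)) + M)) / (1 + d\<^sup>2)"
        proof -
          have "1 + d\<^sup>2 \<le> 2" using True by (simp add: d_def abs_square_le_1)
          then have "M * (1 + d\<^sup>2) \<le> M * 2" using M(1) by (intro mult_left_mono) auto
          also have "\<dots> \<le> 2 * (norm (F (of_real z)) + M)" by simp
          finally show ?thesis using pos by (simp add: pos_le_divide_eq)
        qed
        finally show ?thesis by (simp add: add_increasing)
      next
        case False
        then have d: "d > 1" by simp
        have nd: "norm (complex_of_real x - of_real z) = d" by (simp add: d_def flip: of_real_diff)
        have "norm (E (of_real x)) * d = norm (g (of_real x))"
          using E_mult[of "of_real x"] nd by (metis norm_mult)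
        also have "\<dots> \<le> norm (of_real pi * F (of_real x)) + norm (F (of_real z) * csinc (of_real x - of_real z))"
          unfolding g_def by (rule norm_triangle_ineq4)
        also have "\<dots> = pi * norm (F (of_real x)) + norm (F (of_real z)) * norm (csinc (of_real (x - z)))"
          by (simp add: norm_mult)
        also have "\<dots> \<le> pi * norm (F (of_real x)) * d + norm (F (of_real z)) * (1 / d)"
        proof (intro add_mono mult_left_mono)
          show "pi * norm (F (of_real x)) \<le> pi * norm (F (of_real x)) * d"
            using mult_left_mono[of 1 d "pi * norm (F (of_real x))"] d by simp
          show "norm (csinc (of_real (x - z))) \<le> 1 / d"
            using norm_csinc_mult_le[of "x - z"] d unfolding d_def[symmetric] by (simp add: pos_le_divide_eq)
        qed auto
        finally have "norm (E (of_real x)) * d \<le> (pi * norm (F (of_real x)) + norm (F (of_real z)) / d\<^sup>2) * d"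
          using d by (simp add: algebra_simps power2_eq_square)
        then have "norm (E (of_real x)) \<le> pi * norm (F (of_real x)) + norm (F (of_real z)) / d\<^sup>2"
          using d by simp
        also have "norm (F (of_real z)) / d\<^sup>2 \<le> (2 * (norm (F (of_real z)) + M)) / (1 + d\<^sup>2)"
        proof -
          have "d\<^sup>2 \<ge> 1" using d by simp
          then have "norm (F (of_real z)) * (1 + d\<^sup>2) \<le> norm (F (of_real z)) * (2 * d\<^sup>2)" by (intro mult_left_mono) auto
          also have "\<dots> \<le> (2 * (norm (F (of_real z)) + M)) * d\<^sup>2" using M(1) by (simp add: algebra_simps)
          finally show ?thesis using pos d by (simp add: divide_simps)
        qed
        finally show ?thesis by simp
      qed
      also have "\<dots> \<le> norm (pi * norm (F (of_real x)) + (2 * (norm (F (of_real z)) + M)) * inverse (1 + (x - z)\<^sup>2))"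
        by (simp add: d_def divide_inverse)
      finally show "norm (E (of_real x)) \<le>
         norm (pi * norm (F (of_real x)) + (2 * (norm (F (of_real z)) + M)) * inverse (1 + (x - z)\<^sup>2))" .
    qed
  qed
  have E_exp_int: "integrable lborel (\<lambda>x. E (of_real x) * exp (\<i> * of_real \<xi> * of_real x))" for \<xi>
    by (rule integrable_mult_cis[OF E_int])
  have E0: "(LBINT x. E (of_real x) * exp (\<i> * of_real \<xi> * of_real x)) = 0" if "\<bar>\<xi>\<bar> = pi" for \<xi>
    by (rule fourier_vanishes_outside_type[OF E_type _ _ E_int]) (use that in auto)
  define a where "a = exp (- \<i> * of_real pi * of_real z) / (2 * \<i>)"
  define b where "b = exp (\<i> * of_real pi * of_real z) / (2 * \<i>)"
  have sin_eq: "sin (of_real pi * (w - of_real z)) = a * exp (\<i> * of_real pi * w) - b * exp (\<i> * of_real (- pi) * w)" for w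
    by (simp add: sin_exp_eq a_def b_def algebra_simps diff_divide_distrib flip: exp_add)
  have "(LBINT x. E (of_real x) * sin (of_real pi * (of_real x - of_real z))) =
     (LBINT x. a * (E (of_real x) * exp (\<i> * of_real pi * of_real x)) - b * (E (of_real x) * exp (\<i> * of_real (- pi) * of_real x)))"
    unfolding sin_eq by (simp add: algebra_simps)
  also have "\<dots> = a * (LBINT x. E (of_real x) * exp (\<i> * of_real pi * of_real x)) - b * (LBINT x. E (of_real x) * exp (\<i> * of_real (- pi) * of_real x))"
    unfolding integral_mult_right_zero[symmetric]
    by (intro Bochner_Integration.integral_diff integrable_mult_right E_exp_int)
  also have "\<dots> = 0" using E0[of pi] E0[of "- pi"] by simp
  finally have zero: "(LBINT x. E (of_real x) * sin (of_real pi * (of_real x - of_real z))) = 0" .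
  have sq: "csinc (of_real y) * csinc (of_real y) = of_real ((norm (csinc (of_real y)))\<^sup>2)" for y
    using csinc_of_real_in_Reals[of y] by (auto simp: Reals_def power2_eq_square abs_mult_self_eq simp flip: of_real_mult)
  have split: "E (of_real x) * sin (of_real pi * (of_real x - of_real z)) =
     of_real pi * (F (of_real x) * csinc (of_real x - of_real z)) - F (of_real z) * of_real ((norm (csinc (of_real (x - z))))\<^sup>2)" for x
  proof -
    have "E (of_real x) * sin (of_real pi * (of_real x - of_real z)) = g (of_real x) * csinc (of_real x - of_real z)"
      unfolding csinc_mult[symmetric] E_mult[symmetric] by (simp add: mult_ac)
    then show ?thesis unfolding g_def using sq[of "x - z"] by (simp add: algebra_simps)
  qed
  have i1: "integrable lborel (\<lambda>x. F (of_real x) * csinc (of_real x - of_real z))"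
  proof (rule Bochner_Integration.integrable_bound)
    show "integrable lborel (\<lambda>x. pi * norm (F (of_real x)))" using int by simp
    have "(\<lambda>w. csinc (w - of_real z)) holomorphic_on UNIV" using csinc_exp_type by (simp add: entire_exp_type_le_def)
    from entire_along_line_measurable[OF this, of 1] entire_along_line_measurable[OF Fh, of 1]
    show "(\<lambda>x. F (of_real x) * csinc (of_real x - of_real z)) \<in> borel_measurable lborel" by simp
    have "norm (csinc (of_real x - of_real z)) \<le> pi" for x
      using norm_csinc_le[of "of_real x - of_real z"] by simp
    then show "AE x in lborel. norm (F (of_real x) * csinc (of_real x - of_real z)) \<le> norm (pi * norm (F (of_real x)))"
      by (intro AE_I2) (simp add: norm_mult mult.commute[of pi] mult_left_mono)
  qed
  have i2: "integrable lborel (\<lambda>x. (norm (csinc (of_real (x - z))))\<^sup>2)"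
    using lborel_integrable_real_affine[OF csinc_real_sq_integrable, of 1 "- z"] by (simp add: algebra_simps)
  have i3: "integrable lborel (\<lambda>x. complex_of_real ((norm (csinc (of_real (x - z))))\<^sup>2))"
    by (rule integrable_of_real[OF i2])
  have "0 = (LBINT x. of_real pi * (F (of_real x) * csinc (of_real x - of_real z)) - F (of_real z) * of_real ((norm (csinc (of_real (x - z))))\<^sup>2))"
    using zero unfolding split by simp
  also have "\<dots> = of_real pi * (LBINT x. F (of_real x) * csinc (of_real x - of_real z)) -
     F (of_real z) * of_real (LBINT x. (norm (csinc (of_real (x - z))))\<^sup>2)"
    unfolding integral_complex_of_real[symmetric] integral_mult_right_zero[symmetric]
    by (intro Bochner_Integration.integral_diff integrable_mult_right i1 i3)
  also have "(LBINT x. (norm (csinc (of_real (x - z))))\<^sup>2) = (LBINT x. (norm (csinc (of_real x)))\<^sup>2)"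
    using lborel_integral_real_affine[of 1 "\<lambda>x. (norm (csinc (of_real x)))\<^sup>2" "- z"] by (simp add: algebra_simps)
  finally show ?thesis by (simp add: mult.commute)
qed

text \<open>
  Both sides of the reproducing formula are entire in \<open>z\<close>, so it holds for complex \<open>z\<close> as well, and there the
  kernel is bounded by \<open>pi * exp (pi * \<bar>Im z\<bar>)\<close>.
\<close>

lemma integrable_exp_type_bound:
  assumes F: "entire_exp_type_le pi F" and int: "integrable lborel (\<lambda>x. F (of_real x))"
  obtains M where "\<And>z. norm (F z) \<le> M * exp (pi * \<bar>Im z\<bar>)"
proof -
  define c where "c = (LBINT x. (norm (csinc (of_real x)))\<^sup>2)"
  have c: "c > 0" unfolding c_def by (rule csinc_real_sq_integral_pos)
  define \<Phi> where "\<Phi> z = (LBINT x. F (of_real x) * csinc (of_real x - z))" for z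
  have Fh: "F holomorphic_on UNIV" using F by (simp add: entire_exp_type_le_def)
  have sm: "(\<lambda>x. csinc (of_real x - z)) \<in> borel_measurable lborel" for z
  proof -
    have "(\<lambda>w. csinc (w - z)) holomorphic_on UNIV" using csinc_exp_type by (simp add: entire_exp_type_le_def)
    from entire_along_line_measurable[OF this, of 1] show ?thesis by simp
  qed
  have strip: "\<Phi> holomorphic_on ({z. Im z < R} \<inter> {z. Im z > - R})" for R
    unfolding \<Phi>_def
  proof (rule holomorphic_integral_parameter[OF _ int sm, where B = "pi * exp (pi * R)"])
    show "open ({z. Im z < R} \<inter> {z. Im z > - R})" by (intro open_Int open_halfspace_Im_gt open_halfspace_Im_lt)
    show "(\<lambda>z. csinc (of_real x - z)) holomorphic_on ({z. Im z < R} \<inter> {z. Im z > - R})" for x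
      by (rule holomorphic_on_compose_gen[of "\<lambda>z. of_real x - z" _ csinc UNIV, unfolded o_def])
         (auto intro!: holomorphic_intros csinc_holomorphic)
    show "norm (csinc (of_real x - z)) \<le> pi * exp (pi * R)" if "z \<in> {z. Im z < R} \<inter> {z. Im z > - R}" for z x
    proof -
      have "norm (csinc (of_real x - z)) \<le> pi * exp (pi * \<bar>Im z\<bar>)"
        using norm_csinc_le[of "of_real x - z"] by simp
      also have "\<dots> \<le> pi * exp (pi * R)" using that by (auto simp: abs_if)
      finally show ?thesis .
    qed
  qed
  have \<Phi>h: "\<Phi> holomorphic_on UNIV"
  proof -
    have "\<Phi> holomorphic_on (\<Union>R. {z. Im z < R} \<inter> {z. Im z > - R})"
      by (intro holomorphic_on_UN_open strip open_Int open_halfspace_Im_gt open_halfspace_Im_lt)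
    also have "(\<Union>R. {z. Im z < R} \<inter> {z. Im z > - R}) = UNIV"
    proof -
      have "\<exists>R. Im z < R \<and> - R < Im z" for z
        by (rule exI[of _ "\<bar>Im z\<bar> + 1"]) auto
      then show ?thesis by auto
    qed
    finally show ?thesis .
  qed
  have rep: "of_real pi * \<Phi> z = of_real c * F z" for z
  proof -
    have "(\<lambda>z. of_real pi * \<Phi> z - of_real c * F z) z = 0"
    proof (rule analytic_continuation[of "\<lambda>z. of_real pi * \<Phi> z - of_real c * F z" UNIV \<real> 0])
      show "(\<lambda>z. of_real pi * \<Phi> z - of_real c * F z) holomorphic_on UNIV"
        by (intro holomorphic_intros \<Phi>h Fh)
      show "(0::complex) islimpt \<real>"
        unfolding islimpt_approachable
      proof (intro allI impI)
        fix e :: real assume "e > 0"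
        then show "\<exists>x'\<in>\<real>. x' \<noteq> (0::complex) \<and> dist x' 0 < e"
          by (intro bexI[of _ "of_real (e/2)"]) auto
      qed
      show "of_real pi * \<Phi> w - of_real c * F w = 0" if "w \<in> \<real>" for w
        using that csinc_reproduces_real[OF F int] by (auto simp: Reals_def \<Phi>_def c_def)
    qed auto
    then show ?thesis by simp
  qed
  define A where "A = (LBINT x. norm (F (of_real x)))"
  have "norm (F z) \<le> (pi / c * (A * pi)) * exp (pi * \<bar>Im z\<bar>)" for z
  proof -
    have "norm (\<Phi> z) \<le> (LBINT x. norm (F (of_real x)) * (pi * exp (pi * \<bar>Im z\<bar>)))"
      unfolding \<Phi>_def
    proof (rule Bochner_Integration.integral_norm_bound_integral)
      have bd: "norm (csinc (of_real x - z)) \<le> pi * exp (pi * \<bar>Im z\<bar>)" for x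
        using norm_csinc_le[of "of_real x - z"] by simp
      show i: "integrable lborel (\<lambda>x. norm (F (of_real x)) * (pi * exp (pi * \<bar>Im z\<bar>)))" using int by simp
      show bd': "norm (F (of_real x) * csinc (of_real x - z)) \<le> norm (F (of_real x)) * (pi * exp (pi * \<bar>Im z\<bar>))" for x
        unfolding norm_mult by (intro mult_left_mono bd) auto
      show "integrable lborel (\<lambda>x. F (of_real x) * csinc (of_real x - z))"
      proof (rule Bochner_Integration.integrable_bound[OF i])
        show "(\<lambda>x. F (of_real x) * csinc (of_real x - z)) \<in> borel_measurable lborel"
          using sm entire_along_line_measurable[OF Fh, of 1] by simp
      qed (use bd' in \<open>auto intro!: AE_I2 order_trans[OF bd']\<close>)
    qed
    also have "\<dots> = A * (pi * exp (pi * \<bar>Im z\<bar>))" by (simp add: A_def)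
    finally have "norm (of_real pi * \<Phi> z) \<le> pi * (A * (pi * exp (pi * \<bar>Im z\<bar>)))" by (simp add: norm_mult)
    then have "c * norm (F z) \<le> pi * (A * (pi * exp (pi * \<bar>Im z\<bar>)))"
      unfolding rep using c by (simp add: norm_mult)
    then show ?thesis using c by (simp add: field_simps)
  qed
  then show ?thesis by (rule that)
qed

section \<open>Integration against the square wave\<close>

text \<open>
  Tannery's theorem in the form of dominated convergence for series.
\<close>

lemma suminf_tendsto_dominated:
  fixes a :: "nat \<Rightarrow> 'b \<Rightarrow> 'a :: {real_normed_algebra, banach}"
  assumes "\<And>k. ((\<lambda>n. a k n) \<longlongrightarrow> b k) F"
    and "eventually (\<lambda>n. \<forall>k. norm (a k n) \<le> M k) F"
    and "summable M" "F \<noteq> bot"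
  shows "((\<lambda>n. \<Sum>k. a k n) \<longlongrightarrow> suminf b) F" and "summable (\<lambda>k. norm (b k))"
proof -
  have "eventually (\<lambda>(k,n). norm (a k n) \<le> M k) (at_top \<times>\<^sub>F F)"
    unfolding eventually_prod_filter
    using assms(2) by (intro exI[of _ "\<lambda>_. True"] exI[of _ "\<lambda>n. \<forall>k. norm (a k n) \<le> M k"]) auto
  from tannerys_theorem[OF assms(1) this assms(3,4)]
  show "((\<lambda>n. \<Sum>k. a k n) \<longlongrightarrow> suminf b) F" and "summable (\<lambda>k. norm (b k))" by blast+
qed

lemma AE_cos_pi_nonzero: "AE x in lborel. cos (pi * x) \<noteq> 0"
proof -
  have "{x. cos (pi * x) = 0} \<subseteq> range (\<lambda>i::int. of_int i / 2)"
  proof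
    fix x assume "x \<in> {x. cos (pi * x) = 0}"
    then obtain i where "pi * x = of_int i * (pi/2)" using cos_zero_iff_int by auto
    then have "x = of_int i / 2" by simp
    then show "x \<in> range (\<lambda>i::int. of_int i / 2)" by blast
  qed
  then have "countable {x. cos (pi * x) = 0}" by (rule countable_subset) simp
  then have "{x. cos (pi * x) = 0} \<in> null_sets lborel" by (rule countable_imp_null_set_lborel)
  from AE_not_in[OF this] show ?thesis by simp
qed

text \<open>
  On the unit circle \<open>(1 - \<i> * z) / (1 + \<i> * z)\<close> is \<open>- \<i>\<close> times a real number of the sign of \<open>cos \<theta>\<close>, so
  the imaginary part of its logarithm is \<open>- pi / 2\<close> or \<open>pi / 2\<close>.
\<close>

lemma Re_Arctan_unit_circle:
  assumes "cos \<theta> \<noteq> 0"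
  shows "Re (Arctan (exp (\<i> * of_real \<theta>))) = pi / 4 * sgn (cos \<theta>)"
proof -
  define z where "z = exp (\<i> * of_real \<theta>)"
  have re: "Re z = cos \<theta>" and im: "Im z = sin \<theta>" by (simp_all add: z_def Re_exp Im_exp)
  have unit: "(Re z)\<^sup>2 + (Im z)\<^sup>2 = 1" by (simp add: re im)
  define d where "d = (norm (1 + \<i> * z))\<^sup>2"
  have nz: "1 + \<i> * z \<noteq> 0" using assms by (auto simp: complex_eq_iff re im)
  then have d: "d > 0" by (simp add: d_def)
  define p where "p = 2 * cos \<theta> / d"
  have num: "(1 - \<i> * z) * cnj (1 + \<i> * z) = - \<i> * of_real (2 * cos \<theta>)"
    using unit by (auto simp: complex_eq_iff re im power2_eq_square algebra_simps)
  have "(1 - \<i> * z) / (1 + \<i> * z) = ((1 - \<i> * z) * cnj (1 + \<i> * z)) / of_real d"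
    unfolding d_def by (rule complex_div_cnj)
  also have "\<dots> = of_real p * (- \<i>)" by (simp only: num p_def) simp
  finally have q: "(1 - \<i> * z) / (1 + \<i> * z) = of_real p * (- \<i>)" .
  have "Im (Ln (of_real p * (- \<i>))) = - pi / 2 * sgn (cos \<theta>)"
  proof (cases "cos \<theta> > 0")
    case True
    then have "p > 0" using d by (simp add: p_def)
    then have "Ln (of_real p * (- \<i>)) = ln p + Ln (- \<i>)"
      by (subst Ln_times_of_real) (auto simp: Ln_of_real)
    then show ?thesis using True by simp
  next
    case False
    then have neg: "cos \<theta> < 0" using assms by simp
    then have "p < 0" using d by (simp add: p_def divide_neg_pos)
    have "of_real p * (- \<i>) = of_real (- p) * \<i>" by simp
    also have "Ln \<dots> = ln (- p) + Ln \<i>" by (subst Ln_times_of_real) (use \<open>p < 0\<close> in \<open>auto simp flip: Ln_of_real\<close>)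
    finally show ?thesis using neg by simp
  qed
  then show ?thesis
    by (simp add: Arctan_def q flip: z_def)
qed

text \<open>
  Abel summation of the Fourier series of the square wave. With damping factors \<open>r ^ (2 * k + 1)\<close> the series sums to
  \<open>Re (Arctan (r * exp (\<i> * pi * x)))\<close>, which is bounded by \<open>pi / 2\<close> and converges to the square wave
  (times \<open>pi / 4\<close>) as \<open>r\<close> tends to \<open>1\<close>; this replaces uniform bounds for the partial sums of the undamped series.
\<close>

lemma square_wave_integral_expansion:
  fixes f :: "real \<Rightarrow> complex" and c :: "nat \<Rightarrow> complex"
  assumes f: "integrable lborel f"
    and c: "\<And>k. c k = (LBINT x. f x * of_real (cos (real (2*k+1) * (pi * x))))"
    and summ: "summable (\<lambda>k. norm (c k) / real (2*k+1))"
  shows "(LBINT x. f x * of_real (sgn (cos (pi * x)))) = of_real (4 / pi) * (\<Sum>k. (-1)^k * c k / of_nat (2*k+1))"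
proof -
  have [measurable]: "f \<in> borel_measurable borel" using f by simp
  define r where "r n = 1 - inverse (real (Suc n))" for n
  have r01: "0 \<le> r n" "r n < 1" for n by (auto simp: r_def field_simps)
  have r_lim: "r \<longlonglongrightarrow> 1"
    using tendsto_diff[OF tendsto_const[of 1] LIMSEQ_inverse_real_of_nat] by (simp add: r_def[abs_def])
  define A where "A n x = Re (Arctan (of_real (r n) * exp (\<i> * of_real (pi * x))))" for n x
  define a where "a n k x = (-1)^k / real (2*k+1) * r n ^ (2*k+1) * cos (real (2*k+1) * (pi * x))" for n k x
  have A_sums: "(\<lambda>k. a n k x) sums A n x" for n x
  proof -
    have "norm (of_real (r n) * exp (\<i> * of_real (pi * x))) < 1"
      using r01[of n] by (simp add: norm_mult)
    from sums_Re[OF Arctan_series(2)[OF this]]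
    have "(\<lambda>k. Re ((-1)^k / of_nat (2*k+1) * (of_real (r n) * exp (\<i> * of_real (pi * x)))^(2*k+1))) sums A n x"
      by (simp add: A_def)
    moreover have "Re ((-1)^k / of_nat (2*k+1) * (of_real (r n) * exp (\<i> * of_real (pi * x)))^(2*k+1)) = a n k x" for k
    proof -
      have "(of_real (r n) * exp (\<i> * of_real (pi * x)))^(2*k+1)
          = of_real (r n ^ (2*k+1)) * exp (\<i> * of_real (real (2*k+1) * (pi * x)))"
        unfolding power_mult_distrib exp_of_nat_mult[symmetric] by (simp add: mult_ac)
      moreover have "(-1)^k / of_nat (2*k+1) = complex_of_real ((-1)^k / real (2*k+1))" by simp
      ultimately have "(-1)^k / of_nat (2*k+1) * (of_real (r n) * exp (\<i> * of_real (pi * x)))^(2*k+1)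
         = of_real ((-1)^k / real (2*k+1) * r n ^ (2*k+1)) * exp (\<i> * of_real (real (2*k+1) * (pi * x)))"
        by (simp only: of_real_mult mult.assoc)
      then show ?thesis by (simp only: Re_complex_of_real Re_exp times_complex.sel Im_complex_of_real a_def) simp
    qed
    ultimately show ?thesis by simp
  qed
  have A_meas[measurable]: "A n \<in> borel_measurable borel" for n
    by (rule borel_measurable_LIMSEQ_real[where u = "\<lambda>m x. \<Sum>k<m. a n k x"])
       (use A_sums in \<open>auto simp: sums_def a_def\<close>)
  have A_bound: "\<bar>A n x\<bar> \<le> 2" for n x
  proof -
    have "norm (of_real (r n) * exp (\<i> * of_real (pi * x))) < 1"
      using r01[of n] by (simp add: norm_mult)
    then have "\<bar>Im (of_real (r n) * exp (\<i> * of_real (pi * x)))\<bar> < 1"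
      using abs_Im_le_cmod order_le_less_trans by blast
    then have "\<bar>A n x\<bar> < pi/2" unfolding A_def by (intro Re_Arctan_bounds) auto
    then show ?thesis using pi_less_4 by linarith
  qed
  have lim1: "(\<lambda>n. LBINT x. f x * of_real (A n x)) \<longlonglongrightarrow> (LBINT x. f x * of_real (pi / 4 * sgn (cos (pi * x))))"
  proof (rule integral_dominated_convergence[where w = "\<lambda>x. norm (f x) * 2"])
    show "AE x in lborel. (\<lambda>n. f x * of_real (A n x)) \<longlonglongrightarrow> f x * of_real (pi / 4 * sgn (cos (pi * x)))"
      using AE_cos_pi_nonzero
    proof eventually_elim
      case (elim x)
      have cont: "isCont Arctan (exp (\<i> * of_real (pi * x)))"
        by (rule continuous_at_Arctan) (use elim in \<open>auto simp: Re_exp\<close>)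
      have "(\<lambda>n. of_real (r n) * exp (\<i> * of_real (pi * x))) \<longlonglongrightarrow> of_real 1 * exp (\<i> * of_real (pi * x))"
        by (intro tendsto_intros r_lim)
      then have "(\<lambda>n. Re (Arctan (of_real (r n) * exp (\<i> * of_real (pi * x))))) \<longlonglongrightarrow> Re (Arctan (exp (\<i> * of_real (pi * x))))"
        by (intro tendsto_Re isCont_tendsto_compose[OF cont]) simp
      then have "(\<lambda>n. A n x) \<longlonglongrightarrow> pi / 4 * sgn (cos (pi * x))"
        unfolding Re_Arctan_unit_circle[OF elim] A_def .
      then show ?case by (intro tendsto_intros)
    qed
    show "AE x in lborel. norm (f x * of_real (A n x)) \<le> norm (f x) * 2" for n
      using A_bound by (intro AE_I2) (auto simp: norm_mult intro!: mult_left_mono)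
  qed (use f in auto)
  have int_a: "integrable lborel (\<lambda>x. f x * of_real (a n k x))" for n k
  proof (rule Bochner_Integration.integrable_bound[where f = "\<lambda>x. norm (f x) * (r n ^ (2*k+1))"])
    have "\<bar>a n k x\<bar> \<le> r n ^ (2*k+1)" for x
    proof -
      have "\<bar>a n k x\<bar> = 1 / real (2*k+1) * r n ^ (2*k+1) * \<bar>cos (real (2*k+1) * (pi * x))\<bar>"
        using r01[of n] by (simp add: a_def abs_mult)
      also have "\<dots> \<le> 1 * r n ^ (2*k+1) * 1"
        using r01[of n] by (intro mult_mono) auto
      finally show ?thesis by simp
    qed
    then show "AE x in lborel. norm (f x * of_real (a n k x)) \<le> norm (norm (f x) * (r n ^ (2*k+1)))"
      using r01[of n] by (intro AE_I2) (auto simp: norm_mult abs_mult intro!: mult_left_mono)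
    show "(\<lambda>x. f x * of_real (a n k x)) \<in> borel_measurable lborel" unfolding a_def by measurable
  qed (use f in auto)
  have a_bound: "\<bar>a n k x\<bar> \<le> r n ^ k" for n k x
  proof -
    have "\<bar>a n k x\<bar> = 1 / real (2*k+1) * r n ^ (2*k+1) * \<bar>cos (real (2*k+1) * (pi * x))\<bar>"
      using r01[of n] by (simp add: a_def abs_mult)
    also have "\<dots> \<le> 1 * r n ^ k * 1"
      using r01[of n] by (intro mult_mono power_decreasing) auto
    finally show ?thesis by simp
  qed
  have A_int: "(LBINT x. f x * of_real (A n x)) = (\<Sum>k. (-1)^k * c k / of_nat (2*k+1) * of_real (r n ^ (2*k+1)))" for n
  proof -
    have "(LBINT x. f x * of_real (A n x)) = (LBINT x. (\<Sum>k. f x * of_real (a n k x)))"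
    proof (intro Bochner_Integration.integral_cong refl)
      fix x
      have "(\<lambda>k. f x * of_real (a n k x)) sums (f x * of_real (A n x))"
        by (rule sums_mult[OF sums_of_real[OF A_sums]])
      then show "f x * of_real (A n x) = (\<Sum>k. f x * of_real (a n k x))"
        by (rule sums_unique)
    qed
    also have "\<dots> = (\<Sum>k. LBINT x. f x * of_real (a n k x))"
    proof (rule integral_suminf[OF int_a])
      have geo: "summable (\<lambda>k. norm (f x) * r n ^ k)" for x
        using r01[of n] by (intro summable_mult summable_geometric) auto
      show "AE x in lborel. summable (\<lambda>k. norm (f x * of_real (a n k x)))"
      proof (rule AE_I2)
        fix x
        have "norm (norm (f x * of_real (a n k x))) \<le> norm (f x) * r n ^ k" for k
          using a_bound by (auto simp: norm_mult intro!: mult_left_mono)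
        then show "summable (\<lambda>k. norm (f x * of_real (a n k x)))"
          by (rule summable_comparison_test'[OF geo])
      qed
      show "summable (\<lambda>k. LBINT x. norm (f x * of_real (a n k x)))"
      proof (rule summable_comparison_test'[where N = 0])
        show "summable (\<lambda>k. (LBINT x. norm (f x)) * r n ^ k)"
          using r01[of n] by (intro summable_mult summable_geometric) auto
        fix k
        have "(LBINT x. norm (f x * of_real (a n k x))) \<le> (LBINT x. norm (f x) * r n ^ k)"
        proof (rule integral_mono[OF integrable_norm[OF int_a]])
          show "integrable lborel (\<lambda>x. norm (f x) * r n ^ k)" using f by simp
          show "norm (f x * of_real (a n k x)) \<le> norm (f x) * r n ^ k" for x
            using a_bound by (auto simp: norm_mult intro!: mult_left_mono)
        qed
        then show "norm (LBINT x. norm (f x * of_real (a n k x))) \<le> (LBINT x. norm (f x)) * r n ^ k"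
          by simp
      qed
    qed
    also have "(\<lambda>k. LBINT x. f x * of_real (a n k x)) = (\<lambda>k. (-1)^k * c k / of_nat (2*k+1) * of_real (r n ^ (2*k+1)))"
    proof
      fix k
      have "(LBINT x. f x * of_real (a n k x)) =
        (LBINT x. (f x * of_real (cos (real (2*k+1) * (pi * x)))) * of_real ((-1)^k / real (2*k+1) * r n ^ (2*k+1)))"
        unfolding a_def by (rule Bochner_Integration.integral_cong) (auto simp: mult_ac)
      also have "\<dots> = c k * of_real ((-1)^k / real (2*k+1) * r n ^ (2*k+1))"
        unfolding c by (rule integral_mult_left_zero)
      finally show "(LBINT x. f x * of_real (a n k x)) = (-1)^k * c k / of_nat (2*k+1) * of_real (r n ^ (2*k+1))"
        by simp
    qed
    finally show ?thesis .
  qed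
  have lim2: "(\<lambda>n. LBINT x. f x * of_real (A n x)) \<longlonglongrightarrow> (\<Sum>k. (-1)^k * c k / of_nat (2*k+1))"
    unfolding A_int
  proof (rule suminf_tendsto_dominated(1)[OF _ _ summ])
    fix k
    have "(\<lambda>n. (-1)^k * c k / of_nat (2*k+1) * of_real (r n ^ (2*k+1))) \<longlonglongrightarrow> (-1)^k * c k / of_nat (2*k+1) * of_real (1 ^ (2*k+1))"
      by (intro tendsto_intros r_lim)
    then show "(\<lambda>n. (-1)^k * c k / of_nat (2*k+1) * of_real (r n ^ (2*k+1))) \<longlonglongrightarrow> (-1)^k * c k / of_nat (2*k+1)" by simp
  next
    have "norm ((-1)^k * c k / of_nat (2*k+1) * of_real (r n ^ (2*k+1))) \<le> norm (c k) / real (2*k+1)" for n k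
    proof -
      have "norm ((-1)^k * c k / of_nat (2*k+1) * of_real (r n ^ (2*k+1))) = norm (c k) / real (2*k+1) * r n ^ (2*k+1)"
        using r01[of n] unfolding norm_mult norm_divide norm_power norm_of_nat norm_of_real by simp
      also have "\<dots> \<le> norm (c k) / real (2*k+1) * 1"
        using r01[of n] by (intro mult_left_mono power_le_one) auto
      finally show ?thesis by simp
    qed
    then show "\<forall>\<^sub>F n in sequentially. \<forall>k. norm ((-1)^k * c k / of_nat (2*k+1) * of_real (r n ^ (2*k+1))) \<le> norm (c k) / real (2*k+1)"
      by (intro always_eventually allI)
  qed simp
  have "(LBINT x. f x * of_real (pi / 4 * sgn (cos (pi * x)))) = (\<Sum>k. (-1)^k * c k / of_nat (2*k+1))"
    by (rule LIMSEQ_unique[OF lim1 lim2])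
  moreover have "(LBINT x. f x * of_real (pi / 4 * sgn (cos (pi * x)))) =
    (LBINT x. of_real (pi / 4) * (f x * of_real (sgn (cos (pi * x)))))"
    by (rule Bochner_Integration.integral_cong) (simp_all only: of_real_mult mult_ac)
  moreover have "\<dots> = of_real (pi / 4) * (LBINT x. f x * of_real (sgn (cos (pi * x))))"
    by (rule integral_mult_right_zero)
  ultimately have "of_real (4 / pi) * (\<Sum>k. (-1)^k * c k / of_nat (2*k+1)) =
    of_real (4 / pi) * (of_real (pi / 4) * (LBINT x. f x * of_real (sgn (cos (pi * x)))))"
    by (simp only:)
  also have "\<dots> = (LBINT x. f x * of_real (sgn (cos (pi * x))))"
    unfolding mult.assoc[symmetric] of_real_mult[symmetric] by simp
  finally show ?thesis by (rule sym)
qed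

section \<open>The Gaussian and the theta function\<close>

lemma gaussian_of_real: "gaussian lam (of_real x) = of_real (exp (- (pi * lam) * x\<^sup>2))"
  by (simp add: gaussian_def flip: exp_of_real)

text \<open>
  The characteristic function of the standard normal distribution, after rescaling.
\<close>

lemma gaussian_cos_transform:
  assumes "lam > 0"
  shows "integrable lborel (\<lambda>x. exp (- (pi * lam) * x\<^sup>2))"
    and "(LBINT x. exp (- (pi * lam) * x\<^sup>2) * cos (a * x)) = lam powr (-1/2) * exp (- a\<^sup>2 / (4 * pi * lam))"
proof -
  \<comment> \<open>The scale at which \<open>exp (- (s * x)\<^sup>2 / 2)\<close> is the Gaussian.\<close>
  define s where "s = sqrt (2 * pi * lam)"
  have s: "s > 0" "s\<^sup>2 = 2 * pi * lam" using assms by (auto simp: s_def)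
  have dens: "std_normal_density (s * x) * sqrt (2 * pi) = exp (- (pi * lam) * x\<^sup>2)" for x
    by (simp add: std_normal_density_def power_mult_distrib s)
  have "integrable lborel (\<lambda>x. std_normal_density (s * x))"
    using lborel_integrable_real_affine[of std_normal_density s 0] s by simp
  from integrable_mult_left[OF this, of "sqrt (2 * pi)"]
  show int: "integrable lborel (\<lambda>x. exp (- (pi * lam) * x\<^sup>2))"
    by (simp only: dens)
  have "(LBINT x. exp (- (pi * lam) * x\<^sup>2) * cos (a * x)) =
        (LBINT x. std_normal_density (s * x) * cos (a / s * (s * x))) * sqrt (2 * pi)"
    unfolding integral_mult_left_zero[symmetric] dens[symmetric]
    using s by (intro Bochner_Integration.integral_cong) (auto simp: mult_ac)
  also have "(LBINT x. std_normal_density (s * x) * cos (a / s * (s * x))) =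
       (LBINT x. std_normal_density x * cos (a / s * x)) / s"
    using lborel_integral_real_affine[of s "\<lambda>x. std_normal_density x * cos (a / s * x)" 0] s by simp
  also have "(LBINT x. std_normal_density x * cos (a / s * x)) = Re (char std_normal_distribution (a / s))"
  proof -
    have int_iexp: "integrable lborel (\<lambda>x. std_normal_density x *\<^sub>R iexp (a / s * x))"
      by (rule Bochner_Integration.integrable_bound[of lborel std_normal_density]) auto
    have "char std_normal_distribution (a / s) = (LBINT x. std_normal_density x *\<^sub>R iexp (a / s * x))"
      unfolding char_def by (subst integral_density) auto
    also have "Re \<dots> = (LBINT x. Re (std_normal_density x *\<^sub>R iexp (a / s * x)))"
      by (rule integral_Re[OF int_iexp, symmetric])
    finally show ?thesis by (simp add: Re_exp)
  qed
  also have "\<dots> = exp (- a\<^sup>2 / (4 * pi * lam))"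
    unfolding char_std_normal_distribution by (simp add: power_divide s)
  also have "exp (- a\<^sup>2 / (4 * pi * lam)) / s * sqrt (2 * pi) = lam powr (-1/2) * exp (- a\<^sup>2 / (4 * pi * lam))"
    using assms by (simp add: s_def real_sqrt_mult powr_minus powr_half_sqrt field_simps)
  finally show "(LBINT x. exp (- (pi * lam) * x\<^sup>2) * cos (a * x)) = lam powr (-1/2) * exp (- a\<^sup>2 / (4 * pi * lam))" .
qed

lemma summable_gaussian_nat:
  fixes c :: real
  assumes "c > 0"
  shows "summable (\<lambda>k. real k ^ p * exp (- c * (real k + 1/2)\<^sup>2))"
proof (rule summable_comparison_test_bigo)
  show "summable (\<lambda>k. norm (1 / real k ^ 2))"
    using inverse_power_summable[of 2, where 'a = real] by (simp add: divide_inverse)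
  show "(\<lambda>k. real k ^ p * exp (- c * (real k + 1/2)\<^sup>2)) \<in> O(\<lambda>k. 1 / real k ^ 2)"
    using assms by real_asymp
qed

text \<open>
  The indices \<open>k\<close> and \<open>- 1 - k\<close> belong to the half-integers \<open>k + 1/2\<close> and \<open>- (k + 1/2)\<close>.
\<close>

lemma infsum_int_eq_suminf:
  fixes f :: "int \<Rightarrow> 'a :: banach"
  assumes "summable (\<lambda>k. norm (f (int k)))" "summable (\<lambda>k. norm (f (- 1 - int k)))"
  shows "(\<Sum>\<^sub>\<infinity>n. f n) = (\<Sum>k. f (int k) + f (- 1 - int k))"
proof -
  have split: "range int \<union> range (\<lambda>k. - 1 - int k) = UNIV"
  proof -
    have "n \<in> range int \<union> range (\<lambda>k. - 1 - int k)" for n :: int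
    proof (cases "n \<ge> 0")
      case True
      then have "n = int (nat n)" by simp
      then show ?thesis by blast
    next
      case False
      then have "n = - 1 - int (nat (- 1 - n))" by simp
      then show ?thesis by blast
    qed
    then show ?thesis by blast
  qed
  have half: "(f has_sum (\<Sum>k. f (h k))) (range h)" if "inj h" "summable (\<lambda>k. norm (f (h k)))" for h :: "nat \<Rightarrow> int"
    using norm_summable_imp_has_sum[OF that(2) summable_sums[OF summable_norm_cancel[OF that(2)]]] that(1)
    by (simp add: has_sum_reindex o_def)
  have "(f has_sum ((\<Sum>k. f (int k)) + (\<Sum>k. f (- 1 - int k)))) (range int \<union> range (\<lambda>k. - 1 - int k))"
    by (intro has_sum_Un_disjoint half assms) (auto simp: inj_on_def)
  then have "(\<Sum>\<^sub>\<infinity>n. f n) = (\<Sum>k. f (int k)) + (\<Sum>k. f (- 1 - int k))"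
    unfolding split by (rule infsumI)
  also have "\<dots> = (\<Sum>k. f (int k) + f (- 1 - int k))"
    by (rule suminf_add[OF summable_norm_cancel[OF assms(1)] summable_norm_cancel[OF assms(2)]])
  finally show ?thesis .
qed

lemma theta1_eq_cos_series:
  assumes "lam > 0"
  shows "theta1 (of_real u) (\<i> * of_real (1/lam)) =
    (\<Sum>k. of_real (2 * exp (- (pi / lam) * (real k + 1/2)\<^sup>2) * cos (real (2*k+1) * pi * u)))"
proof -
  let ?f = "\<lambda>n::int. exp (of_real pi * \<i> * (\<i> * of_real (1/lam)) * (of_int n + 1/2)\<^sup>2) *
     exp (2 * of_real pi * \<i> * ((of_int n + 1/2) * complex_of_real u))"
  have f: "?f n = of_real (exp (- (pi / lam) * (of_int n + 1/2)\<^sup>2)) * exp (\<i> * of_real (2 * pi * (of_int n + 1/2) * u))" for n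
  proof -
    have "of_real pi * \<i> * (\<i> * of_real (1/lam)) * (of_int n + 1/2)\<^sup>2 = complex_of_real (- (pi / lam) * (of_int n + 1/2)\<^sup>2)"
      by (simp add: power2_eq_square algebra_simps)
    moreover have "2 * of_real pi * \<i> * ((of_int n + 1/2) * complex_of_real u) = \<i> * of_real (2 * pi * (of_int n + 1/2) * u)"
      by (simp add: algebra_simps)
    ultimately show ?thesis by (simp only: exp_of_real)
  qed
  have norm: "norm (?f n) = exp (- (pi / lam) * (of_int n + 1/2)\<^sup>2)" for n
    unfolding f norm_mult by simp
  have sq: "(of_int (- 1 - int k) + 1/2)\<^sup>2 = (real k + 1/2)\<^sup>2" for k
    by (simp add: power2_eq_square algebra_simps)
  have summ: "summable (\<lambda>k. exp (- (pi / lam) * (real k + 1/2)\<^sup>2))"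
    using summable_gaussian_nat[of "pi/lam" 0] assms by simp
  have "theta1 (of_real u) (\<i> * of_real (1/lam)) = (\<Sum>k. ?f (int k) + ?f (- 1 - int k))"
    unfolding theta1_def
  proof (rule infsum_int_eq_suminf)
    show "summable (\<lambda>k. norm (?f (int k)))"
      unfolding norm using summ by simp
    show "summable (\<lambda>k. norm (?f (- 1 - int k)))"
      unfolding norm sq using summ by simp
  qed
  also have "(\<lambda>k. ?f (int k) + ?f (- 1 - int k)) =
    (\<lambda>k. of_real (2 * exp (- (pi / lam) * (real k + 1/2)\<^sup>2) * cos (real (2*k+1) * pi * u)))"
  proof
    fix k
    have "2 * pi * (of_int (int k) + 1/2) * u = real (2*k+1) * pi * u"
      "2 * pi * (of_int (- 1 - int k) + 1/2) * u = - (real (2*k+1) * pi * u)"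
      by (auto simp: algebra_simps)
    then show "?f (int k) + ?f (- 1 - int k) =
        of_real (2 * exp (- (pi / lam) * (real k + 1/2)\<^sup>2) * cos (real (2*k+1) * pi * u))"
      unfolding f unfolding sq of_int_of_nat_eq
      by (simp only: cis_conv_exp[symmetric]) (simp add: complex_eq_iff)
  qed
  finally show ?thesis .
qed

lemma has_integral_theta1:
  assumes "lam > 0"
  shows "((\<lambda>u. theta1 (of_real u) (\<i> * of_real (1/lam))) has_integral
    of_real (4 / pi * (\<Sum>k. (-1)^k / real (2*k+1) * exp (- (pi / lam) * (real k + 1/2)\<^sup>2)))) {-1/2..1/2::real}"
proof -
  define q where "q k = exp (- (pi / lam) * (real k + 1/2)\<^sup>2)" for k
  define g where "g k u = complex_of_real (2 * q k * cos (real (2*k+1) * pi * u))" for k u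
  have summ: "summable q"
    using summable_gaussian_nat[of "pi/lam" 0] assms by (simp add: q_def[abs_def])
  have "uniform_limit {-1/2..1/2} (\<lambda>n u. \<Sum>k<n. g k u) (\<lambda>u. \<Sum>k. g k u) sequentially"
  proof (rule Weierstrass_m_test)
    show "summable (\<lambda>k. 2 * q k)" using summ by (rule summable_mult)
    show "norm (g k u) \<le> 2 * q k" for k u
      unfolding g_def norm_of_real by (simp add: q_def abs_mult mult_left_le)
  qed
  then obtain I J where I: "\<And>n. ((\<lambda>u. \<Sum>k<n. g k u) has_integral I n) {-1/2..1/2}"
    and J: "((\<lambda>u. \<Sum>k. g k u) has_integral J) {-1/2..1/2}" and IJ: "I \<longlonglongrightarrow> J"
    by (rule uniform_limit_integral) (auto simp: g_def intro!: continuous_intros)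
  define b where "b k = 4 / pi * ((-1)^k / real (2*k+1) * q k)" for k
  have g_int: "(g k has_integral of_real (b k)) {-1/2..1/2}" for k
  proof -
    have "((\<lambda>u. 2 * q k * cos (real (2*k+1) * pi * u)) has_integral
       (2 * q k * sin (real (2*k+1) * pi * (1/2)) / (real (2*k+1) * pi) -
        2 * q k * sin (real (2*k+1) * pi * (-1/2)) / (real (2*k+1) * pi))) {-1/2..1/2}"
    proof (rule fundamental_theorem_of_calculus)
      fix x :: real
      have "((\<lambda>u. 2 * q k * sin (real (2*k+1) * pi * u) / (real (2*k+1) * pi)) has_real_derivative
        2 * q k * (cos (real (2*k+1) * pi * x) * (real (2*k+1) * pi)) / (real (2*k+1) * pi)) (at x within {-1/2..1/2})"
        by (auto intro!: derivative_eq_intros)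
      also have "2 * q k * (cos (real (2*k+1) * pi * x) * (real (2*k+1) * pi)) / (real (2*k+1) * pi) = 2 * q k * cos (real (2*k+1) * pi * x)"
        using pi_gt_zero by (simp del: of_nat_Suc)
      finally show "((\<lambda>u. 2 * q k * sin (real (2*k+1) * pi * u) / (real (2*k+1) * pi)) has_vector_derivative
        2 * q k * cos (real (2*k+1) * pi * x)) (at x within {-1/2..1/2})"
        by (simp only: has_real_derivative_iff_has_vector_derivative)
    qed simp
    moreover have "sin (real (2*k+1) * pi * (1/2)) = (-1)^k"
    proof -
      have "real (2*k+1) * pi * (1/2) = real k * pi + pi / 2" by (simp add: field_simps)
      then show ?thesis by (simp only: sin_add) simp
    qed
    moreover have "real (2*k+1) * pi * (-1/2) = - (real (2*k+1) * pi * (1/2))" by simp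
    ultimately have "((\<lambda>u. 2 * q k * cos (real (2*k+1) * pi * u)) has_integral b k) {-1/2..1/2}"
      by (simp only: sin_minus b_def) (simp add: field_simps)
    from has_integral_of_real[OF this] show ?thesis by (simp add: g_def[abs_def])
  qed
  have "I n = (\<Sum>k<n. of_real (b k))" for n
    by (rule has_integral_unique[OF I]) (intro has_integral_sum g_int, simp)
  then have "I = (\<lambda>n. \<Sum>k<n. of_real (b k))" by (rule ext)
  then have "(\<lambda>k. complex_of_real (b k)) sums J" using IJ unfolding sums_def by simp
  moreover have "summable (\<lambda>k. (-1)^k / real (2*k+1) * q k)"
  proof (rule summable_comparison_test'[OF summ])
    show "norm ((-1)^k / real (2*k+1) * q k) \<le> q k" for k
      by (simp add: abs_mult q_def field_simps)
  qed
  then have "(\<lambda>k. b k) sums (4 / pi * (\<Sum>k. (-1)^k / real (2*k+1) * q k))"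
    unfolding b_def by (intro sums_mult summable_sums)
  then have "(\<lambda>k. complex_of_real (b k)) sums of_real (4 / pi * (\<Sum>k. (-1)^k / real (2*k+1) * q k))"
    by (rule sums_of_real)
  ultimately have "J = of_real (4 / pi * (\<Sum>k. (-1)^k / real (2*k+1) * q k))"
    by (rule sums_unique2)
  moreover have "(\<lambda>u. theta1 (of_real u) (\<i> * of_real (1/lam))) = (\<lambda>u. \<Sum>k. g k u)"
    by (rule ext) (simp only: theta1_eq_cos_series[OF assms] g_def q_def)
  ultimately show ?thesis using J by (simp add: q_def)
qed

lemma gaussian_square_wave_eq_theta:
  assumes "lam > 0"
  shows "(LBINT x. exp (- (pi * lam) * x\<^sup>2) * sgn (cos (pi * x))) =
    lam powr (-1/2) * Re (integral {-1/2..1/2::real} (\<lambda>u. theta1 (of_real u) (\<i> * of_real (1/lam))))"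
proof -
  define G where "G x = exp (- (pi * lam) * x\<^sup>2)" for x
  define q where "q k = exp (- (pi / lam) * (real k + 1/2)\<^sup>2)" for k
  define A where "A = lam powr (-1/2)"
  have A: "A \<ge> 0" by (simp add: A_def)
  have Gint: "integrable lborel G" using gaussian_cos_transform(1)[OF assms] by (simp add: G_def[abs_def])
  have summ: "summable q"
    using summable_gaussian_nat[of "pi/lam" 0] assms by (simp add: q_def[abs_def])
  have summ': "summable (\<lambda>k. (-1)^k / real (2*k+1) * q k)"
  proof (rule summable_comparison_test'[OF summ])
    show "norm ((-1)^k / real (2*k+1) * q k) \<le> q k" for k
      by (simp add: abs_mult q_def field_simps)
  qed
  have "complex_of_real (LBINT x. G x * sgn (cos (pi * x))) = (LBINT x. of_real (G x) * of_real (sgn (cos (pi * x))))"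
    by (simp flip: of_real_mult)
  also have "\<dots> = of_real (4 / pi) * (\<Sum>k. (-1)^k * complex_of_real (A * q k) / of_nat (2*k+1))"
  proof (rule square_wave_integral_expansion)
    show "integrable lborel (\<lambda>x. complex_of_real (G x))" using Gint by simp
    fix k
    have "(LBINT x. complex_of_real (G x) * of_real (cos (real (2*k+1) * (pi * x)))) = of_real (LBINT x. G x * cos (real (2*k+1) * pi * x))"
      by (simp only: flip: of_real_mult integral_complex_of_real) (simp add: mult.assoc)
    also have "(LBINT x. G x * cos (real (2*k+1) * pi * x)) = A * exp (- (real (2*k+1) * pi)\<^sup>2 / (4 * pi * lam))"
      unfolding G_def A_def by (rule gaussian_cos_transform(2)[OF assms])
    also have "- (real (2*k+1) * pi)\<^sup>2 / (4 * pi * lam) = - (pi / lam) * (real k + 1/2)\<^sup>2"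
      using assms by (simp add: field_simps power2_eq_square)
    finally show "complex_of_real (A * q k) = (LBINT x. complex_of_real (G x) * of_real (cos (real (2*k+1) * (pi * x))))"
      by (simp add: q_def)
  next
    show "summable (\<lambda>k. norm (complex_of_real (A * q k)) / real (2*k+1))"
    proof (rule summable_comparison_test'[OF summable_mult[OF summ]])
      fix k
      have "A * q k \<ge> 0" using A by (simp add: q_def)
      then have "A * q k / real (2*k+1) \<le> A * q k"
        using divide_left_mono[of 1 "real (2*k+1)" "A * q k"] by simp
      moreover have "norm (complex_of_real (A * q k)) = A * q k"
        unfolding norm_of_real using \<open>A * q k \<ge> 0\<close> by (rule abs_of_nonneg)
      ultimately show "norm (norm (complex_of_real (A * q k)) / real (2*k+1)) \<le> A * q k"
        using \<open>A * q k \<ge> 0\<close> by (simp only: real_norm_def abs_divide abs_of_nonneg of_nat_0_le_iff)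
    qed
  qed
  also have "(\<lambda>k. (-1)^k * complex_of_real (A * q k) / of_nat (2*k+1)) = (\<lambda>k. of_real (A * ((-1)^k / real (2*k+1) * q k)))"
    by (rule ext) simp
  also have "(\<Sum>k. complex_of_real (A * ((-1)^k / real (2*k+1) * q k))) = of_real (\<Sum>k. A * ((-1)^k / real (2*k+1) * q k))"
    by (rule suminf_of_real[symmetric]) (intro summable_mult summ')
  also have "(\<Sum>k. A * ((-1)^k / real (2*k+1) * q k)) = A * (\<Sum>k. (-1)^k / real (2*k+1) * q k)"
    by (rule suminf_mult[OF summ'])
  finally have "(LBINT x. G x * sgn (cos (pi * x))) = 4 / pi * (A * (\<Sum>k. (-1)^k / real (2*k+1) * q k))"
    unfolding of_real_mult[symmetric] of_real_eq_iff .
  also have "\<dots> = A * (4 / pi * (\<Sum>k. (-1)^k / real (2*k+1) * q k))"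
    by (rule mult.left_commute)
  also have "4 / pi * (\<Sum>k. (-1)^k / real (2*k+1) * q k) =
     Re (integral {-1/2..1/2::real} (\<lambda>u. theta1 (of_real u) (\<i> * of_real (1/lam))))"
    unfolding q_def integral_unique[OF has_integral_theta1[OF assms]] Re_complex_of_real ..
  finally show ?thesis by (simp only: G_def A_def)
qed

section \<open>Sign of the interpolation error of the Gaussian\<close>

text \<open>
  The zeros of \<open>f'\<close> are kept below \<open>Max Z\<close>, so that in the induction the zero that Rolle's theorem gives
  between \<open>Max Z\<close> and a new, larger zero of \<open>f\<close> is different from the earlier ones.
\<close>

lemma Rolle_finite_zeros:
  fixes f f' :: "real \<Rightarrow> real"
  assumes "\<And>x. (f has_real_derivative f' x) (at x)"
    and "finite Z" "Z \<noteq> {}" "\<And>z. z \<in> Z \<Longrightarrow> f z = 0"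
  shows "\<exists>Z'. finite Z' \<and> Suc (card Z') = card Z \<and> (\<forall>z\<in>Z'. f' z = 0 \<and> z < Max Z)"
  using assms(2-4)
proof (induction Z rule: finite_linorder_max_induct)
  case empty
  then show ?case by simp
next
  case (insert b A)
  show ?case
  proof (cases "A = {}")
    case True
    then show ?thesis by (intro exI[of _ "{}"]) auto
  next
    case False
    then obtain Z' where Z': "finite Z'" "Suc (card Z') = card A" "\<forall>z\<in>Z'. f' z = 0 \<and> z < Max A"
      using insert by auto
    have lt: "Max A < b" using insert False by simp
    have eq: "f (Max A) = f b" using insert.prems(2) Max_in[OF insert.hyps(1) False] by simp
    have "\<exists>c. Max A < c \<and> c < b \<and> (f has_real_derivative 0) (at c)"
    proof (rule Rolle[OF lt eq])
      show "continuous_on {Max A..b} f"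
        by (intro continuous_at_imp_continuous_on ballI DERIV_isCont[OF assms(1)])
      show "f differentiable (at c)" for c
        using assms(1) real_differentiable_def by blast
    qed
    then obtain c where c: "Max A < c" "c < b" "f' c = 0"
      using assms(1) DERIV_unique by blast
    have "c \<notin> Z'" using Z' c by fastforce
    moreover have "Max (insert b A) = b" using insert lt False by (simp add: Max_insert)
    moreover have "b \<notin> A" using insert by auto
    ultimately show ?thesis
      using Z' c insert.hyps(1) lt by (intro exI[of _ "insert c Z'"]) auto
  qed
qed

lemma Rolle_iterated:
  fixes D :: "nat \<Rightarrow> real \<Rightarrow> real"
  assumes "\<And>j x. (D j has_real_derivative D (Suc j) x) (at x)"
    and "finite Z" "card Z = Suc n" "\<And>z. z \<in> Z \<Longrightarrow> D 0 z = 0"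
  shows "\<exists>\<xi>. D n \<xi> = 0"
  using assms
proof (induction n arbitrary: D Z)
  case 0
  then obtain z where "z \<in> Z" by (metis card_eq_0_iff equals0I nat.distinct(1))
  then show ?case using 0 by blast
next
  case (Suc n)
  have "Z \<noteq> {}" using Suc.prems(3) by auto
  from Rolle_finite_zeros[OF Suc.prems(1) Suc.prems(2) this Suc.prems(4)]
  obtain Z' where "finite Z'" "card Z' = Suc n" "\<forall>z\<in>Z'. D (Suc 0) z = 0"
    using Suc.prems(3) by auto
  with Suc.IH[of "\<lambda>j. D (Suc j)" Z'] Suc.prems(1) show ?case by auto
qed

lemma higher_pderiv_degree_le:
  fixes q :: "real poly"
  assumes "degree q \<le> N"
  shows "(pderiv ^^ N) q = [:fact N * coeff q N:]"
proof (rule poly_eqI)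
  fix k
  show "coeff ((pderiv ^^ N) q) k = coeff [:fact N * coeff q N:] k"
    using assms by (cases k) (auto simp: coeff_higher_pderiv pochhammer_fact coeff_eq_0)
qed

text \<open>
  Let \<open>W\<close> be the product of the \<open>t - b k\<close> and choose \<open>C\<close> such that \<open>exp (- l * t) - p t - C * W t\<close> vanishes at
  \<open>s\<close> too. This function then has \<open>N + 1\<close> zeros, so its \<open>N\<close>-th derivative
  \<open>(- l) ^ N * exp (- l * t) - N! * C\<close> has a zero, and \<open>C\<close> has the sign of \<open>(- 1) ^ N\<close>.
\<close>

lemma exp_interpolation_sign:
  fixes b :: "nat \<Rightarrow> real" and p :: "real poly"
  assumes l: "l \<ge> 0" and inj: "inj_on b {..<N}"
    and deg: "degree p < N" and node: "\<And>n. n < N \<Longrightarrow> poly p (b n) = exp (- l * b n)"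
  shows "(exp (- l * s) - poly p s) * (\<Prod>k<N. b k - s) \<ge> 0"
proof (cases "s \<in> b ` {..<N}")
  case True
  then have "(\<Prod>k<N. b k - s) = 0" by (auto intro!: prod_zero)
  show ?thesis unfolding \<open>(\<Prod>k<N. b k - s) = 0\<close> by simp
next
  case False
  define W where "W = (\<Prod>k<N. [:- b k, 1:])"
  have W: "poly W t = (\<Prod>k<N. t - b k)" for t by (simp add: W_def poly_prod)
  have "poly W s \<noteq> 0" using False by (auto simp: W)
  define C where "C = (exp (- l * s) - poly p s) / poly W s"
  have C: "exp (- l * s) - poly p s = C * poly W s" using \<open>poly W s \<noteq> 0\<close> by (simp add: C_def)
  define q where "q = p + smult C W"
  define D where "D j t = (- l) ^ j * exp (- l * t) - poly ((pderiv ^^ j) q) t" for j t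
  have degW: "degree W = N" and monic: "coeff W N = 1"
  proof -
    have lc: "lead_coeff W = 1" by (simp add: W_def lead_coeff_prod)
    have "degree W = (\<Sum>k<N. degree [:- b k, 1:])"
      unfolding W_def by (rule degree_prod_eq_sum_degree) simp
    then show "degree W = N" by simp
    then show "coeff W N = 1" using lc by simp
  qed
  have "\<exists>\<xi>. D N \<xi> = 0"
  proof (rule Rolle_iterated)
    show "(D j has_real_derivative D (Suc j) x) (at x)" for j x
      unfolding D_def by (auto intro!: derivative_eq_intros poly_DERIV simp: algebra_simps)
    show "finite (insert s (b ` {..<N}))" by simp
    show "card (insert s (b ` {..<N})) = Suc N"
      using False inj by (simp add: card_image)
    show "D 0 z = 0" if "z \<in> insert s (b ` {..<N})" for z
      using that C node by (auto simp: D_def q_def W intro!: prod_zero)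
  qed
  then obtain \<xi> where \<xi>: "D N \<xi> = 0" by blast
  have "degree q \<le> N" unfolding q_def
    by (rule degree_add_le) (use deg degW degree_smult_le[of C W] in auto)
  moreover have "coeff q N = C" using deg monic by (simp add: q_def coeff_eq_0)
  ultimately have "(- l) ^ N * exp (- l * \<xi>) = fact N * C"
    using \<xi> by (simp add: D_def higher_pderiv_degree_le)
  then have CC: "C = (- l) ^ N * exp (- l * \<xi>) / fact N" by simp
  have "poly W s = (- 1) ^ N * (\<Prod>k<N. b k - s)"
    unfolding W using prod.distrib[of "\<lambda>_. - 1" "\<lambda>k. b k - s" "{..<N}"] by simp
  then have "(exp (- l * s) - poly p s) * (\<Prod>k<N. b k - s) =
     ((- l) ^ N * (- 1) ^ N) * (exp (- l * \<xi>) / fact N) * (\<Prod>k<N. b k - s)\<^sup>2"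
    unfolding C CC by (simp add: power2_eq_square)
  also have "(- l) ^ N * (- 1) ^ N = l ^ N" by (simp flip: power_mult_distrib)
  finally show ?thesis using l by simp
qed

definition half_odd :: "nat \<Rightarrow> real" where "half_odd n = real n + 1/2"

lemma half_odd_pos: "half_odd n > 0" by (simp add: half_odd_def)

lemma half_odd_sq_inj: "(half_odd k)\<^sup>2 = (half_odd n)\<^sup>2 \<longleftrightarrow> k = n"
  using half_odd_pos[of k] half_odd_pos[of n] by (auto simp: power2_eq_iff half_odd_def)

lemma exp_interpolation_half_odd_squares:
  assumes "l \<ge> 0"
  shows "(exp (- l * s) - (\<Sum>n<N. exp (- l * (half_odd n)\<^sup>2) *
            (\<Prod>k\<in>{..<N}-{n}. ((half_odd k)\<^sup>2 - s) / ((half_odd k)\<^sup>2 - (half_odd n)\<^sup>2)))) *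
          (\<Prod>k<N. (half_odd k)\<^sup>2 - s) \<ge> 0"
proof (cases "N = 0")
  case True
  then show ?thesis by simp
next
  case False
  define b where "b k = (half_odd k)\<^sup>2" for k
  have neq: "b k \<noteq> b n" if "k \<noteq> n" for k n using that by (simp add: b_def half_odd_sq_inj)
  define p where "p = (\<Sum>n<N. smult (exp (- l * b n)) (\<Prod>k\<in>{..<N}-{n}. smult (1 / (b k - b n)) [:b k, -1:]))"
  have p: "poly p t = (\<Sum>n<N. exp (- l * b n) * (\<Prod>k\<in>{..<N}-{n}. (b k - t) / (b k - b n)))" for t
    by (simp add: p_def poly_sum poly_prod diff_divide_distrib)
  have "(exp (- l * s) - poly p s) * (\<Prod>k<N. b k - s) \<ge> 0"
  proof (rule exp_interpolation_sign[OF assms])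
    show "inj_on b {..<N}" using neq by (auto simp: inj_on_def)
    have "degree (smult (exp (- l * b n)) (\<Prod>k\<in>{..<N}-{n}. smult (1 / (b k - b n)) [:b k, -1:])) \<le> N - 1"
      if "n < N" for n
    proof -
      have "degree (\<Prod>k\<in>{..<N}-{n}. smult (1 / (b k - b n)) [:b k, -1:])
         \<le> (\<Sum>k\<in>{..<N}-{n}. degree (smult (1 / (b k - b n)) [:b k, -1:]))"
        by (rule degree_prod_sum_le[unfolded o_def]) simp
      also have "\<dots> \<le> (\<Sum>k\<in>{..<N}-{n}. 1)"
        by (intro sum_mono order_trans[OF degree_smult_le]) simp
      also have "\<dots> = N - 1" using that by simp
      finally show ?thesis by (intro order_trans[OF degree_smult_le])
    qed
    then have "degree p \<le> N - 1" unfolding p_def by (intro degree_sum_le) auto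
    then show "degree p < N" using False by simp
    show "poly p (b m) = exp (- l * b m)" if m: "m < N" for m
    proof -
      have "(\<Prod>k\<in>{..<N}-{n}. (b k - b m) / (b k - b n)) = (if n = m then 1 else 0)" for n
      proof (cases "n = m")
        case True
        then show ?thesis using neq by (auto intro!: prod.neutral)
      next
        case False
        then show ?thesis using m by (auto intro!: prod_zero bexI[of _ m])
      qed
      then have "poly p (b m) = (\<Sum>n<N. if n = m then exp (- l * b n) else 0)"
        unfolding p by (intro sum.cong) auto
      then show ?thesis using m by simp
    qed
  qed
  then show ?thesis by (simp add: p b_def)
qed

definition wallis_prod :: "nat \<Rightarrow> real" where
  "wallis_prod N = (\<Prod>k=1..N. (4 * real k ^ 2) / (4 * real k ^ 2 - 1))"

lemma wallis_prod_ge_1: "wallis_prod N \<ge> 1"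
proof -
  have "(4 * real k ^ 2) / (4 * real k ^ 2 - 1) \<ge> 1" if "k \<ge> 1" for k
  proof -
    have "real k ^ 2 \<ge> 1" using that by simp
    then show ?thesis by (simp add: field_simps)
  qed
  then show ?thesis unfolding wallis_prod_def by (intro prod_ge_1) auto
qed

text \<open>
  Wallis' product in terms of the half-integers.
\<close>

lemma prod_half_odd_squares:
  "(fact N)\<^sup>2 = (2 * real N + 1) * wallis_prod N * (\<Prod>k<N. (half_odd k)\<^sup>2)"
proof (induction N)
  case 0
  then show ?case by (simp add: wallis_prod_def)
next
  case (Suc N)
  have nz: "(2 * real N + 1) * (2 * real N + 3) \<noteq> 0" by (simp add: add_nonneg_eq_0_iff)
  have "4 * real (Suc N) ^ 2 - 1 = (2 * real N + 1) * (2 * real N + 3)"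
    by (simp add: power2_eq_square algebra_simps)
  then have w: "wallis_prod (Suc N) * ((2 * real N + 1) * (2 * real N + 3)) = wallis_prod N * (4 * real (Suc N) ^ 2)"
    using nz by (simp add: wallis_prod_def del: of_nat_Suc)
  have h: "(half_odd N)\<^sup>2 * 4 = (2 * real N + 1)\<^sup>2" by (simp add: half_odd_def power2_eq_square algebra_simps)
  have "4 * ((2 * real (Suc N) + 1) * wallis_prod (Suc N) * (\<Prod>k<Suc N. (half_odd k)\<^sup>2))
     = (2 * real N + 3) * wallis_prod (Suc N) * (\<Prod>k<N. (half_odd k)\<^sup>2) * ((half_odd N)\<^sup>2 * 4)"
    by (simp add: algebra_simps)
  also have "\<dots> = (wallis_prod (Suc N) * ((2 * real N + 1) * (2 * real N + 3))) * (2 * real N + 1) * (\<Prod>k<N. (half_odd k)\<^sup>2)"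
    unfolding h by (simp add: power2_eq_square mult_ac)
  also have "\<dots> = 4 * (real (Suc N) ^ 2 * ((2 * real N + 1) * wallis_prod N * (\<Prod>k<N. (half_odd k)\<^sup>2)))"
    unfolding w by (simp only: mult_ac)
  also have "\<dots> = 4 * (fact (Suc N))\<^sup>2"
    unfolding Suc.IH[symmetric] by (simp add: power_mult_distrib)
  finally show ?case by simp
qed

text \<open>
  The factors are \<open>(k - n) * (k + n + 1)\<close>, so the product is a quotient of factorials.
\<close>

lemma prod_below_node:
  "j \<le> n \<Longrightarrow> (\<Prod>k<j. (half_odd k)\<^sup>2 - (half_odd n)\<^sup>2) * fact (n - j) = (-1)^j * fact (n + j)"
proof (induction j)
  case 0
  then show ?case by simp
next
  case (Suc j)
  have f: "fact (n - j) = real (n - j) * fact (n - Suc j)"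
    using Suc.prems by (metis Suc_diff_Suc Suc_le_lessD fact_Suc)
  have d: "(half_odd j)\<^sup>2 - (half_odd n)\<^sup>2 = - (real (n - j) * real (n + j + 1))"
    using Suc.prems by (simp add: half_odd_def power2_eq_square algebra_simps of_nat_diff)
  have "(\<Prod>k<Suc j. (half_odd k)\<^sup>2 - (half_odd n)\<^sup>2) * fact (n - Suc j)
    = - ((\<Prod>k<j. (half_odd k)\<^sup>2 - (half_odd n)\<^sup>2) * fact (n - j)) * real (n + j + 1)"
    unfolding f prod.lessThan_Suc d by (simp only: mult_ac mult_minus_left mult_minus_right)
  also have "\<dots> = (-1)^Suc j * fact (n + Suc j)"
    using Suc by (simp add: mult_ac)
  finally show ?case .
qed

lemma prod_node_differences:
  assumes "N > n"
  shows "(\<Prod>k\<in>{..<N}-{n}. (half_odd k)\<^sup>2 - (half_odd n)\<^sup>2) * (2 * half_odd n) =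
     (-1)^n * fact (N - 1 - n) * fact (N + n)"
  using Suc_leI[OF assms]
proof (induction N rule: dec_induct)
  case base
  have "{..<Suc n} - {n} = {..<n}" by auto
  then show ?case using prod_below_node[of n n]
    by (simp add: half_odd_def algebra_simps)
next
  case (step N)
  then have "n < N" by simp
  have e: "{..<Suc N} - {n} = insert N ({..<N} - {n})" using step by auto
  have f: "fact (N - n) = real (N - n) * fact (N - 1 - n)"
  proof -
    have "N - n = Suc (N - 1 - n)" using \<open>n < N\<close> by simp
    then show ?thesis by (metis fact_Suc)
  qed
  have d: "(half_odd N)\<^sup>2 - (half_odd n)\<^sup>2 = real (N - n) * real (N + n + 1)"
    using step by (simp add: half_odd_def power2_eq_square algebra_simps of_nat_diff)
  have "(\<Prod>k\<in>{..<Suc N}-{n}. (half_odd k)\<^sup>2 - (half_odd n)\<^sup>2) * (2 * half_odd n) =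
     (real (N - n) * real (N + n + 1)) * ((\<Prod>k\<in>{..<N}-{n}. (half_odd k)\<^sup>2 - (half_odd n)\<^sup>2) * (2 * half_odd n))"
    unfolding e by (subst prod.insert) (auto simp: d)
  also have "\<dots> = (-1)^n * (real (N - n) * fact (N - 1 - n)) * (real (N + n + 1) * fact (N + n))"
    unfolding step.IH by (simp only: mult_ac)
  also have "\<dots> = (-1)^n * fact (Suc N - 1 - n) * fact (Suc N + n)"
    unfolding f[symmetric] by simp
  finally show ?case .
qed

lemma fact_ratio_tendsto_1:
  "(\<lambda>N. fact (N - 1 - n) * fact (N + n) * real N / (fact N)\<^sup>2) \<longlonglongrightarrow> 1"
  and fact_ratio_ge_1: "N > n \<Longrightarrow> fact (N - 1 - n) * fact (N + n) * real N / (fact N)\<^sup>2 \<ge> 1"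
proof -
  define r where "r n N = fact (N - 1 - n) * fact (N + n) * real N / (fact N)\<^sup>2" for n N
  have r0: "r 0 N = 1" if "N > 0" for N
  proof -
    have "fact N = real N * fact (N - 1)" using that fact_reduce by blast
    then show ?thesis using that by (simp add: r_def power2_eq_square)
  qed
  have step: "r (Suc n) N = r n N * (real (N + n + 1) / real (N - 1 - n))" if "N > Suc n" for n N
  proof -
    have "fact (N - 1 - n) = real (N - 1 - n) * fact (N - 1 - Suc n)"
    proof -
      have "N - 1 - n = Suc (N - 1 - Suc n)" using that by simp
      then show ?thesis by (metis fact_Suc)
    qed
    moreover have "fact (N + Suc n) = real (N + n + 1) * fact (N + n)" by simp
    moreover have "X * (m * Y) * Z / F = (c * X) * Y * Z / F * (m / c)" if "c \<noteq> 0" for X Y Z F m c :: real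
      using that by simp
    moreover have "real (N - 1 - n) \<noteq> 0" using that by simp
    ultimately show ?thesis unfolding r_def by (simp only:)
  qed
  have "(\<lambda>N. r n N) \<longlonglongrightarrow> 1"
  proof (induction n)
    case 0
    show ?case
      by (rule Lim_transform_eventually[OF tendsto_const])
         (auto intro!: eventually_mono[OF eventually_gt_at_top[of 0]] simp: r0)
  next
    case (Suc n)
    have "(\<lambda>N. real (N + n + 1) / (real N - real (Suc n))) \<longlonglongrightarrow> 1" by real_asymp
    from tendsto_mult[OF Suc this]
    have "(\<lambda>N. r n N * (real (N + n + 1) / (real N - real (Suc n)))) \<longlonglongrightarrow> 1" by simp
    then show ?case
      by (rule Lim_transform_eventually)
         (auto intro!: eventually_mono[OF eventually_gt_at_top[of "Suc n"]] simp: step of_nat_diff algebra_simps)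
  qed
  then show "(\<lambda>N. fact (N - 1 - n) * fact (N + n) * real N / (fact N)\<^sup>2) \<longlonglongrightarrow> 1" by (simp add: r_def)
  have "N > n \<Longrightarrow> r n N \<ge> 1"
  proof (induction n)
    case 0
    then show ?case by (simp add: r0)
  next
    case (Suc n)
    have "real (N + n + 1) / real (N - 1 - n) \<ge> 1" using Suc.prems by (simp add: of_nat_diff)
    with Suc have "r n N * (real (N + n + 1) / real (N - 1 - n)) \<ge> 1 * 1" by (intro mult_mono) auto
    then show ?case using step[OF Suc.prems] by simp
  qed
  then show "N > n \<Longrightarrow> fact (N - 1 - n) * fact (N + n) * real N / (fact N)\<^sup>2 \<ge> 1" by (simp add: r_def)
qed

text \<open>
  The quotient of factorials tends to \<open>1\<close> and is at least \<open>1\<close>, and the last factor tends to \<open>pi\<close> and is at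
  least \<open>2\<close>. So this form shows both the limit of the product and a lower bound that is uniform in \<open>N\<close>.
\<close>

lemma wallis_node_product:
  assumes "N > n"
  shows "(\<Prod>k\<in>{..<N}-{n}. 1 - (half_odd n)\<^sup>2 / (half_odd k)\<^sup>2) =
    (-1)^n * (half_odd n / 2) * (fact (N - 1 - n) * fact (N + n) * real N / (fact N)\<^sup>2) * ((2 * real N + 1) / real N * wallis_prod N)"
proof -
  define B where "B = (\<Prod>k<N. (half_odd k)\<^sup>2)"
  define B' where "B' = (\<Prod>k\<in>{..<N}-{n}. (half_odd k)\<^sup>2)"
  have hp: "half_odd k \<noteq> 0" for k using half_odd_pos[of k] by simp
  have "B > 0" unfolding B_def using hp by (intro prod_pos) auto
  have BB: "B = (half_odd n)\<^sup>2 * B'"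
    unfolding B_def B'_def using assms by (subst prod.remove[of _ n]) auto
  have F: "(fact N)\<^sup>2 = (2 * real N + 1) * wallis_prod N * B"
    using prod_half_odd_squares[of N] by (simp add: B_def)
  have W: "wallis_prod N > 0" using wallis_prod_ge_1[of N] by linarith
  have "(\<Prod>k\<in>{..<N}-{n}. 1 - (half_odd n)\<^sup>2 / (half_odd k)\<^sup>2) =
        (\<Prod>k\<in>{..<N}-{n}. ((half_odd k)\<^sup>2 - (half_odd n)\<^sup>2) / (half_odd k)\<^sup>2)"
    by (intro prod.cong) (auto simp: hp diff_divide_distrib)
  also have "\<dots> = (\<Prod>k\<in>{..<N}-{n}. (half_odd k)\<^sup>2 - (half_odd n)\<^sup>2) / B'"
    by (simp add: prod_dividef B'_def)
  also have "\<dots> = ((\<Prod>k\<in>{..<N}-{n}. (half_odd k)\<^sup>2 - (half_odd n)\<^sup>2) * (2 * half_odd n)) * (half_odd n / 2) / B"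
    using hp[of n] by (simp add: BB power2_eq_square)
  also have "\<dots> = (-1)^n * fact (N - 1 - n) * fact (N + n) * (half_odd n / 2) / B"
    unfolding prod_node_differences[OF assms] ..
  also have "\<dots> = (-1)^n * (half_odd n / 2) * (fact (N - 1 - n) * fact (N + n) * real N / (fact N)\<^sup>2) * ((2 * real N + 1) / real N * wallis_prod N)"
  proof -
    have "(real N) \<noteq> 0" "2 * real N + 1 \<noteq> 0" using assms by auto
    then show ?thesis using \<open>B > 0\<close> W unfolding F by (simp add: divide_simps)
  qed
  finally show ?thesis .
qed

lemma node_product_tendsto:
  "(\<lambda>N. \<Prod>k\<in>{..<N}-{n}. 1 - (half_odd n)\<^sup>2 / (half_odd k)\<^sup>2) \<longlonglongrightarrow> (-1)^n * pi * half_odd n / 2"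
proof -
  have "wallis_prod \<longlonglongrightarrow> pi / 2" using wallis by (simp add: wallis_prod_def[abs_def])
  moreover have "(\<lambda>N. (2 * real N + 1) / real N) \<longlonglongrightarrow> 2" by real_asymp
  ultimately have "(\<lambda>N. (-1)^n * (half_odd n / 2) * (fact (N - 1 - n) * fact (N + n) * real N / (fact N)\<^sup>2) * ((2 * real N + 1) / real N * wallis_prod N))
     \<longlonglongrightarrow> (-1)^n * (half_odd n / 2) * 1 * (2 * (pi / 2))"
    by (intro tendsto_mult tendsto_const fact_ratio_tendsto_1)
  then have "(\<lambda>N. (-1)^n * (half_odd n / 2) * (fact (N - 1 - n) * fact (N + n) * real N / (fact N)\<^sup>2) * ((2 * real N + 1) / real N * wallis_prod N))
     \<longlonglongrightarrow> (-1)^n * pi * half_odd n / 2" by (simp add: mult_ac)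
  then show ?thesis
    by (rule Lim_transform_eventually) (use wallis_node_product in \<open>auto intro!: eventually_mono[OF eventually_gt_at_top[of n]]\<close>)
qed

lemma node_product_lower_bound:
  assumes "N > n"
  shows "\<bar>\<Prod>k\<in>{..<N}-{n}. 1 - (half_odd n)\<^sup>2 / (half_odd k)\<^sup>2\<bar> \<ge> half_odd n"
proof -
  define r where "r = fact (N - 1 - n) * fact (N + n) * real N / (fact N)\<^sup>2"
  have r: "r \<ge> 1" unfolding r_def by (rule fact_ratio_ge_1[OF assms])
  define w where "w = (2 * real N + 1) / real N * wallis_prod N"
  have "(2 * real N + 1) / real N \<ge> 2" using assms by (simp add: field_simps)
  then have w: "w \<ge> 2 * 1"
    unfolding w_def using wallis_prod_ge_1 by (intro mult_mono) auto
  have "half_odd n / 2 * (r * w) \<ge> half_odd n / 2 * (1 * 2)"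
    using r w half_odd_pos[of n] by (intro mult_left_mono mult_mono) auto
  moreover have "\<bar>(-1)^n * (half_odd n / 2) * r * w\<bar> = half_odd n / 2 * (r * w)"
    using r w half_odd_pos[of n] by (simp add: abs_mult)
  ultimately show ?thesis
    unfolding wallis_node_product[OF assms] r_def[symmetric] w_def[symmetric] by simp
qed

lemma sin_prod_double:
  "(\<Prod>k=1..2*N. 1 - (2*x)^2 / real k ^ 2) = (\<Prod>k=1..N. 1 - x^2 / real k ^ 2) * (\<Prod>k<N. 1 - x^2 / (half_odd k)\<^sup>2)"
proof (induction N)
  case 0
  then show ?case by simp
next
  case (Suc N)
  have 1: "1 - (2*x)^2 / real (2 * N + 1) ^ 2 = 1 - x^2 / (half_odd N)\<^sup>2"
  proof -
    have "real (2 * N + 1) = 2 * half_odd N" by (simp add: half_odd_def)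
    then show ?thesis by (simp add: power_mult_distrib)
  qed
  have 2: "1 - (2*x)^2 / real (2 * N + 2) ^ 2 = 1 - x^2 / real (Suc N) ^ 2"
  proof -
    have "real (2 * N + 2) = 2 * real (Suc N)" by simp
    then show ?thesis by (simp only: power_mult_distrib) simp
  qed
  have "(\<Prod>k=1..2*Suc N. 1 - (2*x)^2 / real k ^ 2) =
     (\<Prod>k=1..2*N. 1 - (2*x)^2 / real k ^ 2) * (1 - (2*x)^2 / real (2 * N + 1) ^ 2) * (1 - (2*x)^2 / real (2 * N + 2) ^ 2)"
    by (simp add: mult.assoc)
  then show ?case unfolding 1 2 Suc.IH by (simp add: mult_ac)
qed

text \<open>
  \<open>cos (pi * x) = sin (2 * pi * x) / (2 * sin (pi * x))\<close>, and the even-numbered factors of the sine product at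
  \<open>2 * x\<close> are the factors of the sine product at \<open>x\<close>.
\<close>

lemma cos_prod_half_odd:
  fixes x :: real
  assumes "sin (pi * x) \<noteq> 0"
  shows "(\<lambda>N. \<Prod>k<N. 1 - x^2 / (half_odd k)\<^sup>2) \<longlonglongrightarrow> cos (pi * x)"
proof -
  define S where "S y N = (\<Prod>k=1..N. 1 - y^2 / real k ^ 2)" for y N
  have "x \<noteq> 0" using assms by auto
  have lim: "(\<lambda>N. S y N) \<longlonglongrightarrow> sin (pi * y) / (pi * y)" if "y \<noteq> 0" for y
    using sin_product_formula_real'[OF that] by (simp add: S_def)
  have sub: "strict_mono (\<lambda>N::nat. 2 * N)" by (auto simp: strict_mono_def)
  have "(\<lambda>N. S (2*x) (2*N)) \<longlonglongrightarrow> sin (pi * (2*x)) / (pi * (2*x))"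
    using LIMSEQ_subseq_LIMSEQ[OF lim sub, of "2*x"] \<open>x \<noteq> 0\<close> by (simp add: o_def)
  then have "(\<lambda>N. S (2*x) (2*N) / S x N) \<longlonglongrightarrow> (sin (pi * (2*x)) / (pi * (2*x))) / (sin (pi * x) / (pi * x))"
    using assms \<open>x \<noteq> 0\<close> by (intro tendsto_divide lim) auto
  also have "(sin (pi * (2*x)) / (pi * (2*x))) / (sin (pi * x) / (pi * x)) = cos (pi * x)"
    using assms \<open>x \<noteq> 0\<close> sin_double[of "pi * x"] by (simp add: field_simps)
  also have "(\<lambda>N. S (2*x) (2*N) / S x N) = (\<lambda>N. \<Prod>k<N. 1 - x^2 / (half_odd k)\<^sup>2)"
  proof
    fix N
    have "1 - x^2 / real k ^ 2 \<noteq> 0" if "k \<ge> 1" for k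
    proof
      assume "1 - x^2 / real k ^ 2 = 0"
      then have "x^2 = real k ^ 2" using that by (simp add: field_simps)
      then have "x = real k \<or> x = - real k" by (simp add: power2_eq_iff)
      then show False using assms by auto
    qed
    then have "S x N \<noteq> 0" by (auto simp: S_def)
    then show "S (2*x) (2*N) / S x N = (\<Prod>k<N. 1 - x^2 / (half_odd k)\<^sup>2)"
      unfolding S_def sin_prod_double by simp
  qed
  finally show ?thesis .
qed

lemma half_odd_sq_ne:
  assumes "cos (pi * x) \<noteq> 0"
  shows "(half_odd n)\<^sup>2 \<noteq> x\<^sup>2"
proof
  assume "(half_odd n)\<^sup>2 = x\<^sup>2"
  then have "x = half_odd n \<or> x = - half_odd n" by (auto simp: power2_eq_iff)
  moreover have "cos (pi * half_odd n) = 0"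
    by (simp add: half_odd_def distrib_left cos_add)
  ultimately show False using assms by auto
qed

text \<open>
  In the Lagrange polynomial with nodes \<open>(n + 1/2)\<^sup>2\<close>, \<open>n < N\<close>, evaluated at \<open>x\<^sup>2\<close>, the product in the \<open>n\<close>-th
  summand is a partial product of the cosine, without its \<open>n\<close>-th factor, divided by the product of
  \<open>wallis_node_product\<close>. Its limit is therefore the \<open>n\<close>-th summand of the interpolant on the left, and the lower bound for the
  divisor lets the limit be taken under the sum.
\<close>

lemma gaussian_minus_interpolant_sign:
  assumes "lam > 0" "sin (pi * x) \<noteq> 0" "cos (pi * x) \<noteq> 0"
  shows "(exp (- (pi * lam) * x\<^sup>2) - 2 / pi * cos (pi * x) *
      (\<Sum>n. (-1)^n * exp (- (pi * lam) * (half_odd n)\<^sup>2) * half_odd n / ((half_odd n)\<^sup>2 - x\<^sup>2))) * cos (pi * x) \<ge> 0"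
proof -
  define l where "l = pi * lam"
  define s where "s = x\<^sup>2"
  define b where "b n = (half_odd n)\<^sup>2" for n
  define P where "P N = (\<Prod>k<N. 1 - s / b k)" for N
  define \<rho> where "\<rho> n N = (\<Prod>k\<in>{..<N}-{n}. 1 - b n / b k)" for n N
  define a where "a n N = (if n < N then exp (- l * b n) * (P N / (1 - s / b n) / \<rho> n N) else 0)" for n N
  define T where "T N = (\<Sum>n<N. exp (- l * b n) * (\<Prod>k\<in>{..<N}-{n}. (b k - s) / (b k - b n)))" for N
  have l: "l > 0" using assms by (simp add: l_def)
  have b: "b n > 0" for n using half_odd_pos[of n] by (simp add: b_def)
  have bs: "b n \<noteq> s" for n using half_odd_sq_ne[OF assms(3)] by (simp add: b_def s_def)
  have bne: "1 - s / b n \<noteq> 0" for n using bs[of n] b[of n] by (simp add: field_simps)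
  have Plim: "P \<longlonglongrightarrow> cos (pi * x)"
    using cos_prod_half_odd[OF assms(2)] by (simp add: P_def[abs_def] b_def s_def)
  have \<rho>lim: "\<rho> n \<longlonglongrightarrow> (-1)^n * pi * half_odd n / 2" for n
    using node_product_tendsto[of n] by (simp add: \<rho>_def[abs_def] b_def)
  have T: "T N = (\<Sum>n. a n N)" for N
  proof -
    have "(\<Sum>n. a n N) = (\<Sum>n<N. a n N)" by (rule suminf_finite) (auto simp: a_def)
    also have "\<dots> = T N"
      unfolding T_def
    proof (rule sum.cong)
      fix n assume n: "n \<in> {..<N}"
      have "(\<Prod>k\<in>{..<N}-{n}. (b k - s) / (b k - b n)) = (\<Prod>k\<in>{..<N}-{n}. (1 - s / b k) / (1 - b n / b k))"
      proof (rule prod.cong)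
        fix k
        have "(1 - s / b k) / (1 - b n / b k) = ((b k - s) / b k) / ((b k - b n) / b k)"
          using b[of k] by (simp add: diff_divide_distrib)
        also have "\<dots> = (b k - s) / (b k - b n)" using b[of k] by simp
        finally show "(b k - s) / (b k - b n) = (1 - s / b k) / (1 - b n / b k)" ..
      qed simp
      also have "\<dots> = (\<Prod>k\<in>{..<N}-{n}. 1 - s / b k) / \<rho> n N"
        by (simp add: prod_dividef \<rho>_def)
      also have "(\<Prod>k\<in>{..<N}-{n}. 1 - s / b k) = P N / (1 - s / b n)"
      proof -
        have "P N = (1 - s / b n) * (\<Prod>k\<in>{..<N}-{n}. 1 - s / b k)"
          unfolding P_def by (rule prod.remove) (use n in auto)
        then show ?thesis using bne[of n] by simp
      qed
      finally show "a n N = exp (- l * b n) * (\<Prod>k\<in>{..<N}-{n}. (b k - s) / (b k - b n))"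
        using n by (simp add: a_def)
    qed simp
    finally show ?thesis ..
  qed
  have alim: "(\<lambda>N. a n N) \<longlonglongrightarrow> exp (- l * b n) * (cos (pi * x) / (1 - s / b n) / ((-1)^n * pi * half_odd n / 2))" for n
  proof -
    have "(\<lambda>N. exp (- l * b n) * (P N / (1 - s / b n) / \<rho> n N)) \<longlonglongrightarrow>
       exp (- l * b n) * (cos (pi * x) / (1 - s / b n) / ((-1)^n * pi * half_odd n / 2))"
      using bne half_odd_pos[of n] by (intro tendsto_intros Plim \<rho>lim) auto
    then show ?thesis
      by (rule Lim_transform_eventually)
         (auto intro!: eventually_mono[OF eventually_gt_at_top[of n]] simp: a_def)
  qed
  have term_eq: "exp (- l * b n) * (cos (pi * x) / (1 - s / b n) / ((-1)^n * pi * half_odd n / 2)) =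
     2 / pi * cos (pi * x) * ((-1)^n * exp (- l * b n) * half_odd n / (b n - s))" for n
  proof -
    have h: "half_odd n > 0" by (rule half_odd_pos)
    have f1: "1 - s / b n = (b n - s) / (half_odd n)\<^sup>2" using b[of n] by (simp add: diff_divide_distrib b_def)
    have f2: "1 / (-1)^n = ((-1)^n :: real)" by (metis divide_minus1 minus_one_power_iff div_by_1)
    have f3: "E * (c / (d / h\<^sup>2) / (u * pi * h / 2)) = 2 / pi * c * ((1 / u) * E * h / d)" if "h \<noteq> 0" for E c d h u :: real
      using that by (simp add: power2_eq_square mult_ac)
    show ?thesis
      unfolding f1 f3[OF h[THEN less_imp_neq, symmetric]] f2 ..
  qed
  obtain C where C: "\<And>N. \<bar>P N\<bar> \<le> C" "C > 0"
    using convergent_imp_Bseq[OF convergentI[OF Plim]] by (auto simp: Bseq_def)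
  have "(\<lambda>n. 1 / (1 - s / b n)) \<longlonglongrightarrow> 1"
    unfolding b_def half_odd_def by real_asymp
  from convergent_imp_Bseq[OF convergentI[OF this]]
  \<comment> \<open>The factors \<open>1 - s / b n\<close> are nonzero and tend to \<open>1\<close>, so their inverses are bounded.\<close>
  obtain C' where C': "\<And>n. \<bar>1 / (1 - s / b n)\<bar> \<le> C'" "C' > 0"
    by (auto simp: Bseq_def)
  have bound: "\<bar>a n N\<bar> \<le> (C * C' * 2) * exp (- l * b n)" for n N
  proof (cases "n < N")
    case True
    have "\<bar>\<rho> n N\<bar> \<ge> half_odd n"
      using node_product_lower_bound[OF True] by (simp add: \<rho>_def b_def)
    then have "\<bar>\<rho> n N\<bar> \<ge> 1/2" by (simp add: half_odd_def)
    then have "1 / \<bar>\<rho> n N\<bar> \<le> 2" by (simp add: divide_simps)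
    then have "\<bar>P N\<bar> * \<bar>1 / (1 - s / b n)\<bar> * (1 / \<bar>\<rho> n N\<bar>) \<le> C * C' * 2"
      using C C' by (intro mult_mono) auto
    moreover have "\<bar>a n N\<bar> = exp (- l * b n) * (\<bar>P N\<bar> * \<bar>1 / (1 - s / b n)\<bar> * (1 / \<bar>\<rho> n N\<bar>))"
      using True by (simp add: a_def abs_mult)
    ultimately show ?thesis by (metis mult.commute mult_left_mono exp_ge_zero)
  next
    case False
    then show ?thesis using C C' by (simp add: a_def)
  qed
  have summ: "summable (\<lambda>n. (C * C' * 2) * exp (- l * b n))"
    using summable_mult[OF summable_gaussian_nat[OF l, of 0], of "C * C' * 2"] by (simp add: b_def half_odd_def)
  have ev: "\<forall>\<^sub>F N in sequentially. \<forall>n. norm (a n N) \<le> (C * C' * 2) * exp (- l * b n)"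
    using bound by (intro always_eventually allI) simp
  note tannery = suminf_tendsto_dominated[OF alim[unfolded term_eq] ev summ sequentially_bot]
  define K where "K = (\<Sum>n. (-1)^n * exp (- l * b n) * half_odd n / (b n - s))"
  have "2 / pi * cos (pi * x) \<noteq> 0" using assms by simp
  then have "summable (\<lambda>n. (-1)^n * exp (- l * b n) * half_odd n / (b n - s))"
    by (rule summable_mult_D[OF summable_norm_cancel[OF tannery(2)]])
  then have "(\<Sum>n. 2 / pi * cos (pi * x) * ((-1)^n * exp (- l * b n) * half_odd n / (b n - s))) = 2 / pi * cos (pi * x) * K"
    unfolding K_def by (rule suminf_mult)
  then have Tlim: "T \<longlonglongrightarrow> 2 / pi * cos (pi * x) * K"
    using tannery(1) by (simp add: T[abs_def])
  have "(exp (- l * s) - T N) * P N \<ge> 0" for N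
  proof -
    have "P N = (\<Prod>k<N. (b k - s) / b k)"
      unfolding P_def using b by (intro prod.cong) (auto simp: diff_divide_distrib less_imp_neq[symmetric])
    also have "\<dots> = (\<Prod>k<N. b k - s) / (\<Prod>k<N. b k)" by (rule prod_dividef)
    finally have "(exp (- l * s) - T N) * P N = ((exp (- l * s) - T N) * (\<Prod>k<N. b k - s)) / (\<Prod>k<N. b k)" by simp
    moreover have "(exp (- l * s) - T N) * (\<Prod>k<N. b k - s) \<ge> 0"
      using exp_interpolation_half_odd_squares[of l s N] l by (simp add: T_def b_def)
    moreover have "(\<Prod>k<N. b k) > 0" using b by (intro prod_pos) auto
    ultimately show ?thesis by (simp only: divide_nonneg_pos)
  qed
  moreover have "(\<lambda>N. (exp (- l * s) - T N) * P N) \<longlonglongrightarrow> (exp (- l * s) - 2 / pi * cos (pi * x) * K) * cos (pi * x)"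
    by (intro tendsto_intros Tlim Plim)
  ultimately have "(exp (- l * s) - 2 / pi * cos (pi * x) * K) * cos (pi * x) \<ge> 0"
    by (intro LIMSEQ_le_const[OF _ exI]) auto
  then show ?thesis by (simp only: K_def l_def s_def b_def)
qed

section \<open>Interpolation at the half-integers\<close>

definition half_int :: "int \<Rightarrow> complex" where "half_int n = of_int n + 1/2"

lemma cos_pi_eq_0_iff: "cos (of_real pi * z) = 0 \<longleftrightarrow> z \<in> range half_int" for z :: complex
proof -
  have "cos (of_real pi * z) = 0 \<longleftrightarrow> (\<exists>n::int. of_real pi * z = of_real (n * pi) + of_real pi / 2)"
    by (rule cos_eq_0)
  also have "\<dots> \<longleftrightarrow> (\<exists>n::int. z = half_int n)"
  proof (intro ex_cong1)
    fix n :: int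
    have "of_real (n * pi) + of_real pi / 2 = of_real pi * half_int n"
      by (simp add: half_int_def algebra_simps)
    then show "(of_real pi * z = of_real (n * pi) + of_real pi / 2) \<longleftrightarrow> z = half_int n" by simp
  qed
  finally show ?thesis by auto
qed

lemma sin_pi_half_int: "sin (of_real pi * half_int n) = (-1) powi n"
proof -
  have "of_real pi * half_int n = of_real (of_int n * pi + pi / 2)" by (simp add: half_int_def algebra_simps)
  then have "sin (of_real pi * half_int n) = of_real (sin (of_int n * pi + pi / 2))" by (simp only: sin_of_real)
  also have "sin (of_int n * pi + pi / 2) = cos (of_int n * pi)" by (simp add: sin_add)
  also have "\<dots> = (-1) powi n"
    using cos_npi_int[of n] by (simp add: mult.commute power_int_minus_left)
  finally show ?thesis by simp
qed

lemma norm_cos_ge_sinh: "norm (cos z) \<ge> sinh \<bar>Im z\<bar>" for z :: complex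
proof -
  have "norm (cos z) = norm (exp (\<i> * z) + exp (- (\<i> * z))) / 2"
    by (simp add: cos_exp_eq norm_divide)
  moreover have "norm (exp (\<i> * z) + exp (- (\<i> * z))) \<ge> \<bar>norm (exp (\<i> * z)) - norm (exp (- (\<i> * z)))\<bar>"
    using norm_triangle_ineq3[of "exp (\<i> * z)" "- exp (- (\<i> * z))"] by simp
  moreover have "\<bar>norm (exp (\<i> * z)) - norm (exp (- (\<i> * z)))\<bar> = 2 * sinh \<bar>Im z\<bar>"
    by (cases "Im z \<ge> 0") (auto simp: sinh_def abs_if)
  ultimately show ?thesis by simp
qed

lemma norm_cos_ge_cos_cosh: "norm (cos z) \<ge> \<bar>cos (Re z)\<bar> * cosh (Im z)" for z :: complex
proof -
  have "\<bar>Re (cos z)\<bar> \<le> norm (cos z)" by (rule abs_Re_le_cmod)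
  then show ?thesis by (simp add: Re_cos cosh_def abs_mult add.commute)
qed

text \<open>
  Circles of integral radius keep away from the zeros of the cosine: either \<open>z\<close> is far from the real axis and
  \<open>sinh\<close> is a good lower bound, or \<open>\<bar>Re z\<bar>\<close> is within \<open>1/4\<close> of the integer \<open>N\<close>.
\<close>

lemma exp_le_cos_circle:
  assumes N: "N \<ge> 1" and z: "norm z = real N"
  shows "exp (pi * \<bar>Im z\<bar>) \<le> 4 * norm (cos (of_real pi * z))"
proof (cases "\<bar>Im z\<bar> \<ge> 1/4")
  case True
  have e: "exp (pi * \<bar>Im z\<bar>) \<ge> 2"
  proof -
    have "pi * \<bar>Im z\<bar> \<ge> 3 * (1/4)" using True pi_gt3 by (intro mult_mono) auto
    then have "exp (pi * \<bar>Im z\<bar>) \<ge> exp (3/4)" by simp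
    moreover have "exp (3/4) \<ge> 1 + 3/4 + (3/4)\<^sup>2 / (2::real)" by (rule exp_lower_Taylor_quadratic) simp
    moreover have "1 + 3/4 + (3/4)\<^sup>2 / (2::real) \<ge> 2" by (simp add: power2_eq_square)
    ultimately show ?thesis by linarith
  qed
  then have "inverse (exp (pi * \<bar>Im z\<bar>)) \<le> 1/2" by (simp add: inverse_eq_divide field_simps)
  then have "exp (- (pi * \<bar>Im z\<bar>)) \<le> 1/2" by (simp add: exp_minus)
  then have "exp (pi * \<bar>Im z\<bar>) \<le> 4 * sinh (pi * \<bar>Im z\<bar>)" using e by (simp add: sinh_def)
  also have "pi * \<bar>Im z\<bar> = \<bar>Im (of_real pi * z)\<bar>" by (simp add: abs_mult)
  finally show ?thesis using norm_cos_ge_sinh[of "of_real pi * z"] by (simp add: abs_mult)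
next
  case False
  have "\<bar>Re z\<bar>\<^sup>2 = (real N)\<^sup>2 - (Im z)\<^sup>2" using z by (simp add: cmod_power2[symmetric] flip: z) (simp add: cmod_power2)
  moreover have "(Im z)\<^sup>2 \<le> (1/4)\<^sup>2" using False by (simp add: abs_le_square_iff[symmetric])
  ultimately have sq: "(real N - 1/4)\<^sup>2 \<le> \<bar>Re z\<bar>\<^sup>2"
    using N by (simp add: power2_eq_square algebra_simps)
  have "real N - 1/4 \<le> \<bar>Re z\<bar>" using power2_le_imp_le[OF sq] by simp
  moreover have "\<bar>Re z\<bar> \<le> real N" using abs_Re_le_cmod[of z] z by simp
  ultimately have d: "0 \<le> real N - \<bar>Re z\<bar>" "real N - \<bar>Re z\<bar> \<le> 1/4" by auto
  have "\<bar>cos (pi * Re z)\<bar> = \<bar>cos (pi * \<bar>Re z\<bar>)\<bar>" by (simp add: abs_if)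
  also have "pi * \<bar>Re z\<bar> = real N * pi - pi * (real N - \<bar>Re z\<bar>)" by (simp add: algebra_simps)
  also have "\<bar>cos \<dots>\<bar> = \<bar>cos (pi * (real N - \<bar>Re z\<bar>))\<bar>"
    by (simp add: cos_diff abs_mult power_abs)
  also have "\<dots> \<ge> 1/2"
  proof -
    have "pi * (real N - \<bar>Re z\<bar>) \<le> pi / 3" using d mult_left_mono[of "real N - \<bar>Re z\<bar>" "1/4" pi] by simp
    then have "cos (pi / 3) \<le> cos (pi * (real N - \<bar>Re z\<bar>))"
      using d by (intro cos_monotone_0_pi_le) (auto simp: field_simps)
    then show ?thesis by (simp add: cos_60)
  qed
  finally have c: "\<bar>cos (pi * Re z)\<bar> \<ge> 1/2" .
  have "exp (pi * \<bar>Im z\<bar>) \<le> 2 * cosh (pi * Im z)"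
    by (cases "Im z \<ge> 0") (auto simp: cosh_def abs_if)
  also have "\<dots> \<le> 4 * (\<bar>cos (pi * Re z)\<bar> * cosh (pi * Im z))"
    using mult_right_mono[OF c, of "cosh (pi * Im z)"] by simp
  also have "\<dots> \<le> 4 * norm (cos (of_real pi * z))"
    using norm_cos_ge_cos_cosh[of "of_real pi * z"] by simp
  finally show ?thesis .
qed

text \<open>
  The residue theorem on circles of integral radius \<open>N\<close> for \<open>F w / (cos (pi * w) * w * (w - z))\<close>. Since
  \<open>F / cos\<close> is merely bounded on these circles, the denominator carries the extra factor \<open>w\<close>: the integrand is then of
  order \<open>1 / N\<^sup>2\<close> on a curve of length \<open>2 * pi * N\<close>. The price is the residue at \<open>0\<close>, that is, the term \<open>F 0\<close>.
\<close>

lemma interpolation_series: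
  assumes F: "F holomorphic_on UNIV" and M: "\<And>w. norm (F w) \<le> M * exp (pi * \<bar>Im w\<bar>)"
    and z: "cos (of_real pi * z) \<noteq> 0" "z \<noteq> 0"
  shows "(\<lambda>N. \<Sum>n\<in>{- int N..<int N}. (-1) powi n * F (half_int n) / (half_int n * (half_int n - z)))
    \<longlonglongrightarrow> of_real pi / z * (F z / cos (of_real pi * z) - F 0)"
proof -
  define f where "f w = F w / (cos (of_real pi * w) * w * (w - z))" for w
  define S where "S N = (\<Sum>n\<in>{- int N..<int N}. (-1) powi n * F (half_int n) / (half_int n * (half_int n - z)))" for N :: nat
  define r where "r = F z / (z * cos (of_real pi * z)) - F 0 / z"
  have Fh: "F holomorphic_on A" for A by (rule holomorphic_on_subset[OF F]) simp
  have Fc: "isCont F w" for w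
    using holomorphic_on_imp_continuous_on[OF F] by (simp add: continuous_on_eq_continuous_at)
  have hi_ne0: "half_int n \<noteq> 0" for n
  proof -
    have "half_int n = of_int (2 * n + 1) / 2" by (simp add: half_int_def field_simps)
    moreover have "2 * n + 1 \<noteq> 0" by presburger
    ultimately show ?thesis by (metis divide_eq_0_iff of_int_eq_0_iff zero_neq_numeral)
  qed
  have hi_nez: "half_int n \<noteq> z" for n using z(1) cos_pi_eq_0_iff by auto
  have hi_inj: "inj half_int" by (auto simp: inj_on_def half_int_def)
  have M0: "M \<ge> 0" using order_trans[OF norm_ge_zero M[of 0]] by simp
  have main: "norm (2 * pi * \<i> * (r - S N / of_real pi)) \<le> 8 * pi * M / (real N - norm z)"
    if N: "N \<ge> 1" "real N > norm z" for N
  proof -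
    define J where "J = {- int N..<int N}"
    define pts where "pts = insert 0 (insert z (half_int ` J))"
    have normN: "norm (half_int n) < real N \<longleftrightarrow> n \<in> J" for n
    proof -
      have "half_int n = of_real (of_int n + 1/2)" by (simp add: half_int_def)
      then have "norm (half_int n) = \<bar>of_int n + 1/2\<bar>" by (simp only: norm_of_real)
      then have "norm (half_int n) < real N \<longleftrightarrow> \<bar>2 * n + 1\<bar> < 2 * int N" by linarith
      also have "\<dots> \<longleftrightarrow> n \<in> J" unfolding J_def by auto
      finally show ?thesis .
    qed
    have normNne: "norm (half_int n) \<noteq> real N" for n
    proof -
      have "half_int n = of_real (of_int n + 1/2)" by (simp add: half_int_def)
      then have "norm (half_int n) = \<bar>of_int n + 1/2\<bar>" by (simp only: norm_of_real)
      then have "norm (half_int n) = real N \<longleftrightarrow> \<bar>2 * n + 1\<bar> = 2 * int N" by linarith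
      then show ?thesis by presburger
    qed

    \<comment> \<open>A slightly larger disc: it contains the circle, and no half-integer lies between the two.\<close>
    define U where "U = ball (0::complex) (real N + 1/4)"
    have polesU: "p \<in> pts" if "p \<in> U" "cos (of_real pi * p) * p * (p - z) = 0" for p
    proof -
      from that(2) consider "p = 0" | "p = z" | n where "p = half_int n"
        using cos_pi_eq_0_iff[of p] by auto
      then show ?thesis
      proof cases
        case (3 n)
        have "half_int n = of_real (of_int n + 1/2)" by (simp add: half_int_def)
        then have "norm (half_int n) = \<bar>of_int n + 1/2\<bar>" by (simp only: norm_of_real)
        moreover have "norm (half_int n) < real N + 1/4" using that(1) 3 by (simp add: U_def)
        ultimately have "\<bar>2 * real_of_int n + 1\<bar> < 2 * real N + 1/2" by linarith
        then have "\<bar>2 * n + 1\<bar> \<le> 2 * int N" by linarith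
        then have "n \<in> J" unfolding J_def by auto
        then show ?thesis using 3 by (simp add: pts_def)
      qed (auto simp: pts_def)
    qed
    have fin: "finite pts" by (simp add: pts_def J_def)
    have hol: "f holomorphic_on U - pts"
      unfolding f_def using polesU by (intro holomorphic_intros Fh) auto
    have path: "path_image (circlepath 0 (real N)) \<subseteq> U - pts"
    proof -
      have "norm p \<noteq> real N" if "p \<in> pts" for p
        using that N normNne unfolding pts_def by auto
      then show ?thesis using N by (auto simp: U_def)
    qed
    have "contour_integral (circlepath 0 (real N)) f =
       2 * pi * \<i> * (\<Sum>p\<in>pts. winding_number (circlepath 0 (real N)) p * residue f p)"
    proof (rule Residue_theorem[of U])
      show "open U" "connected U" by (auto simp: U_def)
      show "\<forall>w. w \<notin> U \<longrightarrow> winding_number (circlepath 0 (real N)) w = 0"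
      proof (intro allI impI)
        fix w assume "w \<notin> U"
        then show "winding_number (circlepath 0 (real N)) w = 0"
          by (intro winding_number_zero_outside[of _ U]) (use path in \<open>auto simp: U_def\<close>)
      qed
    qed (use fin hol path in auto)
    also have "(\<Sum>p\<in>pts. winding_number (circlepath 0 (real N)) p * residue f p) = (\<Sum>p\<in>pts. residue f p)"
    proof (rule sum.cong)
      fix p assume "p \<in> pts"
      then have "norm (p - 0) < real N" using N normN by (auto simp: pts_def)
      then show "winding_number (circlepath 0 (real N)) p * residue f p = residue f p"
        by (simp add: winding_number_circlepath)
    qed simp
    also have "\<dots> = residue f 0 + residue f z + (\<Sum>n\<in>J. residue f (half_int n))"
    proof -
      have "z \<notin> half_int ` J" "0 \<notin> half_int ` J" "0 \<noteq> z"
        using hi_nez hi_ne0 z(2) by (auto simp: image_iff)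
      then have "(\<Sum>p\<in>pts. residue f p) = residue f 0 + (residue f z + (\<Sum>p\<in>half_int ` J. residue f p))"
        unfolding pts_def by (subst sum.insert; (subst sum.insert)?) (auto simp: J_def)
      also have "(\<Sum>p\<in>half_int ` J. residue f p) = (\<Sum>n\<in>J. residue f (half_int n))"
        by (subst sum.reindex) (auto intro: inj_on_subset[OF hi_inj])
      finally show ?thesis by (simp add: add.assoc)
    qed
    also have "\<dots> = r - S N / of_real pi"
    proof -
      have res: "residue f p = c" if "p \<in> pts" "((\<lambda>w. f w * (w - p)) \<longlongrightarrow> c) (at p)" for p c
      proof (rule residue_simple'[of "U - (pts - {p})"])
        show "open (U - (pts - {p}))"
          using fin by (intro open_Diff finite_imp_closed) (auto simp: U_def)
        have "norm p < real N" using N normN that(1) by (auto simp: pts_def)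
        then show "p \<in> U - (pts - {p})" by (simp add: U_def)
        show "f holomorphic_on U - (pts - {p}) - {p}"
          by (rule holomorphic_on_subset[OF hol]) auto
      qed (rule that(2))
      have ccos: "isCont (\<lambda>w. cos (of_real pi * w)) p" for p :: complex by (intro continuous_intros)
      have "((\<lambda>w. f w * (w - 0)) \<longlongrightarrow> F 0 / (cos (of_real pi * 0) * (0 - z))) (at 0)"
      proof (rule Lim_transform_eventually)
        show "((\<lambda>w. F w / (cos (of_real pi * w) * (w - z))) \<longlongrightarrow> F 0 / (cos (of_real pi * 0) * (0 - z))) (at 0)"
          using z(2) Fc[unfolded isCont_def] ccos[unfolded isCont_def] by (intro tendsto_intros) auto
        show "\<forall>\<^sub>F w in at 0. F w / (cos (of_real pi * w) * (w - z)) = f w * (w - 0)"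
          by (auto simp: eventually_at_filter f_def)
      qed
      then have r0: "residue f 0 = - F 0 / z"
        by (intro res) (auto simp: pts_def)
      have "((\<lambda>w. f w * (w - z)) \<longlongrightarrow> F z / (cos (of_real pi * z) * z)) (at z)"
      proof (rule Lim_transform_eventually)
        show "((\<lambda>w. F w / (cos (of_real pi * w) * w)) \<longlongrightarrow> F z / (cos (of_real pi * z) * z)) (at z)"
          using z Fc[unfolded isCont_def] ccos[unfolded isCont_def] by (intro tendsto_intros) auto
        show "\<forall>\<^sub>F w in at z. F w / (cos (of_real pi * w) * w) = f w * (w - z)"
          by (auto simp: eventually_at_filter f_def)
      qed
      then have rz: "residue f z = F z / (z * cos (of_real pi * z))"
        by (intro res) (auto simp: pts_def mult.commute)
      have rn: "residue f (half_int n) = - ((-1) powi n * F (half_int n) / (half_int n * (half_int n - z))) / of_real pi"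
        if "n \<in> J" for n
      proof -
        let ?p = "half_int n"
        define \<sigma> where "\<sigma> = ((-1) powi n :: complex)"
        have \<sigma>: "\<sigma> \<noteq> 0" "inverse \<sigma> = \<sigma>"
          unfolding \<sigma>_def by (auto simp: power_int_minus_left power_int_inverse[symmetric])
        have "((\<lambda>w. cos (of_real pi * w)) has_field_derivative - sin (of_real pi * ?p) * of_real pi) (at ?p)"
          by (auto intro!: derivative_eq_intros)
        then have "((\<lambda>w. (cos (of_real pi * w) - cos (of_real pi * ?p)) / (w - ?p)) \<longlongrightarrow> - \<sigma> * of_real pi) (at ?p)"
          by (simp add: has_field_derivative_iff sin_pi_half_int \<sigma>_def)
        moreover have "cos (of_real pi * ?p) = 0" using cos_pi_eq_0_iff by blast
        ultimately have "((\<lambda>w. cos (of_real pi * w) / (w - ?p)) \<longlongrightarrow> - \<sigma> * of_real pi) (at ?p)" by simp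
        then have "((\<lambda>w. F w / (w * (w - z)) * inverse (cos (of_real pi * w) / (w - ?p))) \<longlongrightarrow> F ?p / (?p * (?p - z)) * inverse (- \<sigma> * of_real pi)) (at ?p)"
          using Fc[unfolded isCont_def] hi_ne0[of n] hi_nez[of n] \<sigma>(1) by (intro tendsto_intros) auto
        then have "((\<lambda>w. f w * (w - ?p)) \<longlongrightarrow> F ?p / (?p * (?p - z)) * inverse (- \<sigma> * of_real pi)) (at ?p)"
          by (rule Lim_transform_eventually) (auto simp: eventually_at_filter f_def divide_simps)
        then have "residue f ?p = F ?p / (?p * (?p - z)) * inverse (- \<sigma> * of_real pi)"
          by (intro res) (use that in \<open>auto simp: pts_def\<close>)
        also have "inverse (- \<sigma> * of_real pi) = - \<sigma> / of_real pi"
          by (simp add: \<sigma>(2) inverse_mult_distrib divide_inverse)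
        finally show ?thesis by (simp add: \<sigma>_def)
      qed
      have "(\<Sum>n\<in>J. residue f (half_int n)) = (\<Sum>n\<in>J. - ((-1) powi n * F (half_int n) / (half_int n * (half_int n - z))) / of_real pi)"
        by (intro sum.cong refl rn)
      also have "\<dots> = - S N / of_real pi"
        by (simp only: S_def J_def sum_negf[symmetric] sum_divide_distrib)
      finally show ?thesis
        unfolding r0 rz by (simp add: r_def)
    qed
    finally have ci: "contour_integral (circlepath 0 (real N)) f = 2 * pi * \<i> * (r - S N / of_real pi)" .
    have "continuous_on (path_image (circlepath 0 (real N))) f"
      using holomorphic_on_imp_continuous_on[OF hol] path continuous_on_subset by blast
    then have "(f has_contour_integral (2 * pi * \<i> * (r - S N / of_real pi))) (circlepath 0 (real N))"
      using ci contour_integrable_continuous_circlepath has_contour_integral_integral by metis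
    then have "norm (2 * pi * \<i> * (r - S N / of_real pi)) \<le> 4 * M / (real N * (real N - norm z)) * (2 * pi * real N)"
    proof (rule has_contour_integral_bound_circlepath)
      fix w :: complex assume w: "norm (w - 0) = real N"
      then have wN: "norm w = real N" by simp
      have "norm (F w) \<le> M * (4 * norm (cos (of_real pi * w)))"
        using M[of w] exp_le_cos_circle[OF N(1) wN] M0 by (meson mult_left_mono order_trans)
      moreover have "norm (cos (of_real pi * w)) > 0"
        using exp_le_cos_circle[OF N(1) wN] by (smt (verit) exp_gt_zero)
      ultimately have "norm (F w) / norm (cos (of_real pi * w)) \<le> 4 * M"
        by (simp add: divide_simps mult_ac)
      moreover have "norm (w - z) \<ge> real N - norm z"
        using norm_triangle_ineq2[of w z] wN by simp
      ultimately have "(norm (F w) / norm (cos (of_real pi * w))) / (real N * norm (w - z)) \<le> 4 * M / (real N * (real N - norm z))"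
        using N M0 by (intro frac_le mult_left_mono mult_pos_pos) auto
      then show "norm (f w) \<le> 4 * M / (real N * (real N - norm z))"
        by (simp add: f_def norm_divide norm_mult wN mult_ac)
    qed (use N M0 in auto)
    also have "\<dots> = 8 * pi * M / (real N - norm z)"
      using N by (simp add: field_simps)
    finally show ?thesis by simp
  qed
  have "(\<lambda>N. 2 * pi * \<i> * (r - S N / of_real pi)) \<longlonglongrightarrow> 0"
  proof (rule Lim_null_comparison)
    show "\<forall>\<^sub>F N in sequentially. norm (2 * pi * \<i> * (r - S N / of_real pi)) \<le> 8 * pi * M / (real N - norm z)"
      using eventually_ge_at_top[of 1] eventually_gt_at_top[of "nat \<lceil>norm z\<rceil>"]
      by eventually_elim (rule main, auto, linarith)
    show "(\<lambda>N. 8 * pi * M / (real N - norm z)) \<longlonglongrightarrow> 0" by real_asymp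
  qed
  then have "(\<lambda>N. 2 * pi * \<i> * (r - S N / of_real pi) / (2 * pi * \<i>)) \<longlonglongrightarrow> 0 / (2 * pi * \<i>)"
    by (rule tendsto_divide) auto
  moreover have "2 * pi * \<i> * c / (2 * pi * \<i>) = c" for c :: complex by simp
  ultimately have "(\<lambda>N. r - S N / of_real pi) \<longlonglongrightarrow> 0" by (simp only: div_0)
  from tendsto_mult[OF tendsto_diff[OF tendsto_const[of r] this] tendsto_const[of "of_real pi"]]
  have "S \<longlonglongrightarrow> r * of_real pi" by simp
  also have "r * of_real pi = of_real pi / z * (F z / cos (of_real pi * z) - F 0)"
    using z by (simp add: r_def field_simps)
  finally show ?thesis by (simp add: S_def[abs_def])
qed

section \<open>The function K on the real line\<close>

definition K_term :: "real \<Rightarrow> complex \<Rightarrow> int \<Rightarrow> complex" where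
  "K_term lam z n = (-1) powi (n + 1) * gaussian lam (of_int n + 1/2) / (z - of_int n - 1/2)"

lemma gaussian_half_int: "gaussian lam (of_int n + 1/2) = of_real (exp (- (pi * lam) * (of_int n + 1/2)\<^sup>2))"
proof -
  have "(of_int n + 1/2 :: complex) = of_real (of_int n + 1/2)" by simp
  then show ?thesis by (simp only: gaussian_of_real)
qed

lemma norm_K_term: "norm (K_term lam z n) = exp (- (pi * lam) * (of_int n + 1/2)\<^sup>2) / norm (z - half_int n)"
  by (simp only: K_term_def norm_mult norm_divide gaussian_half_int norm_of_real norm_power_int half_int_def)
     (simp add: diff_diff_eq)

text \<open>
  One \<open>\<delta>\<close> serves all \<open>w\<close> near \<open>z\<close>, so that it controls the series of \<open>K_raw\<close> at \<open>z\<close> and its convergence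
  around \<open>z\<close>.
\<close>

lemma half_int_separated:
  assumes "cos (of_real pi * z) \<noteq> 0"
  obtains \<delta> where "\<delta> > 0" "\<And>w n. dist w z < \<delta> \<Longrightarrow> norm (w - half_int n) \<ge> \<delta>"
proof -
  have "isCont (\<lambda>w. cos (of_real pi * w)) z" by (intro continuous_intros)
  from continuous_at_avoid[OF this assms]
  obtain e where e: "e > 0" "\<And>w. dist z w < e \<Longrightarrow> cos (of_real pi * w) \<noteq> 0" by blast
  show ?thesis
  proof (rule that[of "e/2"])
    show "e/2 > 0" using e by simp
    fix w n assume w: "dist w z < e/2"
    have "cos (of_real pi * half_int n) = 0" using cos_pi_eq_0_iff by blast
    then have "dist z (half_int n) \<ge> e" using e(2)[of "half_int n"] by force
    then show "norm (w - half_int n) \<ge> e/2"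
      using w dist_triangle[of z "half_int n" w] by (simp add: dist_norm norm_minus_commute)
  qed
qed

lemma summable_K_term:
  assumes "lam > 0" "cos (of_real pi * z) \<noteq> 0"
  shows "summable (\<lambda>k. norm (K_term lam z (int k)))" "summable (\<lambda>k. norm (K_term lam z (- 1 - int k)))"
proof -
  obtain \<delta> where \<delta>: "\<delta> > 0" "\<And>w n. dist w z < \<delta> \<Longrightarrow> norm (w - half_int n) \<ge> \<delta>"
    using half_int_separated[OF assms(2)] by blast
  have summ: "summable (\<lambda>k. exp (- (pi * lam) * (real k + 1/2)\<^sup>2) / \<delta>)"
    using summable_divide[OF summable_gaussian_nat[of "pi * lam" 0], of \<delta>] assms(1) by simp
  have bound: "norm (norm (K_term lam z n)) \<le> exp (- (pi * lam) * (of_int n + 1/2)\<^sup>2) / \<delta>" for n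
    unfolding norm_K_term using \<delta>(2)[of z n] \<delta>(1) by (simp add: frac_le)
  have sq: "(of_int (- 1 - int k) + 1/2 :: real)\<^sup>2 = (real k + 1/2)\<^sup>2" for k
    by (simp add: power2_eq_square algebra_simps)
  show "summable (\<lambda>k. norm (K_term lam z (int k)))"
    by (rule summable_comparison_test'[OF summ, of 0]) (use bound[of "int _"] in simp)
  show "summable (\<lambda>k. norm (K_term lam z (- 1 - int k)))"
    by (rule summable_comparison_test'[OF summ, of 0]) (use bound[of "- 1 - int _", unfolded sq] in simp)
qed

lemma K_raw_eq_suminf:
  assumes "lam > 0" "cos (of_real pi * z) \<noteq> 0"
  shows "K_raw lam z = cos (of_real pi * z) / of_real pi * (\<Sum>k. K_term lam z (int k) + K_term lam z (- 1 - int k))"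
  unfolding K_raw_def K_term_def[symmetric] infsum_int_eq_suminf[OF summable_K_term[OF assms]] ..

lemma sum_symmetric_int_range:
  fixes f :: "int \<Rightarrow> 'a :: ab_group_add"
  shows "(\<Sum>n\<in>{- int N..<int N}. f n) = (\<Sum>k<N. f (int k) + f (- 1 - int k))"
proof (induction N)
  case 0
  then show ?case by simp
next
  case (Suc N)
  have "{- int (Suc N)..<int (Suc N)} = insert (int N) (insert (- 1 - int N) {- int N..<int N})" by auto
  then show ?case using Suc by (simp add: add_ac)
qed

lemma K_raw_symmetric_limit:
  assumes "lam > 0" "cos (of_real pi * z) \<noteq> 0"
  shows "(\<lambda>N. \<Sum>n\<in>{- int N..<int N}. K_term lam z n) \<longlonglongrightarrow> of_real pi * K_raw lam z / cos (of_real pi * z)"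
proof -
  have "summable (\<lambda>k. K_term lam z (int k) + K_term lam z (- 1 - int k))"
    by (rule summable_add[OF summable_norm_cancel[OF summable_K_term(1)[OF assms]] summable_norm_cancel[OF summable_K_term(2)[OF assms]]])
  from summable_LIMSEQ[OF this]
  have "(\<lambda>N. \<Sum>n\<in>{- int N..<int N}. K_term lam z n) \<longlonglongrightarrow> (\<Sum>k. K_term lam z (int k) + K_term lam z (- 1 - int k))"
    by (simp only: sum_symmetric_int_range)
  moreover have "(\<Sum>k. K_term lam z (int k) + K_term lam z (- 1 - int k)) = of_real pi * K_raw lam z / cos (of_real pi * z)"
    using assms(2) by (simp add: K_raw_eq_suminf[OF assms])
  ultimately show ?thesis by simp
qed

text \<open>
  The series converges uniformly near \<open>z\<close>. Consequently \<^const>\<open>remove_sings\<close> does not change \<open>K_raw\<close> at \<open>z\<close>.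
\<close>

lemma K_raw_tendsto:
  assumes "lam > 0" "cos (of_real pi * z) \<noteq> 0"
  shows "K_raw lam \<midarrow>z\<rightarrow> K_raw lam z"
proof -
  obtain \<delta> where \<delta>: "\<delta> > 0" "\<And>w n. dist w z < \<delta> \<Longrightarrow> norm (w - half_int n) \<ge> \<delta>"
    using half_int_separated[OF assms(2)] by blast
  have near: "eventually (\<lambda>w. dist w z < \<delta>) (at z)"
    using \<delta>(1) eventually_at by blast
  have cont: "((\<lambda>w. K_term lam w n) \<longlongrightarrow> K_term lam z n) (at z)" for n
  proof -
    have "z - of_int n - 1/2 \<noteq> 0" using \<delta>(2)[of z n] \<delta>(1) by (auto simp: half_int_def diff_diff_eq)
    then show ?thesis unfolding K_term_def by (intro tendsto_intros)
  qed
  have bound: "norm (K_term lam w n) \<le> exp (- (pi * lam) * (of_int n + 1/2)\<^sup>2) / \<delta>" if "dist w z < \<delta>" for w n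
    unfolding norm_K_term using \<delta>(2)[OF that, of n] \<delta>(1) by (simp add: frac_le)
  have sq: "(of_int (- 1 - int k) + 1/2 :: real)\<^sup>2 = (real k + 1/2)\<^sup>2" for k
    by (simp add: power2_eq_square algebra_simps)
  have "((\<lambda>w. \<Sum>k. K_term lam w (int k) + K_term lam w (- 1 - int k)) \<longlongrightarrow> (\<Sum>k. K_term lam z (int k) + K_term lam z (- 1 - int k))) (at z)"
  proof (rule suminf_tendsto_dominated(1))
    show "((\<lambda>w. K_term lam w (int k) + K_term lam w (- 1 - int k)) \<longlongrightarrow> K_term lam z (int k) + K_term lam z (- 1 - int k)) (at z)" for k
      by (intro tendsto_add cont)
    show "summable (\<lambda>k. 2 / \<delta> * exp (- (pi * lam) * (real k + 1/2)\<^sup>2))"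
      using summable_mult[OF summable_gaussian_nat[of "pi * lam" 0], of "2 / \<delta>"] assms(1) by simp
    show "eventually (\<lambda>w. \<forall>k. norm (K_term lam w (int k) + K_term lam w (- 1 - int k)) \<le> 2 / \<delta> * exp (- (pi * lam) * (real k + 1/2)\<^sup>2)) (at z)"
      using near
    proof eventually_elim
      case (elim w)
      show ?case
      proof
        fix k
        have "norm (K_term lam w (int k) + K_term lam w (- 1 - int k)) \<le> norm (K_term lam w (int k)) + norm (K_term lam w (- 1 - int k))"
          by (rule norm_triangle_ineq)
        also have "\<dots> \<le> exp (- (pi * lam) * (real k + 1/2)\<^sup>2) / \<delta> + exp (- (pi * lam) * (real k + 1/2)\<^sup>2) / \<delta>"
          using bound[OF elim, of "int k"] bound[OF elim, of "- 1 - int k", unfolded sq] by (intro add_mono) simp_all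
        finally show "norm (K_term lam w (int k) + K_term lam w (- 1 - int k)) \<le> 2 / \<delta> * exp (- (pi * lam) * (real k + 1/2)\<^sup>2)"
          by simp
      qed
    qed
  qed simp
  then have "((\<lambda>w. cos (of_real pi * w) / of_real pi * (\<Sum>k. K_term lam w (int k) + K_term lam w (- 1 - int k))) \<longlongrightarrow> K_raw lam z) (at z)"
    unfolding K_raw_eq_suminf[OF assms] by (intro tendsto_intros) auto
  moreover have "eventually (\<lambda>w. cos (of_real pi * w) / of_real pi * (\<Sum>k. K_term lam w (int k) + K_term lam w (- 1 - int k)) = K_raw lam w) (at z)"
    using near
  proof eventually_elim
    case (elim w)
    have "w \<noteq> half_int n" for n using \<delta>(2)[OF elim, of n] \<delta>(1) by auto
    then have "cos (of_real pi * w) \<noteq> 0" using cos_pi_eq_0_iff[of w] by auto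
    then show ?case by (simp add: K_raw_eq_suminf[OF assms(1)])
  qed
  ultimately show ?thesis by (rule Lim_transform_eventually)
qed

lemma K_eq_K_raw:
  assumes "lam > 0" "cos (of_real pi * z) \<noteq> 0"
  shows "K lam z = K_raw lam z"
  unfolding K_def by (rule remove_sings_eqI[OF K_raw_tendsto[OF assms]])

lemma cos_of_real_pi: "cos (of_real pi * complex_of_real x) = of_real (cos (pi * x))"
  by (simp only: of_real_mult[symmetric] cos_of_real)

lemma K_term_pair_real:
  assumes "cos (pi * x) \<noteq> 0"
  shows "K_term lam (of_real x) (int k) + K_term lam (of_real x) (- 1 - int k) =
    of_real (2 * ((-1)^k * exp (- (pi * lam) * (half_odd k)\<^sup>2) * half_odd k / ((half_odd k)\<^sup>2 - x\<^sup>2)))"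
proof -
  define h where "h = half_odd k"
  define q where "q = exp (- (pi * lam) * h\<^sup>2)"
  define s :: real where "s = (-1)^k"
  have ne: "h\<^sup>2 \<noteq> x\<^sup>2" unfolding h_def by (rule half_odd_sq_ne[OF assms])
  then have ne': "x - h \<noteq> 0" "x + h \<noteq> 0" "h\<^sup>2 - x\<^sup>2 \<noteq> 0"
    by (auto simp: power2_eq_square) (auto simp: square_eq_iff eq_neg_iff_add_eq_0 add.commute)
  have g1: "gaussian lam (of_int (int k) + 1/2) = of_real q"
    unfolding gaussian_half_int q_def h_def half_odd_def by simp
  have sq: "(of_int (- 1 - int k) + 1/2 :: real)\<^sup>2 = (real k + 1/2)\<^sup>2"
    by (simp add: power2_eq_square algebra_simps)
  have g2: "gaussian lam (of_int (- 1 - int k) + 1/2) = of_real q"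
    unfolding gaussian_half_int sq q_def h_def half_odd_def by simp
  have p1: "(-1) powi (int k + 1) = complex_of_real (- s)"
    unfolding s_def by (simp add: power_int_minus_left minus_one_power_iff)
  have p2: "(-1) powi (- 1 - int k + 1) = complex_of_real s"
    unfolding s_def by (simp add: power_int_minus_left minus_one_power_iff)
  have d1: "complex_of_real x - of_int (int k) - 1/2 = of_real (x - h)" by (simp add: h_def half_odd_def)
  have d2: "complex_of_real x - of_int (- 1 - int k) - 1/2 = of_real (x + h)" by (simp add: h_def half_odd_def)
  have "K_term lam (of_real x) (int k) + K_term lam (of_real x) (- 1 - int k) =
     of_real (- s * q / (x - h) + s * q / (x + h))"
    unfolding K_term_def g1 g2 p1 p2 d1 d2 by simp
  also have "- s * q / (x - h) + s * q / (x + h) = 2 * (s * q * h / (h\<^sup>2 - x\<^sup>2))"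
    using ne' by (simp add: divide_simps) (simp add: power2_eq_square algebra_simps)
  finally show ?thesis by (simp only: s_def q_def h_def)
qed

lemma K_raw_of_real:
  assumes "lam > 0" "cos (pi * x) \<noteq> 0"
  shows "K_raw lam (of_real x) = of_real (2 / pi * cos (pi * x) *
      (\<Sum>n. (-1)^n * exp (- (pi * lam) * (half_odd n)\<^sup>2) * half_odd n / ((half_odd n)\<^sup>2 - x\<^sup>2)))"
    and "summable (\<lambda>n. (-1)^n * exp (- (pi * lam) * (half_odd n)\<^sup>2) * half_odd n / ((half_odd n)\<^sup>2 - x\<^sup>2))"
proof -
  define t where "t n = (-1)^n * exp (- (pi * lam) * (half_odd n)\<^sup>2) * half_odd n / ((half_odd n)\<^sup>2 - x\<^sup>2)" for n
  have cz: "cos (of_real pi * complex_of_real x) \<noteq> 0" using assms(2) by (simp add: cos_of_real_pi)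
  have pair: "K_term lam (of_real x) (int k) + K_term lam (of_real x) (- 1 - int k) = of_real (2 * t k)" for k
    unfolding t_def by (rule K_term_pair_real[OF assms(2)])
  have "summable (\<lambda>k. K_term lam (of_real x) (int k) + K_term lam (of_real x) (- 1 - int k))"
    by (rule summable_add[OF summable_norm_cancel[OF summable_K_term(1)[OF assms(1) cz]] summable_norm_cancel[OF summable_K_term(2)[OF assms(1) cz]]])
  then have "summable (\<lambda>k. 2 * t k)" unfolding pair by (simp only: summable_complex_of_real)
  then show t: "summable t" by (rule summable_mult_D) simp
  have "K_raw lam (of_real x) = of_real (cos (pi * x)) / of_real pi * (\<Sum>k. complex_of_real (2 * t k))"
    unfolding K_raw_eq_suminf[OF assms(1) cz] pair cos_of_real_pi ..
  also have "(\<Sum>k. complex_of_real (2 * t k)) = of_real (2 * suminf t)"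
    using t by (simp only: suminf_of_real[symmetric] suminf_mult summable_mult)
  finally show "K_raw lam (of_real x) = of_real (2 / pi * cos (pi * x) * (\<Sum>n. t n))"
    by simp
qed

text \<open>
  Put \<open>h = n + 1/2\<close>. The cosine vanishes at \<open>h\<close> and \<open>- h\<close>, so \<open>\<bar>cos (pi * x)\<bar>\<close> is at most \<open>pi\<close> times the
  distance of \<open>x\<close> from either point; this bounds the quotient \<open>T\<close> by \<open>pi\<close>. The decay in \<open>x\<close> comes from
  \<open>T * x\<^sup>2 = T * h\<^sup>2 - cos (pi * x) * h\<close>.
\<close>

lemma cos_kernel_bound:
  assumes "cos (pi * x) \<noteq> 0"
  shows "\<bar>cos (pi * x) * (half_odd n / ((half_odd n)\<^sup>2 - x\<^sup>2))\<bar> \<le> (pi * (1 + (half_odd n)\<^sup>2) + half_odd n) / (1 + x\<^sup>2)"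
proof -
  define h where "h = half_odd n"
  define c where "c = cos (pi * x)"
  have h: "h > 0" unfolding h_def by (rule half_odd_pos)
  have ne: "h\<^sup>2 \<noteq> x\<^sup>2" unfolding h_def by (rule half_odd_sq_ne[OF assms])
  then have ne': "h - x \<noteq> 0" "h + x \<noteq> 0"
    by (auto simp: power2_eq_square square_eq_iff eq_neg_iff_add_eq_0 add.commute)
  have c0: "cos (pi * (\<epsilon> * h)) = 0" if "\<epsilon> = 1 \<or> \<epsilon> = - 1" for \<epsilon>
  proof -
    have "cos (pi * h) = 0" by (simp add: h_def half_odd_def distrib_left cos_add)
    then show ?thesis using that by auto
  qed
  have lip: "\<bar>c\<bar> \<le> pi * \<bar>\<epsilon> * h - x\<bar>" if e: "\<epsilon> = 1 \<or> \<epsilon> = - 1" for \<epsilon>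
  proof -
    have "c = cos (pi * x) - cos (pi * (\<epsilon> * h))" using c0[OF e] by (simp add: c_def)
    also have "\<bar>\<dots>\<bar> \<le> \<bar>pi * x - pi * (\<epsilon> * h)\<bar>"
    proof -
      have "\<bar>cos u - cos v\<bar> \<le> \<bar>u - v\<bar>" for u v :: real
      proof -
        have "\<bar>cos u - cos v\<bar> = 2 * (\<bar>sin ((u + v) / 2)\<bar> * \<bar>sin ((v - u) / 2)\<bar>)"
          by (simp add: cos_diff_cos abs_mult)
        also have "\<dots> \<le> 2 * (1 * \<bar>(v - u) / 2\<bar>)"
          by (intro mult_left_mono mult_mono abs_sin_x_le_abs_x) auto
        finally show ?thesis by simp
      qed
      then show ?thesis .
    qed
    also have "\<dots> = pi * \<bar>\<epsilon> * h - x\<bar>" by (simp add: abs_mult abs_minus_commute flip: right_diff_distrib)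
    finally show ?thesis .
  qed
  have b1: "\<bar>c / (h - x)\<bar> \<le> pi" using lip[of 1] ne' by (simp add: pos_divide_le_eq)
  have b2: "\<bar>c / (h + x)\<bar> \<le> pi"
  proof -
    have "\<bar>c\<bar> \<le> pi * \<bar>h + x\<bar>" using lip[of "-1"] by (simp add: abs_minus_commute) (metis abs_minus_cancel minus_diff_eq diff_minus_eq_add add.commute)
    then show ?thesis using ne' by (simp add: pos_divide_le_eq)
  qed
  define T where "T = c * (h / (h\<^sup>2 - x\<^sup>2))"
  have "T = (c / (h - x) + c / (h + x)) / 2"
    using ne' ne unfolding T_def by (simp add: divide_simps power2_eq_square) (simp add: algebra_simps)
  moreover have "\<bar>(u + v) / 2\<bar> \<le> pi" if "\<bar>u\<bar> \<le> pi" "\<bar>v\<bar> \<le> pi" for u v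
    using that by (auto simp: abs_le_iff)
  ultimately have T: "\<bar>T\<bar> \<le> pi" using b1 b2 by (simp only:)
  have "T * x\<^sup>2 = T * h\<^sup>2 - c * h"
    unfolding T_def using ne by (simp add: divide_simps) (simp add: algebra_simps)
  then have "\<bar>T * x\<^sup>2\<bar> \<le> \<bar>T\<bar> * h\<^sup>2 + \<bar>c\<bar> * h"
    using abs_triangle_ineq4[of "T * h\<^sup>2" "c * h"] h by (simp add: abs_mult)
  also have "\<dots> \<le> pi * h\<^sup>2 + 1 * h"
    using T h by (intro add_mono mult_right_mono) (auto simp: c_def)
  finally have "\<bar>T\<bar> * (1 + x\<^sup>2) \<le> pi * (1 + h\<^sup>2) + h"
    using T by (simp add: abs_mult algebra_simps)
  moreover have "1 + x\<^sup>2 > 0" by (simp add: add_pos_nonneg)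
  ultimately have "\<bar>T\<bar> \<le> (pi * (1 + h\<^sup>2) + h) / (1 + x\<^sup>2)" by (simp add: pos_le_divide_eq)
  then show ?thesis by (simp only: T_def h_def c_def)
qed

text \<open>
  The bound is integrable over the real line. It makes \<open>K\<close> a competitor with finite error, and it serves in
  the proof of uniqueness as well.
\<close>

lemma K_raw_decay:
  assumes "lam > 0"
  obtains C where "\<And>x. cos (pi * x) \<noteq> 0 \<Longrightarrow> norm (K_raw lam (of_real x)) \<le> C * inverse (1 + (x - 0)\<^sup>2)"
proof -
  define q where "q n = exp (- (pi * lam) * (half_odd n)\<^sup>2)" for n
  define B where "B n = q n * (pi * (1 + (half_odd n)\<^sup>2) + half_odd n)" for n
  have summ: "summable B"
  proof -
    have "summable (\<lambda>k. real k ^ p * q k)" for p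
      using summable_gaussian_nat[of "pi * lam" p] assms by (simp add: q_def half_odd_def)
    from summable_add[OF summable_add[OF summable_mult[OF this[of 0], of "pi * (5/4) + 1/2"] summable_mult[OF this[of 1], of "pi + 1"]] summable_mult[OF this[of 2], of pi]]
    show ?thesis
      by (rule summable_cong[THEN iffD1, rotated]) (auto intro!: always_eventually simp: B_def half_odd_def power2_eq_square algebra_simps)
  qed
  show ?thesis
  proof (rule that[of "2 / pi * suminf B"])
    fix x assume x: "cos (pi * x) \<noteq> 0"
    define t where "t n = (-1)^n * q n * half_odd n / ((half_odd n)\<^sup>2 - x\<^sup>2)" for n
    have t: "summable t" using K_raw_of_real(2)[OF assms x] by (simp add: t_def[abs_def] q_def)
    have bt: "norm (cos (pi * x) * t n) \<le> B n / (1 + x\<^sup>2)" for n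
    proof -
      have "norm (cos (pi * x) * t n) = q n * \<bar>cos (pi * x) * (half_odd n / ((half_odd n)\<^sup>2 - x\<^sup>2))\<bar>"
        by (simp add: t_def abs_mult q_def power_abs)
      also have "\<dots> \<le> q n * ((pi * (1 + (half_odd n)\<^sup>2) + half_odd n) / (1 + x\<^sup>2))"
        by (intro mult_left_mono cos_kernel_bound[OF x]) (simp add: q_def)
      finally show ?thesis by (simp add: B_def)
    qed
    have "norm (K_raw lam (of_real x)) = 2 / pi * \<bar>cos (pi * x) * suminf t\<bar>"
      unfolding K_raw_of_real(1)[OF assms x] norm_of_real by (simp add: abs_mult t_def[abs_def] q_def)
    also have "cos (pi * x) * suminf t = (\<Sum>n. cos (pi * x) * t n)"
      by (rule suminf_mult[OF t, symmetric])
    also have "\<bar>\<dots>\<bar> \<le> (\<Sum>n. B n / (1 + x\<^sup>2))"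
      using norm_suminf_le[OF bt summable_divide[OF summ]] by simp
    also have "\<dots> = suminf B / (1 + x\<^sup>2)" by (rule suminf_divide[OF summ])
    finally show "norm (K_raw lam (of_real x)) \<le> 2 / pi * suminf B * inverse (1 + (x - 0)\<^sup>2)"
      by (simp add: divide_inverse mult_left_mono)
  qed
qed

section \<open>Uniqueness and extremality\<close>

text \<open>
  The Fourier coefficients of the square wave sit at odd multiples of \<open>pi\<close>, where the transform of \<open>F\<close> vanishes.
\<close>

lemma square_wave_annihilates_exp_type:
  assumes F: "entire_exp_type_le pi F" and int: "integrable lborel (\<lambda>x. F (of_real x))"
  shows "(LBINT x. F (of_real x) * of_real (sgn (cos (pi * x)))) = 0"
proof -
  have "(LBINT x. F (of_real x) * of_real (sgn (cos (pi * x)))) = of_real (4 / pi) * (\<Sum>k. (-1)^k * 0 / of_nat (2*k+1))"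
  proof (rule square_wave_integral_expansion[OF int])
    fix k :: nat
    define \<xi> where "\<xi> = real (2*k+1) * pi"
    have \<xi>: "\<bar>\<xi>\<bar> \<ge> pi" "\<bar>- \<xi>\<bar> \<ge> pi" by (simp_all add: \<xi>_def)
    have int_e: "integrable lborel (\<lambda>x. F (of_real x) * exp (\<i> * of_real \<eta> * of_real x))" for \<eta>
      by (rule integrable_mult_cis[OF int])
    have "complex_of_real (cos (real (2*k+1) * (pi * x))) = (exp (\<i> * of_real \<xi> * of_real x) + exp (\<i> * of_real (- \<xi>) * of_real x)) / 2" for x
    proof -
      have "complex_of_real (cos (real (2*k+1) * (pi * x))) = cos (of_real (\<xi> * x))"
        by (simp only: cos_of_real \<xi>_def mult.assoc)
      then show ?thesis by (simp add: cos_exp_eq mult.assoc)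
    qed
    then have "(LBINT x. F (of_real x) * of_real (cos (real (2*k+1) * (pi * x)))) =
      (LBINT x. (F (of_real x) * exp (\<i> * of_real \<xi> * of_real x) + F (of_real x) * exp (\<i> * of_real (- \<xi>) * of_real x)) / 2)"
      by (simp only: times_divide_eq_right distrib_left)
    also have "\<dots> = ((LBINT x. F (of_real x) * exp (\<i> * of_real \<xi> * of_real x)) + (LBINT x. F (of_real x) * exp (\<i> * of_real (- \<xi>) * of_real x))) / 2"
      by (simp only: integral_divide_zero Bochner_Integration.integral_add[OF int_e int_e])
    also have "\<dots> = 0"
      using fourier_vanishes_outside_type[OF F _ \<xi>(1) int] fourier_vanishes_outside_type[OF F _ \<xi>(2) int] by simp
    finally show "0 = (LBINT x. F (of_real x) * of_real (cos (real (2*k+1) * (pi * x))))" ..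
  qed simp
  then show ?thesis by simp
qed

lemma entire_exp_type_cos_pi: "entire_exp_type_le pi (\<lambda>z. cos (of_real pi * z))"
proof (rule entire_exp_type_le_of_Im_bound[where C = 1])
  show "norm (cos (of_real pi * z)) \<le> 1 * exp (pi * \<bar>Im z\<bar>)" for z
    using norm_cos_le_exp_Im[of "of_real pi * z"] by (simp add: abs_mult)
qed (auto intro!: holomorphic_intros)

text \<open>
  If it were, the square wave would annihilate it, but the product of the two is \<open>\<bar>cos (pi * x)\<bar>\<close>.
\<close>

lemma cos_pi_not_integrable: "\<not> integrable lborel (\<lambda>x. cos (pi * x))"
proof
  assume int: "integrable lborel (\<lambda>x. cos (pi * x))"
  then have "integrable lborel (\<lambda>x. cos (of_real pi * complex_of_real x))"
    by (simp add: cos_of_real_pi)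
  from square_wave_annihilates_exp_type[OF entire_exp_type_cos_pi this]
  have "(LBINT x. complex_of_real (cos (pi * x) * sgn (cos (pi * x)))) = 0"
    by (simp only: cos_of_real_pi of_real_mult)
  then have "(LBINT x. \<bar>cos (pi * x)\<bar>) = 0"
    by (simp only: integral_complex_of_real of_real_eq_0_iff abs_sgn)
  then have "AE x in lborel. \<bar>cos (pi * x)\<bar> = 0"
    using integrable_abs[OF int] by (subst (asm) integral_nonneg_eq_0_iff_AE) auto
  with AE_cos_pi_nonzero have "AE x in lborel. cos (pi * x) \<noteq> 0 \<and> \<bar>cos (pi * x)\<bar> = 0"
    by (rule AE_conjI)
  then show False by (simp add: ae_filter_eq_bot_iff)
qed

text \<open>
  With \<open>1 / (h - w) = 1 / h + w / (h * (h - w))\<close> for each half-integer \<open>h\<close>, the interpolation series of \<open>F\<close> turns into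
  the series of \<open>K_raw\<close> at \<open>w\<close> and at \<open>0\<close>, and \<open>F - K_raw\<close> is \<open>c * cos (pi * w)\<close>. Integrability on the real
  line forces \<open>c = 0\<close>.
\<close>

lemma interpolant_unique:
  assumes lam: "lam > 0" and F: "entire_exp_type_le pi F" and int: "integrable lborel (\<lambda>x. F (of_real x))"
    and node: "\<And>n. F (half_int n) = gaussian lam (half_int n)"
  shows "F z = K lam z"
proof -
  have hol: "F holomorphic_on UNIV" using F by (simp add: entire_exp_type_le_def)
  obtain M where M: "\<And>z. norm (F z) \<le> M * exp (pi * \<bar>Im z\<bar>)"
    using integrable_exp_type_bound[OF F int] by blast
  define c where "c = F 0 - K_raw lam 0"
  have rep: "F w = K_raw lam w + c * cos (of_real pi * w)" if w: "cos (of_real pi * w) \<noteq> 0" "w \<noteq> 0" for w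
  proof -
    have hne: "half_int n \<noteq> 0" "half_int n \<noteq> w" for n
      using cos_pi_eq_0_iff[of 0] cos_pi_eq_0_iff[of w] w by auto
    have "K_term lam w n = K_term lam 0 n + w * ((-1) powi n * F (half_int n) / (half_int n * (half_int n - w)))" for n
    proof -
      define h where "h = half_int n"
      define s where "s = (-1) powi n * gaussian lam h"
      have h: "h \<noteq> 0" "h - w \<noteq> 0" "w - h \<noteq> 0" using hne[of n] by (auto simp: h_def)
      have K: "K_term lam v n = - s / (v - h)" for v
        by (simp add: K_term_def s_def h_def half_int_def power_int_add diff_diff_eq)
      have "- s / (w - h) = - s / (0 - h) + w * (s / (h * (h - w)))"
        using h by (simp add: divide_simps) (simp add: algebra_simps)
      then show ?thesis unfolding K node by (simp add: s_def h_def)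
    qed
    then have "(\<lambda>N. \<Sum>n\<in>{- int N..<int N}. K_term lam w n) =
      (\<lambda>N. (\<Sum>n\<in>{- int N..<int N}. K_term lam 0 n) + w * (\<Sum>n\<in>{- int N..<int N}. (-1) powi n * F (half_int n) / (half_int n * (half_int n - w))))"
      by (simp only: sum.distrib sum_distrib_left)
    moreover have "(\<lambda>N. (\<Sum>n\<in>{- int N..<int N}. K_term lam 0 n) + w * (\<Sum>n\<in>{- int N..<int N}. (-1) powi n * F (half_int n) / (half_int n * (half_int n - w))))
       \<longlonglongrightarrow> of_real pi * K_raw lam 0 / cos (of_real pi * 0) + w * (of_real pi / w * (F w / cos (of_real pi * w) - F 0))"
      by (intro tendsto_add tendsto_mult tendsto_const K_raw_symmetric_limit[OF lam] interpolation_series[OF hol M w]) simp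
    ultimately have "of_real pi * K_raw lam w / cos (of_real pi * w) =
       of_real pi * K_raw lam 0 / cos (of_real pi * 0) + w * (of_real pi / w * (F w / cos (of_real pi * w) - F 0))"
      using LIMSEQ_unique[OF K_raw_symmetric_limit[OF lam w(1)]] by simp
    also have "\<dots> = of_real pi * (F w / cos (of_real pi * w) - c)"
      using w(2) by (simp add: c_def algebra_simps)
    finally have "K_raw lam w / cos (of_real pi * w) = F w / cos (of_real pi * w) - c"
      by (simp add: mult.commute flip: times_divide_eq_right)
    then show ?thesis using w(1) by (simp add: field_simps)
  qed
  have "c = 0"
  proof (rule ccontr)
    assume "c \<noteq> 0"
    obtain C where C: "\<And>x. cos (pi * x) \<noteq> 0 \<Longrightarrow> norm (K_raw lam (of_real x)) \<le> C * inverse (1 + (x - 0)\<^sup>2)"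
      using K_raw_decay[OF lam] by blast
    have "integrable lborel (\<lambda>x. cos (pi * x))"
    proof (rule Bochner_Integration.integrable_bound)
      show "integrable lborel (\<lambda>x. (norm (F (of_real x)) + C * inverse (1 + (x - 0)\<^sup>2)) * (1 / norm c))"
        using int by (intro integrable_mult_left Bochner_Integration.integrable_add integrable_mult_right integrable_inverse_1_plus_square_shift) auto
      show "AE x in lborel. norm (cos (pi * x)) \<le> norm ((norm (F (of_real x)) + C * inverse (1 + (x - 0)\<^sup>2)) * (1 / norm c))"
        using AE_cos_pi_nonzero AE_lborel_singleton[of 0]
      proof eventually_elim
        case (elim x)
        have cz: "cos (of_real pi * complex_of_real x) \<noteq> 0" using elim by (simp add: cos_of_real_pi)
        have "c * of_real (cos (pi * x)) = F (of_real x) - K_raw lam (of_real x)"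
          using rep[OF cz] elim by (simp add: cos_of_real_pi)
        then have "norm c * \<bar>cos (pi * x)\<bar> = norm (F (of_real x) - K_raw lam (of_real x))"
          by (metis norm_mult norm_of_real)
        also have "\<dots> \<le> norm (F (of_real x)) + C * inverse (1 + (x - 0)\<^sup>2)"
          using norm_triangle_ineq4 C[OF elim(1)] by (meson add_left_mono order_trans)
        finally have "\<bar>cos (pi * x)\<bar> \<le> (norm (F (of_real x)) + C * inverse (1 + (x - 0)\<^sup>2)) * (1 / norm c)"
          using \<open>c \<noteq> 0\<close> by (simp add: pos_le_divide_eq mult.commute)
        then show ?case by (smt (verit) real_norm_def)
      qed
    qed simp
    then show False using cos_pi_not_integrable by blast
  qed
  have "eventually (\<lambda>w. cos (of_real pi * w) \<noteq> 0) (at z)"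
  proof -
    have "eventually (\<lambda>w. w \<notin> range half_int) (at z)"
    proof (cases "cos (of_real pi * z) = 0")
      case False
      then obtain \<delta> where \<delta>: "\<delta> > 0" "\<And>w n. dist w z < \<delta> \<Longrightarrow> norm (w - half_int n) \<ge> \<delta>"
        using half_int_separated by blast
      have "eventually (\<lambda>w. dist w z < \<delta>) (at z)" using \<delta>(1) eventually_at by blast
      then show ?thesis
      proof eventually_elim
        case (elim w)
        show ?case
        proof
          assume "w \<in> range half_int"
          then obtain n where "w = half_int n" by blast
          then show False using \<delta>(2)[OF elim, of n] \<delta>(1) by simp
        qed
      qed
    next
      case True
      then obtain n where n: "z = half_int n" using cos_pi_eq_0_iff by blast
      have "half_int m = half_int n" if "dist (half_int m) z < 1" for m
      proof -
        have "half_int m - half_int n = of_int (m - n)" by (simp add: half_int_def)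
        then have "norm (of_int (m - n) :: complex) < 1" using that by (simp add: n dist_norm)
        then have "m = n" by (simp only: norm_of_int)
        then show ?thesis by simp
      qed
      then have "\<forall>w. w \<noteq> z \<and> dist w z < 1 \<longrightarrow> w \<notin> range half_int" using n by auto
      then show ?thesis unfolding eventually_at by (intro exI[of _ 1]) auto
    qed
    then show ?thesis by (simp add: cos_pi_eq_0_iff)
  qed
  then have "eventually (\<lambda>w. K_raw lam w = F w) (at z)"
    using eventually_neq_at_within[of 0 z UNIV]
    by eventually_elim (use rep \<open>c = 0\<close> in auto)
  then have "remove_sings (K_raw lam) z = remove_sings F z" by (rule remove_sings_cong) simp
  also have "remove_sings F z = F z"
    using hol by (intro remove_sings_at_analytic) (metis analytic_on_open analytic_on_subset open_UNIV subset_UNIV)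
  finally show ?thesis by (simp add: K_def)
qed

lemma AE_exists_in_interval:
  assumes "AE x in lborel. P x" "a < (b::real)"
  shows "\<exists>x. a < x \<and> x < b \<and> P x"
proof (rule ccontr)
  assume "\<not> ?thesis"
  then have "AE x in lborel. x \<notin> {a<..<b}" using assms(1) by (auto elim!: eventually_mono)
  then have "emeasure lborel {a<..<b} = 0" by (subst (asm) AE_iff_measurable[of "{a<..<b}"]) auto
  then show False using assms(2) by simp
qed

lemma cos_pi_near_half_int:
  obtains s :: real where "\<bar>s\<bar> = 1" "\<And>t. cos (pi * (of_int n + 1/2 + t)) = - s * sin (pi * t)"
proof (rule that[of "sin (pi * (of_int n + 1/2))"])
  have c: "cos (pi * (of_int n + 1/2)) = 0"
    by (simp add: distrib_left cos_add)
  then have "sin (pi * (of_int n + 1/2)) = 1 \<or> sin (pi * (of_int n + 1/2)) = - 1"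
    using sin_cos_squared_add[of "pi * (of_int n + 1/2)"] by (simp add: power2_eq_1_iff)
  then show "\<bar>sin (pi * (of_int n + 1/2))\<bar> = 1" by (metis abs_minus_cancel abs_one)
  show "cos (pi * (of_int n + 1/2 + t)) = - sin (pi * (of_int n + 1/2)) * sin (pi * t)" for t
    using c by (simp add: distrib_left[of pi "of_int n + 1/2" t] cos_add)
qed

text \<open>
  There are points arbitrarily close to \<open>n + 1/2\<close> on either side where \<open>D\<close> is real with the sign of the
  cosine. These signs are opposite, which continuity permits only if \<open>D\<close> vanishes at \<open>n + 1/2\<close>.
\<close>

lemma zero_at_half_int_of_sign:
  fixes D :: "real \<Rightarrow> complex"
  assumes cont: "isCont D (of_int n + 1/2)"
    and ae: "AE x in lborel. norm (D x) = Re (D x * of_real (sgn (cos (pi * x))))"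
  shows "D (of_int n + 1/2) = 0"
proof (rule ccontr)
  define a :: real where "a = of_int n + 1/2"
  assume "D (of_int n + 1/2) \<noteq> 0"
  then have pos: "norm (D a) / 2 > 0" by (simp add: a_def)
  obtain d where d: "d > 0" "\<And>x. \<bar>x - a\<bar> < d \<Longrightarrow> norm (D x - D a) < norm (D a) / 2"
    using cont pos unfolding continuous_at_eps_delta a_def[symmetric] by (metis dist_norm real_norm_def)
  obtain s where s: "\<bar>s\<bar> = (1::real)" "\<And>t. cos (pi * (a + t)) = - s * sin (pi * t)"
    using cos_pi_near_half_int[of n] unfolding a_def by metis
  define e where "e = min d 1"
  have e: "e > 0" "e \<le> d" "e \<le> 1" using d by (auto simp: e_def)
  obtain x where x: "a < x" "x < a + e" "norm (D x) = Re (D x * of_real (sgn (cos (pi * x))))"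
    using AE_exists_in_interval[OF ae, of a "a + e"] e by auto
  obtain y where y: "a - e < y" "y < a" "norm (D y) = Re (D y * of_real (sgn (cos (pi * y))))"
    using AE_exists_in_interval[OF ae, of "a - e" a] e by auto
  have "sin (pi * (x - a)) > 0"
    using x e by (intro sin_gt_zero) (auto intro!: mult_less_cancel_left_pos[THEN iffD2, of pi _ 1, simplified])
  then have sx: "sgn (cos (pi * x)) = - s"
    using s(2)[of "x - a"] s(1) by (auto simp: sgn_mult abs_if split: if_splits)
  have "sin (pi * (a - y)) > 0"
    using y e by (intro sin_gt_zero) (auto intro!: mult_less_cancel_left_pos[THEN iffD2, of pi _ 1, simplified])
  then have "sin (pi * (y - a)) < 0" by (metis minus_diff_eq mult_minus_right neg_0_less_iff_less sin_minus)
  then have sy: "sgn (cos (pi * y)) = s"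
    using s(2)[of "y - a"] s(1) by (auto simp: sgn_mult abs_if split: if_splits)
  have "norm (D x) + norm (D y) = s * Re (D y - D x)"
    using x(3) y(3) by (simp add: sx sy algebra_simps)
  also have "\<dots> \<le> \<bar>s\<bar> * \<bar>Re (D y - D x)\<bar>" by (metis abs_ge_self abs_mult)
  also have "\<dots> \<le> norm (D y - D x)" using s(1) abs_Re_le_cmod[of "D y - D x"] by simp
  finally have le: "norm (D x) + norm (D y) \<le> norm (D y - D x)" .
  have nx: "norm (D x - D a) < norm (D a) / 2" using x e by (intro d(2)) auto
  have ny: "norm (D y - D a) < norm (D a) / 2" using y e by (intro d(2)) auto
  have "norm (D y - D x) \<le> norm (D y - D a) + norm (D x - D a)"
    using norm_triangle_ineq4[of "D y - D a" "D x - D a"] by simp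
  moreover have "norm (D a) \<le> norm (D x) + norm (D x - D a)"
    using norm_triangle_ineq4[of "D x" "D x - D a"] by simp
  moreover have "norm (D a) \<le> norm (D y) + norm (D y - D a)"
    using norm_triangle_ineq4[of "D y" "D y - D a"] by simp
  ultimately show False using le nx ny by linarith
qed

theorem theorem1:
  fixes lam :: real and F :: "complex \<Rightarrow> complex"
  assumes "lam > 0" and "entire_exp_type_le pi F"
  shows "ereal (lam powr (-1/2) *
             Re (integral {-1/2..1/2::real} (\<lambda>u. theta1 (of_real u) (\<i> * of_real (1/lam)))))
           \<le> enn2ereal (\<integral>\<^sup>+x. ennreal (norm (gaussian lam (of_real x) - F (of_real x))) \<partial>lborel)
       \<and> (ereal (lam powr (-1/2) *
             Re (integral {-1/2..1/2::real} (\<lambda>u. theta1 (of_real u) (\<i> * of_real (1/lam)))))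
           = enn2ereal (\<integral>\<^sup>+x. ennreal (norm (gaussian lam (of_real x) - F (of_real x))) \<partial>lborel)
         \<longleftrightarrow> (\<forall>z. F z = K lam z))"
proof -
  define L where "L = lam powr (-1/2) * Re (integral {-1/2..1/2::real} (\<lambda>u. theta1 (of_real u) (\<i> * of_real (1/lam))))"
  define G where "G x = exp (- (pi * lam) * x\<^sup>2)" for x
  define \<sigma> where "\<sigma> x = sgn (cos (pi * x))" for x
  define D where "D x = gaussian lam (of_real x) - F (of_real x)" for x :: real
  have hol: "F holomorphic_on UNIV" using assms(2) by (simp add: entire_exp_type_le_def)
  have G: "gaussian lam (of_real x) = of_real (G x)" for x by (simp only: gaussian_of_real G_def)
  have G_int: "integrable lborel G" using gaussian_cos_transform(1)[OF assms(1)] by (simp add: G_def[abs_def])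
  have F_cont: "continuous_on UNIV (\<lambda>x::real. F (of_real x))"
    by (rule continuous_on_compose2[OF holomorphic_on_imp_continuous_on[OF hol]]) (auto intro: continuous_intros)
  have D_cont: "continuous_on UNIV D"
    unfolding D_def gaussian_def by (intro continuous_intros F_cont)
  have [measurable]: "D \<in> borel_measurable borel" by (rule borel_measurable_continuous_onI[OF D_cont])
  have [measurable]: "\<sigma> \<in> borel_measurable borel" unfolding \<sigma>_def by measurable
  have \<sigma>_le: "\<bar>\<sigma> x\<bar> \<le> 1" for x by (simp add: \<sigma>_def sgn_if)
  have L: "L = (LBINT x. G x * \<sigma> x)"
    unfolding L_def G_def \<sigma>_def by (rule gaussian_square_wave_eq_theta[OF assms(1), symmetric])
  define I where "I = (\<integral>\<^sup>+x. ennreal (norm (D x)) \<partial>lborel)"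
  have K_int: "integrable lborel (\<lambda>x. F (of_real x))" if FK: "\<forall>z. F z = K lam z"
  proof -
    obtain C where C: "\<And>x. cos (pi * x) \<noteq> 0 \<Longrightarrow> norm (K_raw lam (of_real x)) \<le> C * inverse (1 + (x - 0)\<^sup>2)"
      using K_raw_decay[OF assms(1)] by blast
    show ?thesis
    proof (rule Bochner_Integration.integrable_bound)
      show "integrable lborel (\<lambda>x::real. C * inverse (1 + (x - 0)\<^sup>2))"
        by (intro integrable_mult_right integrable_inverse_1_plus_square_shift)
      show "(\<lambda>x. F (of_real x)) \<in> borel_measurable lborel"
        using borel_measurable_continuous_onI[OF F_cont] by simp
      show "AE x in lborel. norm (F (of_real x)) \<le> norm (C * inverse (1 + (x - 0)\<^sup>2))"
        using AE_cos_pi_nonzero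
      proof eventually_elim
        case (elim x)
        have "F (of_real x) = K_raw lam (of_real x)"
          using FK K_eq_K_raw[OF assms(1)] elim by (simp add: cos_of_real_pi)
        then show ?case using C[OF elim] by (smt (verit) real_norm_def)
      qed
    qed
  qed
  have "ereal L \<le> enn2ereal I \<and> (ereal L = enn2ereal I \<longleftrightarrow> (\<forall>z. F z = K lam z))"
  proof (cases "integrable lborel (\<lambda>x. F (of_real x))")
    case True
    have D_int: "integrable lborel D"
      unfolding D_def G using G_int True by (intro Bochner_Integration.integrable_diff) auto
    have I: "enn2ereal I = ereal (LBINT x. norm (D x))"
      unfolding I_def using D_int by (subst nn_integral_eq_integral) (auto simp: enn2ereal_ennreal)
    have DR_int: "integrable lborel (\<lambda>x. D x * of_real (\<sigma> x))"
    proof (rule Bochner_Integration.integrable_bound[OF D_int])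
      show "AE x in lborel. norm (D x * of_real (\<sigma> x)) \<le> norm (D x)"
        using \<sigma>_le by (intro AE_I2) (simp add: norm_mult mult_left_le)
    qed simp
    have F\<sigma>_int: "integrable lborel (\<lambda>x. F (of_real x) * of_real (\<sigma> x))"
    proof (rule Bochner_Integration.integrable_bound[OF True])
      have [measurable]: "(\<lambda>x::real. F (of_real x)) \<in> borel_measurable borel"
        by (rule borel_measurable_continuous_onI[OF F_cont])
      show "(\<lambda>x. F (of_real x) * of_real (\<sigma> x)) \<in> borel_measurable lborel" by measurable
      show "AE x in lborel. norm (F (of_real x) * of_real (\<sigma> x)) \<le> norm (F (of_real x))"
        using \<sigma>_le by (intro AE_I2) (simp add: norm_mult mult_left_le)
    qed
    have "(LBINT x. D x * of_real (\<sigma> x)) + (LBINT x. F (of_real x) * of_real (\<sigma> x)) =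
       (LBINT x. D x * of_real (\<sigma> x) + F (of_real x) * of_real (\<sigma> x))"
      by (rule Bochner_Integration.integral_add[OF DR_int F\<sigma>_int, symmetric])
    also have "\<dots> = (LBINT x. complex_of_real (G x * \<sigma> x))"
      by (rule Bochner_Integration.integral_cong) (auto simp: D_def G algebra_simps)
    also have "\<dots> = of_real L" by (simp only: integral_complex_of_real L)
    finally have "(LBINT x. D x * of_real (\<sigma> x)) = of_real L"
      using square_wave_annihilates_exp_type[OF assms(2) True] by (simp add: \<sigma>_def)
    then have LR: "L = (LBINT x. Re (D x * of_real (\<sigma> x)))"
      by (simp only: integral_Re[OF DR_int] Re_complex_of_real)
    have le: "Re (D x * of_real (\<sigma> x)) \<le> norm (D x)" for x
    proof -
      have "Re (D x * of_real (\<sigma> x)) \<le> norm (D x * of_real (\<sigma> x))" by (rule complex_Re_le_cmod)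
      also have "\<dots> \<le> norm (D x)" using \<sigma>_le by (simp add: norm_mult mult_left_le)
      finally show ?thesis .
    qed
    have Re_int: "integrable lborel (\<lambda>x. Re (D x * of_real (\<sigma> x)))" by (rule integrable_Re[OF DR_int])
    have Dn_int: "integrable lborel (\<lambda>x. norm (D x))" by (rule integrable_norm[OF D_int])
    have ineq: "L \<le> (LBINT x. norm (D x))"
      unfolding LR by (rule integral_mono[OF Re_int Dn_int le])
    have eq_iff: "L = (LBINT x. norm (D x)) \<longleftrightarrow> (AE x in lborel. norm (D x) = Re (D x * of_real (\<sigma> x)))"
    proof -
      have "L = (LBINT x. norm (D x)) \<longleftrightarrow> (LBINT x. norm (D x) - Re (D x * of_real (\<sigma> x))) = 0"
        unfolding LR by (subst Bochner_Integration.integral_diff[OF Dn_int Re_int]) auto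
      also have "\<dots> \<longleftrightarrow> (AE x in lborel. norm (D x) - Re (D x * of_real (\<sigma> x)) = 0)"
        by (rule integral_nonneg_eq_0_iff_AE) (use Dn_int Re_int le in auto)
      finally show ?thesis by simp
    qed
    have "(AE x in lborel. norm (D x) = Re (D x * of_real (\<sigma> x))) \<longleftrightarrow> (\<forall>z. F z = K lam z)"
    proof
      assume ae: "AE x in lborel. norm (D x) = Re (D x * of_real (\<sigma> x))"
      show "\<forall>z. F z = K lam z"
      proof
        fix z
        show "F z = K lam z"
        proof (rule interpolant_unique[OF assms True])
          fix n
          have "D (of_int n + 1/2) = 0"
            using zero_at_half_int_of_sign[where D = D and n = n] D_cont ae
            by (simp add: \<sigma>_def continuous_on_eq_continuous_at)
          moreover have "half_int n = of_real (of_int n + 1/2)" by (simp add: half_int_def)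
          ultimately show "F (half_int n) = gaussian lam (half_int n)" by (simp only: D_def) simp
        qed
      qed
    next
      assume FK: "\<forall>z. F z = K lam z"
      have "AE x in lborel. x \<notin> range real_of_int"
        by (rule AE_not_in, rule countable_imp_null_set_lborel) simp
      then have sin_ae: "AE x in lborel. sin (pi * x) \<noteq> 0"
        by eventually_elim (auto simp: sin_zero_iff_int2)
      show "AE x in lborel. norm (D x) = Re (D x * of_real (\<sigma> x))"
        using sin_ae AE_cos_pi_nonzero
      proof eventually_elim
        case (elim x)
        define k where "k = 2 / pi * cos (pi * x) *
          (\<Sum>n. (-1)^n * exp (- (pi * lam) * (half_odd n)\<^sup>2) * half_odd n / ((half_odd n)\<^sup>2 - x\<^sup>2))"
        have "F (of_real x) = K_raw lam (of_real x)"
          using FK K_eq_K_raw[OF assms(1)] elim by (simp add: cos_of_real_pi)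
        also have "\<dots> = of_real k" unfolding k_def by (rule K_raw_of_real(1)[OF assms(1) elim(2)])
        finally have Dx: "D x = of_real (G x - k)" by (simp add: D_def G)
        have "(G x - k) * cos (pi * x) \<ge> 0"
          unfolding G_def k_def by (rule gaussian_minus_interpolant_sign[OF assms(1) elim])
        then have "\<bar>G x - k\<bar> = (G x - k) * \<sigma> x"
          using elim(2) by (auto simp: \<sigma>_def sgn_if zero_le_mult_iff split: if_splits)
        then show ?case unfolding Dx norm_of_real by (simp flip: of_real_mult)
      qed
    qed
    then show ?thesis using ineq eq_iff by (simp add: I)
  next
    case False
    have "I = \<infinity>"
    proof (rule ccontr)
      assume "I \<noteq> \<infinity>"
      then have "integrable lborel D"
        unfolding I_def by (intro integrableI_bounded) (auto simp: top.not_eq_extremum less_top)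
      then have "integrable lborel (\<lambda>x. of_real (G x) - D x)"
        using G_int by (intro Bochner_Integration.integrable_diff) auto
      then show False using False by (simp add: D_def G)
    qed
    moreover have "\<not> (\<forall>z. F z = K lam z)" using K_int False by blast
    ultimately show ?thesis by (simp add: infinity_ennreal_def)
  qed
  then show ?thesis by (simp only: L_def I_def D_def)
qed

end
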